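(* Let $\omega$ be an open strict interval of $\mathbb T$ with $\partial\omega=\{\zeta_1,\zeta_2\}$ and let $T>0$. Suppose $g\in L^2(\mathbb T)$ satisfies (1) $\operatorname{supp} g \subset \overline\omega$; (2) $\sum_{n<0} |n|\, |\widehat g(n)|^2 <+\infty$; (3) $\int_{0}^{2\pi}\frac{|g(e^{it})|^2}{|(e^{it}-\zeta_1)(e^{it}-\zeta_2)|}\,dt<\infty$. Then $P_+g\in \mathcal{NC}_{H^2}(\omega,T)$.
   Context: $\mathbb T$ is the complex unit circle, identified with $\mathbb R/2\pi\mathbb Z$ via $x\mapsto e^{ix}$. An open strict interval of $\mathbb T$ is an open arc $\{e^{ix}:a<x<b\}$ with $0<b-a<2\pi$; $\overline\omega$ is its topological closure. Functions are complex valued; $f\in L^2(\mathbb T)$ is written $f(e^{ix})=\sum_{n\in\mathbb Z}\widehat f(n)e^{inx}$. The Riesz projector is $P_+f(e^{ix})=\sum_{n\ge 0}\widehat f(n)e^{inx}$, and $H^2=P_+L^2(\mathbb T)$. Let $S(t)f(e^{ix})=\sum_{n}\widehat f(n)e^{-|n|t}e^{inx}$ (the semigroup generated by $-|D|$, $|D|f=\sum_n|n|\widehat f(n)e^{inx}$). The $H^2$ control system is $(\partial_t+|D|)f(t,e^{ix})=P_+\mathbf 1_\omega u(t,e^{ix})$, $f(0,\cdot)=f_0\in H^2$, with control $u\in L^2([0,T]\times\omega)$; its solution satisfies $f(T,\cdot)=S(T)f_0+\int_0^TS(T-s)P_+(\mathbf 1_\omega u(s,\cdot))\,ds$, where $\mathbf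 1_\omega u$ denotes the extension of $u$ by $0$ outside $\omega$. $\mathcal{NC}_{H^2}(\omega,T)$ is the set of $f_0\in H^2$ for which there is $u\in L^2([0,T]\times\omega)$ with $f(T,\cdot)=0$. (This set does not depend on $T>0$.) *)

theory Defs
  imports "HOL-Analysis.Analysis"
begin

section \<open>The Hilbert space of square integrable functions on the unit circle\<close>

(* The push-forward of dx on [0, 2 pi) under x |-> e^(ix); it has total mass 2 pi and does not
   charge the complement of the unit circle, so that functions on the circle are represented by
   functions on the complex plane. *)
definition circle_measure :: "complex measure"
  where "circle_measure = distr (restrict_space lborel {0..<2*pi}) borel cis"

definition square_integrable :: "(complex \<Rightarrow> complex) \<Rightarrow> bool"
  where "square_integrable f \<longleftrightarrow> f \<in> borel_measurable circle_measure
    \<and> integrable circle_measure (\<lambda>z. (cmod (f z))\<^sup>2)"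

lemma space_circle [simp]: "space circle_measure = UNIV"
  by (simp add: circle_measure_def)

lemma sets_circle [measurable_cong, simp]: "sets circle_measure = sets borel"
  by (simp add: circle_measure_def)

lemma cis_measurable_restrict [measurable]: "cis \<in> borel_measurable (restrict_space lborel A)"
proof -
  have "cis \<in> borel_measurable borel"
    by (intro borel_measurable_continuous_onI continuous_intros)
  then show ?thesis
    by (intro measurable_restrict_space1) simp
qed

lemma emeasure_circle: "emeasure circle_measure UNIV = ennreal (2 * pi)"
  by (simp add: circle_measure_def emeasure_distr emeasure_restrict_space space_restrict_space)

interpretation circle: finite_measure circle_measure
  by standard (simp add: emeasure_circle)

lemma square_integrable_measurable:
  "square_integrable f \<Longrightarrow> f \<in> borel_measurable circle_measure"
  by (simp add: square_integrable_def)

lemma square_integrableI_bound: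
  assumes "g \<in> borel_measurable circle_measure" "integrable circle_measure h"
    and "\<And>z. (cmod (g z))\<^sup>2 \<le> h z"
  shows "square_integrable g"
  unfolding square_integrable_def
proof
  show "integrable circle_measure (\<lambda>z. (cmod (g z))\<^sup>2)"
    by (rule Bochner_Integration.integrable_bound[OF assms(2)])
       (use assms in \<open>auto intro: order_trans[OF assms(3) abs_ge_self]\<close>)
qed (use assms in simp)

lemma sum_power2_le: "(cmod (a + b))\<^sup>2 \<le> 2 * (cmod a)\<^sup>2 + 2 * (cmod b)\<^sup>2"
proof -
  have "(cmod (a + b))\<^sup>2 \<le> (cmod a + cmod b)\<^sup>2"
    by (intro power_mono norm_triangle_ineq) auto
  also have "\<dots> \<le> 2 * (cmod a)\<^sup>2 + 2 * (cmod b)\<^sup>2"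
    using zero_le_power2[of "cmod a - cmod b"] by (simp add: power2_eq_square algebra_simps)
  finally show ?thesis .
qed

lemma square_integrable_add:
  assumes "square_integrable f" "square_integrable g"
  shows "square_integrable (\<lambda>z. f z + g z)"
proof (rule square_integrableI_bound)
  show "integrable circle_measure (\<lambda>z. 2 * (cmod (f z))\<^sup>2 + 2 * (cmod (g z))\<^sup>2)"
    using assms by (auto simp: square_integrable_def)
  show "(\<lambda>z. f z + g z) \<in> borel_measurable circle_measure"
    using assms by (auto simp: square_integrable_def)
qed (rule sum_power2_le)

lemma square_integrable_mult:
  assumes "square_integrable f"
  shows "square_integrable (\<lambda>z. c * f z)"
proof (rule square_integrableI_bound)
  show "integrable circle_measure (\<lambda>z. (cmod c)\<^sup>2 * (cmod (f z))\<^sup>2)"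
    using assms by (auto simp: square_integrable_def)
  show "(\<lambda>z. c * f z) \<in> borel_measurable circle_measure"
    using assms by (auto simp: square_integrable_def)
qed (simp add: norm_mult power_mult_distrib)

lemma square_integrable_scaleR:
  "square_integrable f \<Longrightarrow> square_integrable (\<lambda>z. r *\<^sub>R f z)"
  by (simp add: scaleR_conv_of_real square_integrable_mult)

lemma square_integrable_uminus:
  "square_integrable f \<Longrightarrow> square_integrable (\<lambda>z. - f z)"
  by (simp add: square_integrable_def)

lemma square_integrable_diff:
  "square_integrable f \<Longrightarrow> square_integrable g \<Longrightarrow> square_integrable (\<lambda>z. f z - g z)"
  using square_integrable_add[of f "\<lambda>z. - g z"] square_integrable_uminus by simp

lemma square_integrable_zero: "square_integrable (\<lambda>z. 0)"
  by (simp add: square_integrable_def)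

lemma square_integrable_bounded:
  assumes "f \<in> borel_measurable borel" "\<And>z. cmod (f z) \<le> B"
  shows "square_integrable f"
proof (rule square_integrableI_bound)
  show "integrable circle_measure (\<lambda>z. B\<^sup>2)" by simp
  show "(cmod (f z))\<^sup>2 \<le> B\<^sup>2" for z
    using assms(2) by (intro power_mono) auto
qed (use assms in simp)

lemma integrable_inner_circle:
  assumes "square_integrable f" "square_integrable g"
  shows "integrable circle_measure (\<lambda>z. f z \<bullet> g z)"
proof (rule Bochner_Integration.integrable_bound)
  show "integrable circle_measure (\<lambda>z. (cmod (f z))\<^sup>2 + (cmod (g z))\<^sup>2)"
    using assms by (auto simp: square_integrable_def)
  show "(\<lambda>z. f z \<bullet> g z) \<in> borel_measurable circle_measure"
    using assms by (auto simp: square_integrable_def)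
  have "\<bar>x \<bullet> y\<bar> \<le> (cmod x)\<^sup>2 + (cmod y)\<^sup>2" for x y
  proof -
    have "\<bar>x \<bullet> y\<bar> \<le> cmod x * cmod y" by (rule Cauchy_Schwarz_ineq2)
    also have "\<dots> \<le> (cmod x)\<^sup>2 + (cmod y)\<^sup>2"
    proof -
      have "0 \<le> cmod x * cmod y" by simp
      then show ?thesis
        using sum_squares_bound[of "cmod x" "cmod y"] by linarith
    qed
    finally show ?thesis .
  qed
  then show "AE z in circle_measure. norm (f z \<bullet> g z) \<le> norm ((cmod (f z))\<^sup>2 + (cmod (g z))\<^sup>2)"
    by simp
qed

definition ae_equal :: "(complex \<Rightarrow> complex) \<Rightarrow> (complex \<Rightarrow> complex) \<Rightarrow> bool"
  where "ae_equal f g \<longleftrightarrow> square_integrable f \<and> square_integrable g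
    \<and> (AE z in circle_measure. f z = g z)"

quotient_type L2_circle = "complex \<Rightarrow> complex" / partial: ae_equal
proof (rule part_equivpI)
  show "\<exists>x. ae_equal x x"
    using square_integrable_zero by (auto simp: ae_equal_def)
  show "symp ae_equal"
    by (auto simp: symp_def ae_equal_def)
  show "transp ae_equal"
    unfolding transp_def ae_equal_def by auto
qed

lemma square_integrable_rep: "square_integrable (rep_L2_circle f)"
  using Quotient_rep_reflp[OF Quotient_L2_circle, of f] by (simp add: ae_equal_def)

lemma rep_abs_L2_circle:
  assumes "square_integrable f"
  shows "AE z in circle_measure. rep_L2_circle (abs_L2_circle f) z = f z"
  using Quotient_rep_abs[OF Quotient_L2_circle, of f] assms by (simp add: ae_equal_def)

lemma L2_circle_eqI:
  assumes "AE z in circle_measure. rep_L2_circle f z = rep_L2_circle g z"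
  shows "f = g"
  using Quotient_rel_rep[OF Quotient_L2_circle, of f g] assms square_integrable_rep
  by (simp add: ae_equal_def)

instantiation L2_circle :: real_inner
begin

lift_definition zero_L2_circle :: L2_circle is "\<lambda>z. 0"
  by (simp add: ae_equal_def square_integrable_zero)

lift_definition plus_L2_circle :: "L2_circle \<Rightarrow> L2_circle \<Rightarrow> L2_circle" is "\<lambda>f g z. f z + g z"
  unfolding ae_equal_def by (auto intro: square_integrable_add)

lift_definition minus_L2_circle :: "L2_circle \<Rightarrow> L2_circle \<Rightarrow> L2_circle" is "\<lambda>f g z. f z - g z"
  unfolding ae_equal_def by (auto intro: square_integrable_diff)

lift_definition uminus_L2_circle :: "L2_circle \<Rightarrow> L2_circle" is "\<lambda>f z. - f z"
  unfolding ae_equal_def by (auto intro: square_integrable_uminus)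

lift_definition scaleR_L2_circle :: "real \<Rightarrow> L2_circle \<Rightarrow> L2_circle" is "\<lambda>r f z. r *\<^sub>R f z"
  unfolding ae_equal_def by (auto intro: square_integrable_scaleR)

lift_definition inner_L2_circle :: "L2_circle \<Rightarrow> L2_circle \<Rightarrow> real"
  is "\<lambda>f g. \<integral>z. f z \<bullet> g z \<partial>circle_measure"
proof -
  fix f f' g g' assume "ae_equal f f'" "ae_equal g g'"
  then show "(\<integral>z. f z \<bullet> g z \<partial>circle_measure) = (\<integral>z. f' z \<bullet> g' z \<partial>circle_measure)"
    using integrable_inner_circle[of f g] integrable_inner_circle[of f' g']
    by (intro integral_cong_AE) (auto simp: ae_equal_def)
qed

definition norm_L2_circle :: "L2_circle \<Rightarrow> real"
  where "norm_L2_circle f = sqrt (f \<bullet> f)"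

definition dist_L2_circle :: "L2_circle \<Rightarrow> L2_circle \<Rightarrow> real"
  where "dist_L2_circle f g = norm (f - g)"

definition sgn_L2_circle :: "L2_circle \<Rightarrow> L2_circle"
  where "sgn_L2_circle f = inverse (norm f) *\<^sub>R f"

definition uniformity_L2_circle :: "(L2_circle \<times> L2_circle) filter"
  where "uniformity_L2_circle = (INF e\<in>{0<..}. principal {(x, y). dist x y < e})"

definition open_L2_circle :: "L2_circle set \<Rightarrow> bool"
  where "open_L2_circle U \<longleftrightarrow> (\<forall>x\<in>U. eventually (\<lambda>(x', y). x' = x \<longrightarrow> y \<in> U) uniformity)"

instance
proof
  fix f g h :: L2_circle and r s :: real
  show "f + g + h = f + (g + h)"
    by (transfer, auto simp: ae_equal_def add.assoc intro!: square_integrable_add)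
  show "f + g = g + f"
    by (transfer, auto simp: ae_equal_def add.commute intro!: square_integrable_add)
  show "0 + f = f"
    by (transfer, auto simp: ae_equal_def)
  show "- f + f = 0"
    by (transfer, auto simp: ae_equal_def square_integrable_zero)
  show "f - g = f + - g"
    by (transfer, auto simp: ae_equal_def square_integrable_diff)
  show "r *\<^sub>R (f + g) = r *\<^sub>R f + r *\<^sub>R g"
    by (transfer, auto simp: ae_equal_def scaleR_add_right
        intro!: square_integrable_add square_integrable_scaleR)
  show "(r + s) *\<^sub>R f = r *\<^sub>R f + s *\<^sub>R f"
    by (transfer, auto simp: ae_equal_def scaleR_add_left
        intro!: square_integrable_add square_integrable_scaleR)
  show "r *\<^sub>R s *\<^sub>R f = (r * s) *\<^sub>R f"
    by (transfer, auto simp: ae_equal_def square_integrable_scaleR mult.assoc)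
  show "1 *\<^sub>R f = f"
    by (transfer, auto simp: ae_equal_def)
  show "dist f g = norm (f - g)"
    by (rule dist_L2_circle_def)
  show "sgn f = inverse (norm f) *\<^sub>R f"
    by (rule sgn_L2_circle_def)
  show "uniformity = (INF e\<in>{0<..}. principal {(x, y::L2_circle). dist x y < e})"
    by (rule uniformity_L2_circle_def)
  show "open U \<longleftrightarrow> (\<forall>x\<in>U. eventually (\<lambda>(x', y). x' = x \<longrightarrow> y \<in> U) uniformity)"
    for U :: "L2_circle set"
    by (rule open_L2_circle_def)
  show "f \<bullet> g = g \<bullet> f"
    by (transfer, simp add: inner_commute)
  show "(f + g) \<bullet> h = f \<bullet> h + g \<bullet> h"
    by (transfer, simp add: inner_add_left integrable_inner_circle ae_equal_def)
  show "(r *\<^sub>R f) \<bullet> g = r * (f \<bullet> g)"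
    by (transfer, simp)
  show "0 \<le> f \<bullet> f"
    by (transfer, simp)
  show "f \<bullet> f = 0 \<longleftrightarrow> f = 0"
  proof (transfer)
    fix f assume f: "ae_equal f f"
    then have "integrable circle_measure (\<lambda>z. f z \<bullet> f z)"
      by (simp add: ae_equal_def integrable_inner_circle)
    from integral_nonneg_eq_0_iff_AE[OF this]
    show "((\<integral>z. f z \<bullet> f z \<partial>circle_measure) = 0) = ae_equal f (\<lambda>z. 0)"
      using f square_integrable_zero by (simp add: ae_equal_def)
  qed
  show "norm f = sqrt (f \<bullet> f)"
    by (rule norm_L2_circle_def)
qed

end

(* The class of f; functions that are not square integrable have the junk value 0. *)
definition to_L2 :: "(complex \<Rightarrow> complex) \<Rightarrow> L2_circle"
  where "to_L2 f = (if square_integrable f then abs_L2_circle f else 0)"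

lemma to_L2_rep [simp]: "to_L2 (rep_L2_circle f) = f"
  using square_integrable_rep Quotient_abs_rep[OF Quotient_L2_circle] by (simp add: to_L2_def)

lemma rep_to_L2:
  "square_integrable f \<Longrightarrow> AE z in circle_measure. rep_L2_circle (to_L2 f) z = f z"
  by (simp add: to_L2_def rep_abs_L2_circle)

lemma to_L2_add:
  assumes "square_integrable f" "square_integrable g"
  shows "to_L2 (\<lambda>z. f z + g z) = to_L2 f + to_L2 g"
  using assms plus_L2_circle.abs_eq[of f g] square_integrable_add[of f g]
  by (simp add: to_L2_def ae_equal_def eq_onp_def)

lemma to_L2_diff:
  assumes "square_integrable f" "square_integrable g"
  shows "to_L2 (\<lambda>z. f z - g z) = to_L2 f - to_L2 g"
  using assms minus_L2_circle.abs_eq[of f g] square_integrable_diff[of f g]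
  by (simp add: to_L2_def ae_equal_def eq_onp_def)

lemma norm_to_L2:
  assumes "square_integrable f"
  shows "ennreal ((norm (to_L2 f))\<^sup>2) = (\<integral>\<^sup>+z. ennreal ((cmod (f z))\<^sup>2) \<partial>circle_measure)"
proof -
  have "(norm (to_L2 f))\<^sup>2 = (\<integral>z. f z \<bullet> f z \<partial>circle_measure)"
    using assms inner_L2_circle.abs_eq[of f f]
    by (simp add: to_L2_def ae_equal_def power2_norm_eq_inner)
  also have "\<dots> = (\<integral>z. (cmod (f z))\<^sup>2 \<partial>circle_measure)"
    by (simp add: power2_norm_eq_inner)
  finally show ?thesis
    using assms by (simp add: nn_integral_eq_integral square_integrable_def)
qed

lemma norm_L2_circle:
  "ennreal ((norm f)\<^sup>2) = (\<integral>\<^sup>+z. ennreal ((cmod (rep_L2_circle f z))\<^sup>2) \<partial>circle_measure)"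
  using norm_to_L2[OF square_integrable_rep, of f] by simp


lemma norm_diff_L2_circle:
  "ennreal ((norm (f - g))\<^sup>2)
    = (\<integral>\<^sup>+z. ennreal ((cmod (rep_L2_circle f z - rep_L2_circle g z))\<^sup>2) \<partial>circle_measure)"
  using norm_to_L2[OF square_integrable_diff[OF square_integrable_rep square_integrable_rep], of f g]
  by (simp add: to_L2_diff square_integrable_rep)

lemma rep_measurable [measurable]: "rep_L2_circle f \<in> borel_measurable circle_measure"
  by (rule square_integrable_measurable[OF square_integrable_rep])

instance L2_circle :: banach
proof
  fix X :: "nat \<Rightarrow> L2_circle" assume X: "Cauchy X"
  have "\<exists>N. \<forall>i\<ge>N. \<forall>j\<ge>N. dist (X i) (X j) < (1/2) ^ n" for n :: nat
    using metric_CauchyD[OF X, of "(1/2) ^ n"] by simp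
  then obtain N where N: "\<And>n i j. i \<ge> N n \<Longrightarrow> j \<ge> N n \<Longrightarrow> dist (X i) (X j) < (1/2) ^ n"
    by metis
  define r where "r n = n + (\<Sum>k\<le>n. N k)" for n
  have r: "strict_mono r"
    by (rule strict_monoI_Suc) (simp add: r_def)
  have rN: "m \<ge> n \<Longrightarrow> r m \<ge> N n" for m n
  proof -
    assume "m \<ge> n"
    then have "N n \<le> (\<Sum>k\<le>m. N k)" by (intro member_le_sum) auto
    then show "r m \<ge> N n" by (simp add: r_def)
  qed
  have close: "norm (X (r m) - X (r n)) < (1/2) ^ n" if "m \<ge> n" for m n
    using N[OF rN[OF that] rN[OF order_refl]] by (simp add: dist_norm)
  define F where "F n = rep_L2_circle (X (r n))" for n
  have F_meas [measurable]: "F n \<in> borel_measurable circle_measure" for n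
    by (simp add: F_def)
  have F_norm: "(\<integral>\<^sup>+z. ennreal ((cmod (F m z - F n z))\<^sup>2) \<partial>circle_measure)
      = ennreal ((norm (X (r m) - X (r n)))\<^sup>2)" for m n
    by (simp add: F_def norm_diff_L2_circle)
  have L1: "(\<integral>\<^sup>+z. ennreal (cmod (F (Suc n) z - F n z)) \<partial>circle_measure)
      \<le> ennreal ((1 + 2 * pi) * (1/2) ^ n)" for n
  proof -
    have *: "a \<le> 2 ^ n * a\<^sup>2 + (1/2) ^ n" if "a \<ge> 0" for a :: real
    proof (cases "a \<le> (1/2) ^ n")
      case True
      then show ?thesis using that by (simp add: add_increasing)
    next
      case False
      then have "2 ^ n * ((1/2) ^ n * a) \<le> 2 ^ n * (a * a)"
        using that by (intro mult_left_mono mult_right_mono) auto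
      moreover have "2 ^ n * ((1/2) ^ n * a) = a"
        by (simp add: power_one_over)
      ultimately have "a \<le> 2 ^ n * a\<^sup>2"
        by (simp add: power2_eq_square)
      then show ?thesis by (simp add: add_increasing2)
    qed
    have "(\<integral>\<^sup>+z. ennreal (cmod (F (Suc n) z - F n z)) \<partial>circle_measure)
        \<le> (\<integral>\<^sup>+z. ennreal (2 ^ n) * ennreal ((cmod (F (Suc n) z - F n z))\<^sup>2)
              + ennreal ((1/2) ^ n) \<partial>circle_measure)"
      by (intro nn_integral_mono)
         (simp add: * ennreal_mult[symmetric] ennreal_plus[symmetric] del: ennreal_plus)
    also have "\<dots> = ennreal (2 ^ n) * ennreal ((norm (X (r (Suc n)) - X (r n)))\<^sup>2)
        + ennreal ((1/2) ^ n) * ennreal (2 * pi)"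
      by (subst nn_integral_add) (simp_all add: nn_integral_cmult F_norm emeasure_circle)
    also have "\<dots> = ennreal (2 ^ n * (norm (X (r (Suc n)) - X (r n)))\<^sup>2 + (1/2) ^ n * (2 * pi))"
      by (simp add: ennreal_mult[symmetric] ennreal_plus[symmetric] del: ennreal_plus)
    also have "\<dots> \<le> ennreal ((1 + 2 * pi) * (1/2) ^ n)"
    proof (rule ennreal_leI)
      have "(norm (X (r (Suc n)) - X (r n)))\<^sup>2 \<le> ((1/2) ^ n)\<^sup>2"
        using close[of n "Suc n"] by (intro power_mono) auto
      then have "2 ^ n * (norm (X (r (Suc n)) - X (r n)))\<^sup>2 \<le> 2 ^ n * ((1/2) ^ n)\<^sup>2"
        by (intro mult_left_mono) auto
      also have "\<dots> = (1/2) ^ n"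
        by (simp add: power2_eq_square power_one_over)
      finally show "2 ^ n * (norm (X (r (Suc n)) - X (r n)))\<^sup>2 + (1/2) ^ n * (2 * pi)
          \<le> (1 + 2 * pi) * (1/2) ^ n"
        by (simp add: algebra_simps)
    qed
    finally show ?thesis .
  qed
  have "(\<integral>\<^sup>+z. (\<Sum>n. ennreal (cmod (F (Suc n) z - F n z))) \<partial>circle_measure)
      = (\<Sum>n. \<integral>\<^sup>+z. ennreal (cmod (F (Suc n) z - F n z)) \<partial>circle_measure)"
    by (rule nn_integral_suminf) measurable
  also have "\<dots> \<le> (\<Sum>n. ennreal ((1 + 2 * pi) * (1/2) ^ n))"
    by (intro suminf_le L1) auto
  also have "\<dots> < \<infinity>"
  proof -
    have "summable (\<lambda>n. (1 + 2 * pi) * (1/2) ^ n)"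
      by (intro summable_mult summable_geometric) simp
    then show ?thesis
      by (subst suminf_ennreal_eq[OF _ summable_sums]) auto
  qed
  finally have "AE z in circle_measure. (\<Sum>n. ennreal (cmod (F (Suc n) z - F n z))) \<noteq> \<infinity>"
    by (intro nn_integral_noteq_infinite) auto
  then have conv: "AE z in circle_measure. convergent (\<lambda>n. F n z)"
  proof eventually_elim
    case (elim z)
    then have "summable (\<lambda>n. cmod (F (Suc n) z - F n z))"
      by (intro summable_suminf_not_top) auto
    then have "summable (\<lambda>n. F (Suc n) z - F n z)"
      by (rule summable_norm_cancel)
    then have "(\<lambda>n. \<Sum>k<n. F (Suc k) z - F k z) \<longlonglongrightarrow> (\<Sum>n. F (Suc n) z - F n z)"
      by (rule summable_LIMSEQ)
    then have "(\<lambda>n. F n z - F 0 z) \<longlonglongrightarrow> (\<Sum>n. F (Suc n) z - F n z)"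
      by (simp add: sum_lessThan_telescope[of "\<lambda>n. F n z"])
    from tendsto_add[OF this tendsto_const[of "F 0 z"]] show ?case
      by (auto simp: convergent_def)
  qed
  define G where "G z = lim (\<lambda>n. F n z)" for z
  have G_meas [measurable]: "G \<in> borel_measurable circle_measure"
    unfolding G_def by (rule borel_measurable_lim_metric) simp
  have G_bound: "(\<integral>\<^sup>+z. ennreal ((cmod (G z - F n z))\<^sup>2) \<partial>circle_measure) \<le> ennreal (((1/2) ^ n)\<^sup>2)"
    for n
  proof -
    have "AE z in circle_measure. ennreal ((cmod (G z - F n z))\<^sup>2)
        = liminf (\<lambda>m. ennreal ((cmod (F m z - F n z))\<^sup>2))"
      using conv
    proof eventually_elim
      case (elim z)
      then have "(\<lambda>m. F m z) \<longlonglongrightarrow> G z"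
        by (simp add: G_def convergent_LIMSEQ_iff)
      then have "(\<lambda>m. ennreal ((cmod (F m z - F n z))\<^sup>2)) \<longlonglongrightarrow> ennreal ((cmod (G z - F n z))\<^sup>2)"
        by (intro tendsto_intros)
      then show ?case
        by (rule lim_imp_Liminf[OF sequentially_bot, symmetric])
    qed
    then have "(\<integral>\<^sup>+z. ennreal ((cmod (G z - F n z))\<^sup>2) \<partial>circle_measure)
        = (\<integral>\<^sup>+z. liminf (\<lambda>m. ennreal ((cmod (F m z - F n z))\<^sup>2)) \<partial>circle_measure)"
      by (rule nn_integral_cong_AE)
    also have "\<dots> \<le> liminf (\<lambda>m. \<integral>\<^sup>+z. ennreal ((cmod (F m z - F n z))\<^sup>2) \<partial>circle_measure)"
      by (rule nn_integral_liminf) measurable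
    also have "\<dots> \<le> ennreal (((1/2) ^ n)\<^sup>2)"
    proof (rule Liminf_le, simp)
      have "ennreal ((norm (X (r m) - X (r n)))\<^sup>2) \<le> ennreal (((1/2) ^ n)\<^sup>2)" if "m \<ge> n" for m
        using close[OF that] by (intro ennreal_leI power_mono) auto
      then show "\<forall>\<^sub>F m in sequentially. (\<integral>\<^sup>+z. ennreal ((cmod (F m z - F n z))\<^sup>2) \<partial>circle_measure)
          \<le> ennreal (((1/2) ^ n)\<^sup>2)"
        unfolding F_norm eventually_sequentially by blast
    qed
    finally show ?thesis .
  qed
  have diff: "square_integrable (\<lambda>z. G z - F n z)" for n
    unfolding square_integrable_def
    by (auto intro!: integrableI_bounded order.strict_trans1[OF G_bound[of n]])
  have G: "square_integrable G"
    using square_integrable_add[OF diff[of 0] square_integrable_rep[of "X (r 0)"]]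
    by (simp add: F_def)
  have "norm (X (r n) - to_L2 G) \<le> (1/2) ^ n" for n
  proof -
    have "to_L2 (\<lambda>z. G z - F n z) = to_L2 G - X (r n)"
      using to_L2_diff[OF G square_integrable_rep, of "X (r n)"] by (simp add: F_def)
    then have "ennreal ((norm (to_L2 G - X (r n)))\<^sup>2) \<le> ennreal (((1/2) ^ n)\<^sup>2)"
      using norm_to_L2[OF diff, of n] G_bound[of n] by simp
    then have "(norm (to_L2 G - X (r n)))\<^sup>2 \<le> ((1/2) ^ n)\<^sup>2"
      by simp
    then show ?thesis
      by (subst norm_minus_commute) (rule power2_le_imp_le, auto)
  qed
  moreover have "(\<lambda>n. (1/2::real) ^ n) \<longlonglongrightarrow> 0"
    by (intro LIMSEQ_power_zero) simp
  ultimately have "(\<lambda>n. X (r n) - to_L2 G) \<longlonglongrightarrow> 0"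
    by (intro Lim_null_comparison[of "\<lambda>n. X (r n) - to_L2 G"]) auto
  then have "(X \<circ> r) \<longlonglongrightarrow> to_L2 G"
    by (simp add: o_def LIM_zero_iff)
  then show "convergent X"
    using Cauchy_converges_subseq[OF X r] by (auto simp: convergent_def)
qed


lemma to_L2_tendsto:
  assumes f: "square_integrable f" and s: "\<And>n. square_integrable (s n)"
    and lim: "AE z in circle_measure. (\<lambda>n. s n z) \<longlonglongrightarrow> f z"
    and w: "integrable circle_measure w"
    and bound: "\<And>n z. (cmod (s n z - f z))\<^sup>2 \<le> w z"
  shows "(\<lambda>n. to_L2 (s n)) \<longlonglongrightarrow> to_L2 f"
proof -
  note [measurable] = square_integrable_measurable[OF f] square_integrable_measurable[OF s]
  have d: "square_integrable (\<lambda>z. s n z - f z)" for n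
    by (intro square_integrable_diff s f)
  have norm_eq: "(norm (to_L2 (s n) - to_L2 f))\<^sup>2 = (\<integral>z. (cmod (s n z - f z))\<^sup>2 \<partial>circle_measure)" for n
  proof -
    have "ennreal ((norm (to_L2 (s n) - to_L2 f))\<^sup>2)
        = ennreal (\<integral>z. (cmod (s n z - f z))\<^sup>2 \<partial>circle_measure)"
      using norm_to_L2[OF d, of n] d[of n]
      by (simp add: to_L2_diff[OF s f] nn_integral_eq_integral square_integrable_def)
    then show ?thesis by simp
  qed
  have "(\<lambda>n. \<integral>z. (cmod (s n z - f z))\<^sup>2 \<partial>circle_measure) \<longlonglongrightarrow> (\<integral>z. 0 \<partial>circle_measure)"
  proof (rule integral_dominated_convergence[OF _ _ w])
    show "AE z in circle_measure. (\<lambda>n. (cmod (s n z - f z))\<^sup>2) \<longlonglongrightarrow> 0"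
      using lim
    proof eventually_elim
      case (elim z)
      then have "(\<lambda>n. (cmod (s n z - f z))\<^sup>2) \<longlonglongrightarrow> (cmod (f z - f z))\<^sup>2"
        by (intro tendsto_intros)
      then show ?case by simp
    qed
  qed (use bound in auto)
  then have "(\<lambda>n. (norm (to_L2 (s n) - to_L2 f))\<^sup>2) \<longlonglongrightarrow> 0"
    by (simp add: norm_eq)
  then have "(\<lambda>n. sqrt ((norm (to_L2 (s n) - to_L2 f))\<^sup>2)) \<longlonglongrightarrow> sqrt 0"
    by (rule tendsto_real_sqrt)
  then have "(\<lambda>n. norm (to_L2 (s n) - to_L2 f)) \<longlonglongrightarrow> 0"
    by simp
  then show ?thesis
    by (simp add: tendsto_norm_zero_iff LIM_zero_iff)
qed

lemma square_integrable_indicator: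
  "A \<in> sets borel \<Longrightarrow> square_integrable (\<lambda>z. c * indicator A z)"
  by (rule square_integrable_bounded[where B = "cmod c"]) (auto simp: indicator_def)

lemma countable_dense_L2_circle: "\<exists>D :: L2_circle set. countable D \<and> closure D = UNIV"
proof -
  obtain B :: "complex set set" where B: "countable B" "topological_basis B"
    using ex_countable_basis by blast
  define E where "E = (\<lambda>F. \<Inter>F) ` {F. finite F \<and> F \<subseteq> B}"
  have E_countable: "countable E"
    unfolding E_def by (intro countable_image countable_Collect_finite_subset B)
  have E_UNIV: "UNIV \<in> E"
    unfolding E_def by (rule image_eqI[of _ _ "{}"]) auto
  have E_open: "open A" if "A \<in> E" for A
    using that topological_basis_open[OF B(2)] unfolding E_def by (auto intro!: open_Inter)
  have E_Int: "Int_stable E"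
  proof (rule Int_stableI)
    fix A A' assume "A \<in> E" "A' \<in> E"
    then obtain F F' where "A = \<Inter>F" "A' = \<Inter>F'" "finite F" "finite F'" "F \<subseteq> B" "F' \<subseteq> B"
      by (auto simp: E_def)
    then show "A \<inter> A' \<in> E"
      unfolding E_def by (intro image_eqI[of _ _ "F \<union> F'"]) auto
  qed
  have E_borel: "sets (borel :: complex measure) = sigma_sets UNIV E"
  proof
    have "B \<subseteq> E"
    proof
      fix b assume "b \<in> B"
      then show "b \<in> E" unfolding E_def by (intro image_eqI[of _ _ "{b}"]) auto
    qed
    then show "sets (borel :: complex measure) \<subseteq> sigma_sets UNIV E"
      unfolding borel_eq_countable_basis[OF B] by (simp add: sigma_sets_mono')
    show "sigma_sets UNIV E \<subseteq> sets (borel :: complex measure)"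
      using E_open by (intro sets.sigma_sets_subset') auto
  qed
  define e where "e = from_nat_into E"
  have e_range: "range e = E"
    using E_countable E_UNIV unfolding e_def by (intro range_from_nat_into) auto
  define \<phi> where "\<phi> = (\<lambda>(p::rat, q::rat, k::nat).
    to_L2 (\<lambda>z. Complex (of_rat p) (of_rat q) * indicator (e k) z))"
  define D where "D = range (\<lambda>l. sum_list (map \<phi> l))"
  have D_countable: "countable D"
    unfolding D_def by simp
  have D_add: "f + g \<in> D" if "f \<in> D" "g \<in> D" for f g
  proof -
    from that obtain l l' where "f = sum_list (map \<phi> l)" "g = sum_list (map \<phi> l')"
      by (auto simp: D_def)
    then show ?thesis unfolding D_def by (intro image_eqI[of _ _ "l @ l'"]) auto
  qed
  have D_zero: "0 \<in> closure D"
    unfolding D_def by (intro subsetD[OF closure_subset] image_eqI[of _ _ "[]"]) auto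
  have C_add: "f + g \<in> closure D" if "f \<in> closure D" "g \<in> closure D" for f g
  proof -
    from that obtain x y where xy: "\<And>n. x n \<in> D" "x \<longlonglongrightarrow> f" "\<And>n. y n \<in> D" "y \<longlonglongrightarrow> g"
      unfolding closure_sequential by metis
    have "(\<lambda>n. x n + y n) \<longlonglongrightarrow> f + g"
      by (intro tendsto_add xy)
    with xy D_add show ?thesis
      unfolding closure_sequential by (intro exI[of _ "\<lambda>n. x n + y n"]) auto
  qed
  have C_lim: "f \<in> closure D" if "\<And>n. x n \<in> closure D" "x \<longlonglongrightarrow> f" for x f
    using closed_sequentially[OF closed_closure, of x D f] that by blast
  have rat_seq: "\<exists>p :: nat \<Rightarrow> rat. (\<lambda>n. of_rat (p n)) \<longlonglongrightarrow> (a::real) \<and> (\<forall>n. \<bar>of_rat (p n) - a\<bar> \<le> 1)" for a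
  proof -
    have "\<exists>q :: rat. \<bar>of_rat q - a\<bar> < inverse (real (Suc n))" for n
      using of_rat_dense[of "a - inverse (real (Suc n))" "a + inverse (real (Suc n))"]
      by (auto simp: abs_less_iff algebra_simps)
    then obtain p :: "nat \<Rightarrow> rat" where p: "\<And>n. \<bar>of_rat (p n) - a\<bar> < inverse (real (Suc n))"
      by metis
    have "(\<lambda>n. of_rat (p n) - a) \<longlonglongrightarrow> 0"
      by (rule Lim_null_comparison[OF _ LIMSEQ_inverse_real_of_nat]) (use less_imp_le[OF p] in simp)
    moreover have "\<bar>of_rat (p n) - a\<bar> \<le> 1" for n
      using p[of n] inverse_le_1_iff[of "real (Suc n)"] by linarith
    ultimately show ?thesis by (auto simp: LIM_zero_iff)
  qed
  have borelI: "A \<in> sets borel" if "A \<in> sigma_sets UNIV E" for A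
    using that E_borel by simp
  have generator: "to_L2 (\<lambda>z. c * indicator A z) \<in> closure D" if "A \<in> E" for A c
  proof -
    have "A \<in> range e" using that e_range by simp
    then obtain k where k: "A = e k" by (rule rangeE)
    have A: "A \<in> sets borel" using E_open[OF that] by simp
    obtain p q :: "nat \<Rightarrow> rat" where
      p: "(\<lambda>n. of_rat (p n)) \<longlonglongrightarrow> Re c" "\<And>n. \<bar>of_rat (p n) - Re c\<bar> \<le> 1" and
      q: "(\<lambda>n. of_rat (q n)) \<longlonglongrightarrow> Im c" "\<And>n. \<bar>of_rat (q n) - Im c\<bar> \<le> 1"
      using rat_seq[of "Re c"] rat_seq[of "Im c"] by blast
    define d where "d n = Complex (of_rat (p n)) (of_rat (q n))" for n
    have d: "d \<longlonglongrightarrow> c"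
      using tendsto_Complex[OF p(1) q(1)] by (simp add: d_def[abs_def])
    have d_bound: "cmod (d n - c) \<le> 2" for n
      using cmod_le[of "d n - c"] p(2)[of n] q(2)[of n] by (simp add: d_def)
    have "(\<lambda>n. to_L2 (\<lambda>z. d n * indicator A z)) \<longlonglongrightarrow> to_L2 (\<lambda>z. c * indicator A z)"
    proof (rule to_L2_tendsto[where w = "\<lambda>_. 4"])
      show "AE z in circle_measure. (\<lambda>n. d n * indicator A z) \<longlonglongrightarrow> c * indicator A z"
        by (intro AE_I2 tendsto_mult d tendsto_const)
      show "(cmod (d n * indicator A z - c * indicator A z))\<^sup>2 \<le> 4" for n z
        using power_mono[OF d_bound[of n], of 2] by (auto simp: indicator_def)
    qed (use A in \<open>auto intro: square_integrable_indicator\<close>)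
    moreover have "to_L2 (\<lambda>z. d n * indicator A z) \<in> closure D" for n
      unfolding D_def
      by (intro subsetD[OF closure_subset] image_eqI[of _ _ "[(p n, q n, k)]"])
         (auto simp: \<phi>_def d_def k)
    ultimately show ?thesis
      by (rule C_lim[rotated])
  qed
  have to_L2_zero: "to_L2 (\<lambda>z. 0) = 0"
    by (simp add: to_L2_def square_integrable_zero zero_L2_circle.abs_eq)
  have E_Pow: "E \<subseteq> Pow UNIV" by simp
  have "\<forall>c. to_L2 (\<lambda>z. c * indicator A z) \<in> closure D" if "A \<in> sigma_sets UNIV E" for A
    using E_Int E_Pow that
  proof (induction rule: sigma_sets_induct_disjoint)
    case (basic A)
    then show ?case using generator by blast
  next
    case empty
    then show ?case using D_zero by (simp add: to_L2_zero)
  next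
    case (compl A)
    show ?case
    proof
      fix c :: complex
      have "to_L2 (\<lambda>z. c * indicator (UNIV - A) z)
          = to_L2 (\<lambda>z. c * indicator UNIV z + (- c) * indicator A z)"
        by (intro arg_cong[where f = to_L2] ext) (auto simp: indicator_def)
      also have "\<dots> = to_L2 (\<lambda>z. c * indicator UNIV z) + to_L2 (\<lambda>z. (- c) * indicator A z)"
        using compl E_UNIV
        by (intro to_L2_add square_integrable_indicator borelI) (auto intro: sigma_sets.Basic)
      also have "\<dots> \<in> closure D"
        using compl generator[OF E_UNIV] by (intro C_add) blast+
      finally show "to_L2 (\<lambda>z. c * indicator (UNIV - A) z) \<in> closure D" .
    qed
  next
    case (union A)
    have A: "A i \<in> sets borel" for i
      using union by (intro borelI) auto
    show ?case
    proof
      fix c :: complex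
      have "to_L2 (\<lambda>z. c * indicator (\<Union>i<n. A i) z) \<in> closure D" for n
      proof (induction n)
        case 0
        then show ?case using D_zero by (simp add: to_L2_zero)
      next
        case (Suc n)
        have "A n \<inter> A i = {}" if "i < n" for i
          using union(1) that unfolding disjoint_family_on_def by (metis UNIV_I less_irrefl)
        then have "A n \<inter> (\<Union>i<n. A i) = {}"
          by blast
        then have "to_L2 (\<lambda>z. c * indicator (\<Union>i<Suc n. A i) z)
            = to_L2 (\<lambda>z. c * indicator (\<Union>i<n. A i) z + c * indicator (A n) z)"
          by (intro arg_cong[where f = to_L2] ext) (auto simp: indicator_def less_Suc_eq)
        also have "\<dots> = to_L2 (\<lambda>z. c * indicator (\<Union>i<n. A i) z) + to_L2 (\<lambda>z. c * indicator (A n) z)"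
          using A by (intro to_L2_add square_integrable_indicator) auto
        also have "\<dots> \<in> closure D"
          using union(3) Suc by (intro C_add) blast+
        finally show ?case .
      qed
      moreover have "(\<lambda>n. to_L2 (\<lambda>z. c * indicator (\<Union>i<n. A i) z))
          \<longlonglongrightarrow> to_L2 (\<lambda>z. c * indicator (\<Union>i. A i) z)"
      proof (rule to_L2_tendsto[where w = "\<lambda>_. (cmod c)\<^sup>2"])
        show "AE z in circle_measure. (\<lambda>n. c * indicator (\<Union>i<n. A i) z)
            \<longlonglongrightarrow> c * indicator (\<Union>i. A i) z"
          by (intro AE_I2 tendsto_mult tendsto_const LIMSEQ_indicator_UN)
        show "(cmod (c * indicator (\<Union>i<n. A i) z - c * indicator (\<Union>i. A i) z))\<^sup>2
            \<le> (cmod c)\<^sup>2" for n z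
          by (auto simp: indicator_def)
      qed (use A in \<open>auto intro!: square_integrable_indicator\<close>)
      ultimately show "to_L2 (\<lambda>z. c * indicator (\<Union>i. A i) z) \<in> closure D"
        by (rule C_lim)
    qed
  qed
  then have ind: "to_L2 (\<lambda>z. c * indicator A z) \<in> closure D" if "A \<in> sets borel" for A c
    using that E_borel by blast
  have simple: "to_L2 g \<in> closure D" if g: "simple_function circle_measure g" for g
  proof -
    have fin: "finite (range g)" and sets: "g -` {y} \<in> sets borel" for y
      using g simple_functionD(1)[OF g] simple_functionD(2)[OF g, of "{y}"] by auto
    have "square_integrable (\<lambda>z. \<Sum>y\<in>Y. y * indicator (g -` {y}) z)
        \<and> to_L2 (\<lambda>z. \<Sum>y\<in>Y. y * indicator (g -` {y}) z) \<in> closure D" if "finite Y" for Y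
      using that
    proof induction
      case empty
      then show ?case using D_zero by (simp add: square_integrable_zero to_L2_zero)
    next
      case (insert y Y)
      define h where "h z = (\<Sum>y\<in>Y. y * indicator (g -` {y}) z)" for z
      have h: "square_integrable h" "to_L2 h \<in> closure D"
        using insert.IH by (simp_all add: h_def[abs_def] del: sum_mult_indicator)
      have i: "square_integrable (\<lambda>z. y * indicator (g -` {y}) z)"
        by (intro square_integrable_indicator sets)
      have "(\<lambda>z. \<Sum>y\<in>insert y Y. y * indicator (g -` {y}) z) = (\<lambda>z. y * indicator (g -` {y}) z + h z)"
        using insert.hyps unfolding h_def by (intro ext sum.insert)
      then show ?case
        using square_integrable_add[OF i h(1)] C_add[OF ind[OF sets] h(2)]
        by (simp only: to_L2_add[OF i h(1)])
    qed
    note Y = this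
    have "(\<Sum>y\<in>range g. y * indicator (g -` {y}) z) = g z" for z
    proof -
      have "(\<Sum>y\<in>range g. y * indicator (g -` {y}) z) = (\<Sum>y\<in>{g z}. y * indicator (g -` {y}) z)"
        using fin by (intro sum.mono_neutral_right) auto
      then show ?thesis by simp
    qed
    then show ?thesis using Y[OF fin] by (simp only:)
  qed
  have "f \<in> closure D" for f
  proof -
    have f: "square_integrable (rep_L2_circle f)" by (rule square_integrable_rep)
    obtain s where s: "\<And>n. simple_function circle_measure (s n)"
      "\<And>z. (\<lambda>n. s n z) \<longlonglongrightarrow> rep_L2_circle f z"
      "\<And>n z. cmod (s n z) \<le> 2 * cmod (rep_L2_circle f z)"
      using borel_measurable_implies_sequence_metric[OF rep_measurable, of f 0] by auto
    have s2: "(cmod (s n z))\<^sup>2 \<le> 4 * (cmod (rep_L2_circle f z))\<^sup>2" for n z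
      using power_mono[OF s(3)[of n z], of 2] by (simp add: power_mult_distrib)
    have "(\<lambda>n. to_L2 (s n)) \<longlonglongrightarrow> to_L2 (rep_L2_circle f)"
    proof (rule to_L2_tendsto[where w = "\<lambda>z. 10 * (cmod (rep_L2_circle f z))\<^sup>2"])
      show "square_integrable (s n)" for n
      proof (rule square_integrableI_bound)
        show "integrable circle_measure (\<lambda>z. 4 * (cmod (rep_L2_circle f z))\<^sup>2)"
          using f by (simp add: square_integrable_def)
      qed (use s s2 in \<open>auto intro: borel_measurable_simple_function\<close>)
      show "(cmod (s n z - rep_L2_circle f z))\<^sup>2 \<le> 10 * (cmod (rep_L2_circle f z))\<^sup>2" for n z
        using sum_power2_le[of "s n z" "- rep_L2_circle f z"] s2[of n z] by simp
    qed (use f s in \<open>auto simp: square_integrable_def\<close>)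
    from C_lim[OF simple[OF s(1)] this] show ?thesis
      by simp
  qed
  then show ?thesis using D_countable by blast
qed

instance L2_circle :: second_countable_topology
proof
  obtain D :: "L2_circle set" where D: "countable D" "closure D = UNIV"
    using countable_dense_L2_circle by blast
  define B where "B = (\<lambda>(x, n). ball x (inverse (real (Suc n)))) ` (D \<times> UNIV)"
  have "topological_basis B"
  proof (rule topological_basisI)
    fix U :: "L2_circle set" and x assume "open U" "x \<in> U"
    then obtain \<epsilon> where \<epsilon>: "\<epsilon> > 0" "ball x \<epsilon> \<subseteq> U"
      using open_contains_ball by blast
    obtain n where n: "inverse (real (Suc n)) < \<epsilon> / 2"
      using reals_Archimedean[of "\<epsilon> / 2"] \<epsilon> by auto
    obtain y where y: "y \<in> D" "dist y x < inverse (real (Suc n))"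
      using D(2) closure_approachableD[of x D "inverse (real (Suc n))"]
      by (auto simp: dist_commute)
    have "ball y (inverse (real (Suc n))) \<subseteq> ball x \<epsilon>"
    proof
      fix w assume "w \<in> ball y (inverse (real (Suc n)))"
      then show "w \<in> ball x \<epsilon>"
        using y(2) n dist_triangle[of x w y] by (simp add: dist_commute)
    qed
    then show "\<exists>B'\<in>B. x \<in> B' \<and> B' \<subseteq> U"
      using y \<epsilon> unfolding B_def by (intro bexI[of _ "ball y (inverse (real (Suc n)))"]) auto
  qed (auto simp: B_def)
  moreover have "countable B"
    unfolding B_def using D by simp
  ultimately show "\<exists>B :: L2_circle set set. countable B \<and> open = generate_topology B"
    using topological_basis_imp_subbasis by blast
qed


section \<open>Fourier series, the Riesz projector and the semigroup\<close>

(* The choice of the representative is irrelevant here, as in L2_support below. *)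
definition fourier :: "L2_circle \<Rightarrow> int \<Rightarrow> complex"
  where "fourier f n =
    (LBINT x:{0..2*pi}. rep_L2_circle f (cis x) * cis (- (of_int n * x))) / (2 * pi)"

(* The class of e^(ix) |-> c e^(inx). *)
definition mode :: "complex \<Rightarrow> int \<Rightarrow> L2_circle"
  where "mode c n = to_L2 (\<lambda>z. c * z powi n)"

lemma AE_circle_norm: "AE z in circle_measure. cmod z = 1"
  unfolding circle_measure_def by (subst AE_distr_iff) auto

(* So mode never takes the junk value of to_L2. *)
lemma square_integrable_mode: "square_integrable (\<lambda>z. c * z powi n)"
proof -
  have [measurable]: "(\<lambda>z::complex. z powi n) \<in> borel_measurable borel"
    unfolding power_int_def by (cases "n \<ge> 0") simp_all
  have "integrable circle_measure (\<lambda>z. (cmod (c * z powi n))\<^sup>2)"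
  proof (rule circle.integrable_const_bound[where B = "(cmod c)\<^sup>2"])
    show "AE z in circle_measure. norm ((cmod (c * z powi n))\<^sup>2) \<le> (cmod c)\<^sup>2"
      using AE_circle_norm
      by eventually_elim (simp add: norm_mult norm_power_int)
  qed measurable
  then show ?thesis by (simp add: square_integrable_def)
qed

definition riesz :: "L2_circle \<Rightarrow> L2_circle"
  where "riesz f = (\<Sum>\<^sub>\<infinity>n\<in>{0..}. mode (fourier f n) n)"

definition H2 :: "L2_circle set"
  where "H2 = range riesz"

definition semigroup_D :: "real \<Rightarrow> L2_circle \<Rightarrow> L2_circle"
  where "semigroup_D t f = (\<Sum>\<^sub>\<infinity>n. mode (fourier f n * exp (- \<bar>real_of_int n\<bar> * t)) n)"

section \<open>The control system\<close>

definition open_strict_interval :: "complex set \<Rightarrow> bool"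
  where "open_strict_interval \<omega> \<longleftrightarrow> (\<exists>a b. 0 < b - a \<and> b - a < 2 * pi \<and> \<omega> = cis ` {a<..<b})"

(* L^2([0,T] x omega). Every class of Lebesgue measurable functions contains a Borel function. *)
definition L2_control :: "complex set \<Rightarrow> real \<Rightarrow> (real \<times> complex \<Rightarrow> complex) \<Rightarrow> bool"
  where "L2_control \<omega> T u \<longleftrightarrow>
    (let M = restrict_space lborel {0..T} \<Otimes>\<^sub>M restrict_space circle_measure \<omega>
     in u \<in> borel_measurable M \<and> integrable M (\<lambda>p. (cmod (u p))\<^sup>2))"

(* For a square integrable control u, almost every section u(s,.) is square integrable; at the
   remaining times the value of to_L2 is irrelevant for the integral in H2_solution. *)
definition extend0 :: "complex set \<Rightarrow> (complex \<Rightarrow> complex) \<Rightarrow> L2_circle"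
  where "extend0 \<omega> v = to_L2 (\<lambda>z. if z \<in> \<omega> then v z else 0)"

(* The integral is the Bochner integral in L^2 of the circle. *)
definition H2_solution ::
    "complex set \<Rightarrow> (real \<times> complex \<Rightarrow> complex) \<Rightarrow> L2_circle \<Rightarrow> real \<Rightarrow> L2_circle"
  where "H2_solution \<omega> u f\<^sub>0 t = semigroup_D t f\<^sub>0
    + (LBINT s:{0..t}. semigroup_D (t - s) (riesz (extend0 \<omega> (\<lambda>z. u (s, z)))))"

definition null_controllable_H2 :: "complex set \<Rightarrow> real \<Rightarrow> L2_circle set"
  where "null_controllable_H2 \<omega> T =
    {f\<^sub>0 \<in> H2. \<exists>u. L2_control \<omega> T u \<and> H2_solution \<omega> u f\<^sub>0 T = 0}"

(* The essential support: complement of the largest open set on which f vanishes almost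
   everywhere. *)
definition L2_support :: "L2_circle \<Rightarrow> complex set"
  where "L2_support f = {z \<in> sphere 0 1. \<forall>U. open U \<longrightarrow> z \<in> U \<longrightarrow>
    \<not> (AE w in circle_measure. w \<in> U \<longrightarrow> rep_L2_circle f w = 0)}"

end

theory Submission
  imports Defs
begin

text \<open>
  Let \<open>G s\<close> be the Poisson extension of \<open>g\<close> to time \<open>s\<close>, with Fourier coefficients
  \<open>exp (- \<bar>n\<bar> * s) * fourier g n\<close>. If \<open>w = \<chi> * G\<close> with \<open>\<chi>\<close> equal to the indicator of the arc at
  \<open>s = 0\<close>, vanishing at \<open>s = T\<close> and outside of the arc, then integrating the derivative of
  \<open>exp (n * s)\<close> times the \<open>n\<close>-th coefficient of \<open>w s\<close> shows that \<open>u = (\<partial>\<^sub>s - \<i> \<partial>\<^sub>x) w\<close> steers the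
  projection of \<open>g\<close> to zero. The operator \<open>\<partial>\<^sub>s - \<i> \<partial>\<^sub>x\<close> annihilates the modes \<open>n \<ge> 0\<close> of \<open>G\<close>, and condition
  (2) says exactly that the remaining part \<open>\<chi> (\<partial>\<^sub>s - \<i> \<partial>\<^sub>x) G\<close> of \<open>u\<close> is square integrable. The other
  part \<open>G (\<partial>\<^sub>s - \<i> \<partial>\<^sub>x) \<chi>\<close> is controlled by condition (3): the cutoff lives on \<open>0 < s < Q\<close>, where \<open>Q\<close> is
  comparable to the product of the distances to the two end points of the arc, its derivatives are
  \<open>O(1 / Q)\<close>, and the Poisson kernel satisfies a Hardy type inequality with weight \<open>1 / Q\<^sup>2\<close>.
\<close>

section \<open>Integration on the circle\<close>

text \<open>The operator |D| is nonlocal, so cutting off a solution would normally spread the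
  control over the whole circle. On frequencies n \<ge> 0 it coincides with the local operator
  \<open>- \<i> \<partial>\<^sub>x\<close>, and P_+ discards the other frequencies; hence a first
  order operator that preserves supports can take its place. If w_n denotes the n-th coefficient of
  w, that of u is w_n' + n w_n, so e^(ns) u_n is the derivative of e^(ns) w_n. As w_n vanishes at T,
  the integral of e^(ns) u_n over [0, T] is minus the n-th coefficient of g, exactly the value that
  cancels S(T) P_+ g in Duhamel's formula. Two obstacles shape the rest. The cutoff is singular at s
  = Q = 0 and the Poisson extension reaches g only weakly here, so calculus is done on
  [\<epsilon>, T] and the limit \<epsilon> \<rightarrow> 0 transfers the averaging from g to the
  cutoff. And the square of an O(1 / Q) derivative costs 1 / Q^2, while (3) offers 1 / Q; the
  missing power comes from integrating s over an interval of length Q. Scaling Q by a small constant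
  makes the same construction work for every T > 0.\<close>

lemma cis_measurable [measurable]: "cis \<in> borel_measurable borel"
  by (intro borel_measurable_continuous_onI continuous_intros)

lemma power_int_measurable [measurable]: "(\<lambda>z::complex. z powi n) \<in> borel_measurable borel"
  unfolding power_int_def by (cases "n \<ge> 0") simp_all

lemma cnj_measurable [measurable]: "cnj \<in> borel_measurable borel"
  by (intro borel_measurable_continuous_onI continuous_intros)

lemma AE_lborel_indicator_half_open:
  fixes a b :: real
  shows "AE x in lborel. indicator {a..<b} x = (indicator {a..b} x :: real)"
  using AE_lborel_singleton[of b] by eventually_elim (auto simp: indicator_def)

lemma integrable_circle_iff:
  fixes f :: "complex \<Rightarrow> 'a::{banach, second_countable_topology}"
  assumes [measurable]: "f \<in> borel_measurable borel"
  shows "integrable circle_measure f \<longleftrightarrow> set_integrable lborel {0..2*pi} (\<lambda>x. f (cis x))"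
proof -
  have "integrable circle_measure f
      \<longleftrightarrow> integrable lborel (\<lambda>x. indicator {0..<2*pi} x *\<^sub>R f (cis x))"
    unfolding circle_measure_def by (subst integrable_distr_eq) (auto simp: integrable_restrict_space)
  also have "\<dots> \<longleftrightarrow> integrable lborel (\<lambda>x. indicator {0..2*pi} x *\<^sub>R f (cis x))"
    using AE_lborel_indicator_half_open[of 0 "2*pi"] by (intro integrable_cong_AE) auto
  finally show ?thesis by (simp add: set_integrable_def)
qed

lemma integral_circle:
  fixes f :: "complex \<Rightarrow> 'a::{banach, second_countable_topology}"
  assumes [measurable]: "f \<in> borel_measurable borel"
  shows "(\<integral>z. f z \<partial>circle_measure) = (LBINT x:{0..2*pi}. f (cis x))"
proof -
  have "(\<integral>z. f z \<partial>circle_measure) = (\<integral>x. indicator {0..<2*pi} x *\<^sub>R f (cis x) \<partial>lborel)"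
    unfolding circle_measure_def by (subst integral_distr) (auto simp: integral_restrict_space)
  also have "\<dots> = (\<integral>x. indicator {0..2*pi} x *\<^sub>R f (cis x) \<partial>lborel)"
    using AE_lborel_indicator_half_open[of 0 "2*pi"] by (intro integral_cong_AE) auto
  finally show ?thesis by (simp add: set_lebesgue_integral_def)
qed

lemma AE_circle_singleton: "AE z in circle_measure. z \<noteq> \<zeta>"
proof -
  have "finite {x. 0 \<le> x \<and> x < 2 * pi \<and> cis x = \<zeta>}"
  proof -
    have "inj_on cis {x. 0 \<le> x \<and> x < 2 * pi \<and> cis x = \<zeta>}"
    proof (rule inj_onI)
      fix x y assume xy: "x \<in> {x. 0 \<le> x \<and> x < 2 * pi \<and> cis x = \<zeta>}" "y \<in> {x. 0 \<le> x \<and> x < 2 * pi \<and> cis x = \<zeta>}"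
      then have "sin y = sin x \<and> cos y = cos x"
        by (auto simp: complex_eq_iff)
      then obtain n :: int where n: "y = x + 2 * pi * n"
        unfolding sin_cos_eq_iff by blast
      have "2 * pi * real_of_int n < 2 * pi * 1" "2 * pi * (-1) < 2 * pi * n"
        using n xy unfolding mem_Collect_eq by linarith+
      then have "real_of_int n < 1" "-1 < real_of_int n"
        using mult_less_cancel_left_pos[of "2 * pi" "real_of_int n" 1]
          mult_less_cancel_left_pos[of "2 * pi" "-1" "real_of_int n"] by simp_all
      with n show "x = y" by simp
    qed
    then show ?thesis
      by (rule inj_on_finite[of _ _ "{\<zeta>}"]) auto
  qed
  then have "AE x in lborel. x \<notin> {x. 0 \<le> x \<and> x < 2 * pi \<and> cis x = \<zeta>}"
    by (intro AE_not_in null_setsI emeasure_lborel_countable) (auto simp: countable_finite)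
  then show ?thesis
    unfolding circle_measure_def
    by (subst AE_distr_iff) (auto simp: AE_restrict_space_iff)
qed

text \<open>Coefficients of a function instead of a class in \<open>L2_circle\<close>: the Poisson
  extension is a pointwise object, and \<open>fourier_eq_circle_coeff\<close> links the two.\<close>

definition circle_coeff :: "(complex \<Rightarrow> complex) \<Rightarrow> int \<Rightarrow> complex"
  where "circle_coeff f n = (\<integral>z. f z * cnj z powi n \<partial>circle_measure) / (2 * pi)"

lemma fourier_eq_circle_coeff: "fourier f n = circle_coeff (rep_L2_circle f) n"
proof -
  have "rep_L2_circle f \<in> borel_measurable borel"
    using rep_measurable[of f] by (simp cong: measurable_cong_sets)
  then show ?thesis
    unfolding fourier_def circle_coeff_def
    by (subst integral_circle) (auto simp: cis_cnj cis_power_int)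
qed

lemma circle_coeff_cong_AE:
  assumes "AE z in circle_measure. f z = g z"
    and [measurable]: "f \<in> borel_measurable borel" "g \<in> borel_measurable borel"
  shows "circle_coeff f n = circle_coeff g n"
  unfolding circle_coeff_def using assms(1)
  by (intro arg_cong2[where f = "(/)"] integral_cong_AE refl) auto

lemma rep_borel_measurable [measurable]: "rep_L2_circle f \<in> borel_measurable borel"
  using rep_measurable[of f] by (simp cong: measurable_cong_sets)

lemma fourier_to_L2: "square_integrable f \<Longrightarrow> fourier (to_L2 f) n = circle_coeff f n"
  unfolding fourier_eq_circle_coeff
  by (rule circle_coeff_cong_AE[OF rep_to_L2])
     (auto simp: square_integrable_def cong: measurable_cong_sets)

lemma integral_power_int_circle:
  "(\<integral>z. z powi n \<partial>circle_measure) = (if n = 0 then 2 * pi else 0)"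
proof (cases "n = 0")
  case True
  then show ?thesis by (simp add: measure_def emeasure_circle scaleR_conv_of_real)
next
  case False
  define F where "F x = cis (of_int n * x) / (\<i> * of_int n)" for x :: real
  have "(F has_vector_derivative cis (of_int n * x)) (at x within {0..2*pi})" for x
  proof -
    have "((\<lambda>x. cis (of_int n * x)) has_vector_derivative
        of_int n *\<^sub>R (\<i> * cis (of_int n * x))) (at x within {0..2*pi})"
      unfolding has_vector_derivative_def
      by (rule derivative_eq_intros has_derivative_cis refl | simp add: algebra_simps)+
    then have "(F has_vector_derivative
        of_int n *\<^sub>R (\<i> * cis (of_int n * x)) / (\<i> * of_int n)) (at x within {0..2*pi})"
      unfolding F_def by (rule has_vector_derivative_divide)
    then show ?thesis
      using False by (simp add: scaleR_conv_of_real)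
  qed
  then have "((\<lambda>x. cis (of_int n * x)) has_integral (F (2*pi) - F 0)) {0..2*pi}"
    by (intro fundamental_theorem_of_calculus) auto
  moreover have "F (2*pi) = F 0"
    using cis_multiple_2pi[of "of_int n"] by (simp add: F_def mult.commute[of "of_int n"])
  ultimately have "((\<lambda>x. cis (of_int n * x)) has_integral 0) {0..2*pi}"
    by simp
  moreover have "set_integrable lborel {0..2*pi} (\<lambda>x. cis (of_int n * x))"
    by (intro borel_integrable_atLeastAtMost') (intro continuous_intros)
  ultimately have "(LBINT x:{0..2*pi}. cis (of_int n * x)) = 0"
    by (metis set_borel_integral_eq_integral(2) integral_unique)
  then show ?thesis
    using False by (subst integral_circle) (auto simp: cis_power_int)
qed

section \<open>Fourier series in the Hilbert space\<close>

lemma inner_L2_circle: "f \<bullet> g = (\<integral>z. rep_L2_circle f z \<bullet> rep_L2_circle g z \<partial>circle_measure)"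
  using inner_L2_circle.abs_eq[of "rep_L2_circle f" "rep_L2_circle g"] square_integrable_rep
    to_L2_rep[of f] to_L2_rep[of g]
  by (simp add: to_L2_def ae_equal_def)

text \<open>The inner product of \<open>L2_circle\<close> is the real one, so pairing with
  \<open>mode c n\<close> sees only one real component of the coefficient; c = 1 and c = \<i>
  together recover all of it.\<close>

lemma inner_mode: "f \<bullet> mode c n = 2 * pi * Re (fourier f n * cnj c)"
proof -
  have int: "integrable circle_measure (\<lambda>z. rep_L2_circle f z * cnj z powi n)"
  proof (rule Bochner_Integration.integrable_bound)
    show "integrable circle_measure (\<lambda>z. 1 + (cmod (rep_L2_circle f z))\<^sup>2)"
      using square_integrable_rep[of f] by (simp add: square_integrable_def)
    have *: "a \<le> 1 + a\<^sup>2" for a :: real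
      using zero_le_power2[of "a - 1/2"] by (simp add: power2_eq_square algebra_simps)
    show "AE z in circle_measure. norm (rep_L2_circle f z * cnj z powi n)
        \<le> norm (1 + (cmod (rep_L2_circle f z))\<^sup>2)"
      using AE_circle_norm
    proof eventually_elim
      case (elim z)
      then show ?case
        using *[of "cmod (rep_L2_circle f z)"] by (simp add: norm_mult norm_power_int)
    qed
  qed measurable
  have "f \<bullet> mode c n = (\<integral>z. Re (rep_L2_circle f z * cnj z powi n * cnj c) \<partial>circle_measure)"
    unfolding inner_L2_circle
  proof (rule integral_cong_AE)
    show "AE z in circle_measure. rep_L2_circle f z \<bullet> rep_L2_circle (mode c n) z
        = Re (rep_L2_circle f z * cnj z powi n * cnj c)"
      using rep_to_L2[OF square_integrable_mode[of c n]]
    proof eventually_elim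
      case (elim z)
      have *: "x \<bullet> y = Re (x * cnj y)" for x y
        by (simp add: inner_complex_def)
      show ?case
        unfolding mode_def elim * by (simp only: complex_cnj_mult complex_cnj_power_int ac_simps)
    qed
  qed measurable
  also have "\<dots> = Re ((\<integral>z. rep_L2_circle f z * cnj z powi n \<partial>circle_measure) * cnj c)"
    using int by (subst integral_Re) auto
  also have "\<dots> = 2 * pi * Re (fourier f n * cnj c)"
    by (simp add: fourier_eq_circle_coeff circle_coeff_def)
  finally show ?thesis .
qed

lemma fourier_mode: "fourier (mode c n) k = (if k = n then c else 0)"
proof -
  have "circle_coeff (\<lambda>z. c * z powi n) k = c * (\<integral>z. z powi (n - k) \<partial>circle_measure) / (2 * pi)"
  proof -
    have "(\<integral>z. c * z powi n * cnj z powi k \<partial>circle_measure)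
        = (\<integral>z. c * z powi (n - k) \<partial>circle_measure)"
    proof (rule integral_cong_AE)
      show "AE z in circle_measure. c * z powi n * cnj z powi k = c * z powi (n - k)"
        using AE_circle_norm
      proof eventually_elim
        case (elim z)
        then have "z * cnj z = 1" "z \<noteq> 0"
          using complex_norm_square[of z] by auto
        then have "cnj z = inverse z"
          by (metis inverse_unique)
        with \<open>z \<noteq> 0\<close> show ?case by (simp add: power_int_diff power_int_inverse divide_inverse)
      qed
    qed measurable
    then show ?thesis by (simp add: circle_coeff_def)
  qed
  then show ?thesis
    unfolding mode_def by (simp add: fourier_to_L2[OF square_integrable_mode] integral_power_int_circle)
qed

text \<open>Real and imaginary part are inner products with \<open>mode 1 n\<close> and
  \<open>mode \<i> n\<close>. The resulting continuity allows coefficients of infinite sums to be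
  read off term by term.\<close>

lemma bounded_linear_fourier: "bounded_linear (\<lambda>f. fourier f n)"
proof -
  have "fourier f n = of_real (f \<bullet> mode 1 n / (2 * pi)) + \<i> * of_real (f \<bullet> mode \<i> n / (2 * pi))" for f
    by (simp add: inner_mode complex_eq_iff)
  then have *: "(\<lambda>f. fourier f n)
      = (\<lambda>f. of_real (f \<bullet> mode 1 n / (2 * pi)) + \<i> * of_real (f \<bullet> mode \<i> n / (2 * pi)))"
    by auto
  show ?thesis
    unfolding * divide_real_def
    by (intro bounded_linear_add bounded_linear_const_mult
        bounded_linear_compose[OF bounded_linear_of_real]
        bounded_linear_compose[OF bounded_linear_mult_left] bounded_linear_inner_left)
qed

lemma norm_mode: "(norm (mode c n))\<^sup>2 = 2 * pi * (cmod c)\<^sup>2"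
  using complex_norm_square[of c]
  by (simp add: power2_norm_eq_inner[of "mode c n"] inner_mode fourier_mode complex_eq_iff)

lemma bounded_linear_mode: "bounded_linear (\<lambda>c. mode c n)"
proof (rule bounded_linear_intro[where K = "sqrt (2 * pi)"])
  show "mode (x + y) n = mode x n + mode y n" for x y
    unfolding mode_def distrib_right by (intro to_L2_add square_integrable_mode)
  show "mode (r *\<^sub>R x) n = r *\<^sub>R mode x n" for r x
  proof -
    have "ae_equal (\<lambda>z. x * z powi n) (\<lambda>z. x * z powi n)"
      using square_integrable_mode by (simp add: ae_equal_def)
    from scaleR_L2_circle.abs_eq[OF this[folded eq_onp_def], of r] show ?thesis
      unfolding mode_def to_L2_def mult_scaleR_left[symmetric]
      using square_integrable_mode[of x n] square_integrable_mode[of "r *\<^sub>R x" n] by simp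
  qed
  show "norm (mode x n) \<le> norm x * sqrt (2 * pi)" for x
  proof (rule power2_le_imp_le)
    show "(norm (mode x n))\<^sup>2 \<le> (norm x * sqrt (2 * pi))\<^sup>2"
      unfolding norm_mode power_mult_distrib by simp
  qed simp
qed

lemma mode_orthogonal: "m \<noteq> n \<Longrightarrow> mode c m \<bullet> mode d n = 0"
  by (simp add: inner_mode fourier_mode)

lemma norm_sum_orthogonal:
  fixes v :: "'i \<Rightarrow> 'a::real_inner"
  assumes "finite S" "\<And>i j. i \<in> S \<Longrightarrow> j \<in> S \<Longrightarrow> i \<noteq> j \<Longrightarrow> v i \<bullet> v j = 0"
  shows "(norm (\<Sum>i\<in>S. v i))\<^sup>2 = (\<Sum>i\<in>S. (norm (v i))\<^sup>2)"
proof -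
  have "(norm (\<Sum>i\<in>S. v i))\<^sup>2 = (\<Sum>i\<in>S. \<Sum>j\<in>S. v i \<bullet> v j)"
    by (simp only: power2_norm_eq_inner inner_sum_left) (simp only: inner_sum_right)
  also have "\<dots> = (\<Sum>i\<in>S. \<Sum>j\<in>S. if j = i then (norm (v i))\<^sup>2 else 0)"
    using assms(2) by (intro sum.cong refl) (auto simp: power2_norm_eq_inner)
  also have "\<dots> = (\<Sum>i\<in>S. (norm (v i))\<^sup>2)"
    using assms(1) by simp
  finally show ?thesis .
qed

lemma bessel_inequality:
  assumes "finite S"
  shows "2 * pi * (\<Sum>n\<in>S. (cmod (fourier f n))\<^sup>2) \<le> (norm f)\<^sup>2"
proof -
  define p where "p = (\<Sum>n\<in>S. mode (fourier f n) n)"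
  have pp: "(norm p)\<^sup>2 = 2 * pi * (\<Sum>n\<in>S. (cmod (fourier f n))\<^sup>2)"
    unfolding p_def using assms
    by (subst norm_sum_orthogonal) (auto simp: mode_orthogonal norm_mode sum_distrib_left)
  have fp: "f \<bullet> p = 2 * pi * (\<Sum>n\<in>S. (cmod (fourier f n))\<^sup>2)"
    unfolding p_def inner_sum_right inner_mode sum_distrib_left
    by (intro sum.cong refl) (simp add: cmod_power2[unfolded power2_eq_square] power2_eq_square)
  have "0 \<le> (norm (f - p))\<^sup>2" by simp
  also have "(norm (f - p))\<^sup>2 = (norm f)\<^sup>2 - 2 * (f \<bullet> p) + (norm p)\<^sup>2"
    by (simp add: power2_norm_eq_inner inner_diff_left inner_diff_right inner_commute[of p f])
  finally show ?thesis using pp fp by simp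
qed

text \<open>By Pythagoras, enlarging a finite index set F0 to F changes the partial sum by a vector
  whose squared norm is the sum of the squares over F - F0. So the Cauchy criterion along the filter
  of finite subsets is inherited from the series of squares.\<close>

lemma summable_on_orthogonal:
  fixes v :: "'i \<Rightarrow> 'a::{real_inner, banach}"
  assumes ortho: "\<And>i j. i \<in> A \<Longrightarrow> j \<in> A \<Longrightarrow> i \<noteq> j \<Longrightarrow> v i \<bullet> v j = 0"
    and sq: "(\<lambda>i. (norm (v i))\<^sup>2) summable_on A"
  shows "v summable_on A"
proof -
  have "\<exists>P. eventually P (finite_subsets_at_top A)
      \<and> (\<forall>F F'. P F \<and> P F' \<longrightarrow> dist (sum v F) (sum v F') < e)" if "e > 0" for e
  proof -
    define n where "n F = (\<Sum>i\<in>F. (norm (v i))\<^sup>2)" for F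
    have "(n \<longlongrightarrow> infsum (\<lambda>i. (norm (v i))\<^sup>2) A) (finite_subsets_at_top A)"
      using has_sum_infsum[OF sq] unfolding n_def has_sum_def .
    then have "\<forall>\<^sub>F F in finite_subsets_at_top A.
        dist (n F) (infsum (\<lambda>i. (norm (v i))\<^sup>2) A) < (e/4)\<^sup>2 / 2"
      using that by (intro tendstoD) auto
    then obtain F0 where "finite F0 \<and> F0 \<subseteq> A \<and> (\<forall>F. finite F \<and> F0 \<subseteq> F \<and> F \<subseteq> A
        \<longrightarrow> dist (n F) (infsum (\<lambda>i. (norm (v i))\<^sup>2) A) < (e/4)\<^sup>2 / 2)"
      unfolding eventually_finite_subsets_at_top by (elim exE) (rule that)
    then have fin: "finite F0" "F0 \<subseteq> A"
      and F0: "\<And>F. \<lbrakk>finite F; F0 \<subseteq> F; F \<subseteq> A\<rbrakk>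
        \<Longrightarrow> dist (n F) (infsum (\<lambda>i. (norm (v i))\<^sup>2) A) < (e/4)\<^sup>2 / 2"
      by blast+
    define P where "P F \<longleftrightarrow> finite F \<and> F0 \<subseteq> F \<and> F \<subseteq> A" for F
    have near: "dist (sum v F) (sum v F0) < e / 2" if "P F" for F
    proof -
      have F: "finite F" "F0 \<subseteq> F" "F \<subseteq> A" using that by (auto simp: P_def)
      have "(dist (sum v F) (sum v F0))\<^sup>2 = (norm (sum v (F - F0)))\<^sup>2"
        using F by (simp add: dist_norm sum_diff fin)
      also have "\<dots> = (\<Sum>i\<in>F - F0. (norm (v i))\<^sup>2)"
        using F by (intro norm_sum_orthogonal ortho) auto
      also have "\<dots> = n F - n F0"
        using F fin by (simp add: n_def sum_diff)
      also have "\<dots> < (e/4)\<^sup>2"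
      proof -
        define I where "I = infsum (\<lambda>i. (norm (v i))\<^sup>2) A"
        have "dist (n F) I < (e/4)\<^sup>2 / 2" "dist (n F0) I < (e/4)\<^sup>2 / 2"
          using F0[OF F] F0[OF fin(1) order_refl fin(2)] by (simp_all only: I_def)
        then show ?thesis unfolding dist_real_def by linarith
      qed
      finally have "dist (sum v F) (sum v F0) < e / 4"
        by (rule power2_less_imp_less) (use \<open>e > 0\<close> in simp)
      then show ?thesis using \<open>e > 0\<close> by simp
    qed
    have "eventually P (finite_subsets_at_top A)"
      unfolding P_def eventually_finite_subsets_at_top by (rule exI[of _ F0]) (use fin in simp)
    moreover have "dist (sum v F) (sum v F') < e" if "P F \<and> P F'" for F F'
      using near[OF conjunct1[OF that]] near[OF conjunct2[OF that]] dist_triangle2[of "sum v F" "sum v F'" "sum v F0"] by linarith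
    ultimately show ?thesis by blast
  qed
  then have "cauchy_filter (filtermap (sum v) (finite_subsets_at_top A))"
    by (simp add: cauchy_filter_metric_filtermap)
  moreover have "complete (UNIV::'a set)"
    by (meson Cauchy_convergent UNIV_I complete_def convergent_def)
  ultimately obtain L where "(sum v \<longlongrightarrow> L) (finite_subsets_at_top A)"
    using complete_uniform[where S = UNIV] by (force simp add: filterlim_def)
  then show ?thesis
    using summable_on_def has_sum_def by blast
qed

context
  fixes f :: L2_circle and a :: "int \<Rightarrow> complex"
  assumes a: "\<And>n. cmod (a n) \<le> 1"
begin

lemma multiplier_le: "(cmod (fourier f n * a n))\<^sup>2 \<le> (cmod (fourier f n))\<^sup>2"
  using a[of n] by (intro power_mono) (auto simp: norm_mult mult_left_le)

lemma norm_sum_multiplier_le: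
  assumes "finite S"
  shows "norm (\<Sum>n\<in>S. mode (fourier f n * a n) n) \<le> norm f"
proof (rule power2_le_imp_le)
  have "(norm (\<Sum>n\<in>S. mode (fourier f n * a n) n))\<^sup>2 = 2 * pi * (\<Sum>n\<in>S. (cmod (fourier f n * a n))\<^sup>2)"
    using assms by (subst norm_sum_orthogonal) (auto simp: mode_orthogonal norm_mode sum_distrib_left)
  also have "\<dots> \<le> 2 * pi * (\<Sum>n\<in>S. (cmod (fourier f n))\<^sup>2)"
    by (intro mult_left_mono sum_mono multiplier_le) auto
  also have "\<dots> \<le> (norm f)\<^sup>2"
    by (rule bessel_inequality[OF assms])
  finally show "(norm (\<Sum>n\<in>S. mode (fourier f n * a n) n))\<^sup>2 \<le> (norm f)\<^sup>2" .
qed simp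

text \<open>A divergent \<open>infsum\<close> has the default value 0, so this is what gives
  \<open>riesz\<close> and \<open>semigroup_D\<close> their intended meaning; both are Fourier
  multipliers bounded by 1, the semigroup for t \<ge> 0.\<close>

lemma summable_on_multiplier: "(\<lambda>n. mode (fourier f n * a n) n) summable_on A"
proof (rule summable_on_orthogonal)
  show "(\<lambda>n. (norm (mode (fourier f n * a n) n))\<^sup>2) summable_on A"
  proof (rule nonneg_bdd_above_summable_on)
    show "bdd_above (sum (\<lambda>n. (norm (mode (fourier f n * a n) n))\<^sup>2) ` {F. F \<subseteq> A \<and> finite F})"
    proof (rule bdd_aboveI2)
      fix F assume "F \<in> {F. F \<subseteq> A \<and> finite F}"
      then have F: "finite F" by simp
      have "(\<Sum>n\<in>F. (norm (mode (fourier f n * a n) n))\<^sup>2) \<le> 2 * pi * (\<Sum>n\<in>F. (cmod (fourier f n))\<^sup>2)"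
        unfolding norm_mode sum_distrib_left[symmetric]
        by (intro mult_left_mono sum_mono multiplier_le) auto
      then show "(\<Sum>n\<in>F. (norm (mode (fourier f n * a n) n))\<^sup>2) \<le> (norm f)\<^sup>2"
        using bessel_inequality[OF F, of f] by linarith
    qed
  qed simp
qed (simp add: mode_orthogonal)

lemma fourier_multiplier:
  "fourier (\<Sum>\<^sub>\<infinity>n\<in>A. mode (fourier f n * a n) n) k = (if k \<in> A then fourier f k * a k else 0)"
proof -
  have "((\<lambda>n. fourier (mode (fourier f n * a n) n) k)
      has_sum fourier (\<Sum>\<^sub>\<infinity>n\<in>A. mode (fourier f n * a n) n) k) A"
    by (intro has_sum_bounded_linear[OF bounded_linear_fourier] has_sum_infsum summable_on_multiplier)
  moreover have "((\<lambda>n. fourier (mode (fourier f n * a n) n) k)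
      has_sum (\<Sum>n\<in>A \<inter> {k}. fourier f n * a n)) A"
    by (rule has_sum_finite_neutralI[where B = "A \<inter> {k}"]) (auto simp: fourier_mode)
  ultimately have "fourier (\<Sum>\<^sub>\<infinity>n\<in>A. mode (fourier f n * a n) n) k = (\<Sum>n\<in>A \<inter> {k}. fourier f n * a n)"
    by (rule has_sum_unique)
  then show ?thesis by auto
qed

end

lemma fourier_riesz: "fourier (riesz f) k = (if 0 \<le> k then fourier f k else 0)"
  using fourier_multiplier[of "\<lambda>_. 1" f "{0..}" k] by (simp add: riesz_def)

lemma semigroup_D_riesz_eq:
  assumes "t \<ge> 0"
  shows "semigroup_D t (riesz f) = (\<Sum>\<^sub>\<infinity>n\<in>{0..}. mode (fourier f n * exp (- (of_int n * t))) n)"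
proof -
  have m0: "mode 0 n = 0" for n
    using bounded_linear.linear[OF bounded_linear_mode] by (rule linear_0)
  show ?thesis
    unfolding semigroup_D_def by (rule infsum_cong_neutral) (auto simp: fourier_riesz m0 exp_of_real)
qed

lemma range_int: "range int = {0..}"
  by (auto simp: image_iff elim!: nonneg_int_cases)

text \<open>Replaces the unordered sum by a sequence of partial sums, the form required by dominated
  convergence for the Duhamel integral.\<close>

lemma semigroup_D_riesz_LIMSEQ:
  assumes "t \<ge> 0"
  shows "(\<lambda>N. \<Sum>n<N. mode (fourier f (int n) * exp (- (real n * t))) (int n))
    \<longlonglongrightarrow> semigroup_D t (riesz f)"
proof -
  \<comment> \<open>The multiplier is set to 0 for n < 0, where exp (- n t) would exceed the bound 1
    of the multiplier lemmas.\<close>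
  define v where "v n = mode (fourier f n * (if n \<ge> 0 then exp (- (of_int n * t)) else 0)) n" for n
  have "v summable_on {0..}"
    unfolding v_def using assms by (intro summable_on_multiplier) auto
  then have "(v has_sum semigroup_D t (riesz f)) {0..}"
    unfolding semigroup_D_riesz_eq[OF assms]
    by (subst infsum_cong[where g = v]) (auto simp: v_def)
  then have "((v \<circ> int) has_sum semigroup_D t (riesz f)) UNIV"
    by (subst has_sum_reindex[symmetric]) (simp_all add: range_int)
  then show ?thesis
    using has_sum_imp_sums[of "v \<circ> int"] by (simp add: sums_def v_def)
qed

section \<open>The Poisson kernel\<close>

text \<open>Not normalised: for 0 < r < 1 its integral over the circle is 2 pi. It enters with r =
  exp (- s).\<close>

definition poisson_kernel :: "real \<Rightarrow> complex \<Rightarrow> complex \<Rightarrow> real"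
  where "poisson_kernel r z w = (1 - r\<^sup>2) / (cmod (1 - of_real r * z * cnj w))\<^sup>2"

lemma poisson_kernel_measurable [measurable]:
  assumes [measurable]: "r \<in> borel_measurable M" "f \<in> borel_measurable M" "g \<in> borel_measurable M"
  shows "(\<lambda>x. poisson_kernel (r x) (f x) (g x)) \<in> borel_measurable M"
  unfolding poisson_kernel_def by measurable

lemma poisson_kernel_commute: "poisson_kernel r z w = poisson_kernel r w z"
proof -
  have "cnj (1 - of_real r * z * cnj w) = 1 - of_real r * w * cnj z"
    by simp
  then show ?thesis
    unfolding poisson_kernel_def by (metis complex_mod_cnj)
qed

lemma poisson_kernel_nonneg: "0 \<le> r \<Longrightarrow> r \<le> 1 \<Longrightarrow> 0 \<le> poisson_kernel r z w"
  unfolding poisson_kernel_def by (intro divide_nonneg_nonneg) (auto simp: power_le_one)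

text \<open>Keeping only the first summand bounds the kernel near the diagonal, keeping only the
  second bounds it away from the diagonal.\<close>

lemma poisson_denominator:
  assumes "cmod z = 1" "cmod w = 1"
  shows "(cmod (1 - of_real r * z * cnj w))\<^sup>2 = (1 - r)\<^sup>2 + r * (cmod (z - w))\<^sup>2"
proof -
  define c where "c = Re (z * cnj w)"
  have "cmod (z * cnj w) = 1"
    using assms by (simp add: norm_mult)
  then have 1: "(Re (z * cnj w))\<^sup>2 + (Im (z * cnj w))\<^sup>2 = 1"
    unfolding cmod_power2[symmetric] by simp
  have "(cmod (1 - of_real r * (z * cnj w)))\<^sup>2 = 1 - 2 * r * c + r\<^sup>2 * ((Re (z * cnj w))\<^sup>2 + (Im (z * cnj w))\<^sup>2)"
    unfolding cmod_power2 c_def by (simp add: power2_eq_square algebra_simps)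
  moreover have "(cmod (z - w))\<^sup>2 = 2 - 2 * c"
  proof -
    have "(Re z)\<^sup>2 + (Im z)\<^sup>2 = 1" "(Re w)\<^sup>2 + (Im w)\<^sup>2 = 1"
      using assms by (simp_all add: cmod_power2[symmetric])
    then show ?thesis
      unfolding cmod_power2 c_def by (simp add: power2_eq_square algebra_simps)
  qed
  moreover have "1 - 2 * r * c + r\<^sup>2 * 1 = (1 - r)\<^sup>2 + r * (2 - 2 * c)"
    by (simp add: power2_eq_square algebra_simps)
  ultimately show ?thesis
    unfolding 1 by (simp add: mult.assoc)
qed

lemma poisson_kernel_le_near:
  assumes "cmod z = 1" "cmod w = 1" "0 \<le> r" "r < 1"
  shows "poisson_kernel r z w \<le> 2 / (1 - r)"
proof -
  have "poisson_kernel r z w \<le> (1 - r\<^sup>2) / (1 - r)\<^sup>2"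
    unfolding poisson_kernel_def poisson_denominator[OF assms(1,2)]
    using assms(3,4) by (intro divide_left_mono) (auto simp: power_le_one add_pos_nonneg)
  also have "\<dots> = (1 + r) / (1 - r)"
  proof -
    have "1 - r\<^sup>2 = (1 + r) * (1 - r)" by (simp add: power2_eq_square algebra_simps)
    then show ?thesis using assms(4) by (simp add: power2_eq_square)
  qed
  also have "\<dots> \<le> 2 / (1 - r)"
    using assms(4) by (intro divide_right_mono) auto
  finally show ?thesis .
qed

text \<open>The restriction s \<le> 1 / 2 keeps r = exp (- s) above 1 / 2, so that r |z - w|^2
  remains comparable to |z - w|^2; the numerator is at most 2 s.\<close>

lemma poisson_kernel_le_far:
  assumes "cmod z = 1" "cmod w = 1" "0 < s" "s \<le> 1 / 2" "z \<noteq> w"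
  shows "poisson_kernel (exp (- s)) z w \<le> 4 * s / (cmod (z - w))\<^sup>2"
proof -
  have r: "exp (- s) \<ge> 1 / 2" "exp (- s) < 1" "1 - (exp (- s))\<^sup>2 \<le> 2 * s"
    using exp_ge_add_one_self[of "- s"] exp_ge_add_one_self[of "- (2 * s)"] assms
    by (auto simp: power2_eq_square mult_exp_exp)
  have d: "(cmod (z - w))\<^sup>2 > 0"
    using assms(5) by simp
  have "poisson_kernel (exp (- s)) z w \<le> (2 * s) / ((cmod (z - w))\<^sup>2 / 2)"
    unfolding poisson_kernel_def poisson_denominator[OF assms(1,2)]
  proof (rule frac_le)
    have "(cmod (z - w))\<^sup>2 / 2 \<le> exp (- s) * (cmod (z - w))\<^sup>2"
      using mult_right_mono[OF r(1), of "(cmod (z - w))\<^sup>2"] by simp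
    then show "(cmod (z - w))\<^sup>2 / 2 \<le> (1 - exp (- s))\<^sup>2 + exp (- s) * (cmod (z - w))\<^sup>2"
      by (simp add: add_increasing)
  qed (use r d assms in auto)
  then show ?thesis by simp
qed

text \<open>At distance at least d the kernel of radius 1 - d is of size d / |z - w|^2. Thus the far
  part of the estimate can be integrated through the known mass 2 pi of a Poisson kernel, without
  integrating |z - w|^(-2) by hand.\<close>

lemma inverse_square_le_poisson_kernel:
  assumes "cmod z = 1" "cmod w = 1" "0 < d" "d \<le> 1" "d \<le> cmod (z - w)"
  shows "1 / (cmod (z - w))\<^sup>2 \<le> 4 / d * poisson_kernel (1 - d) z w"
proof -
  define \<rho> where "\<rho> = (cmod (1 - of_real (1 - d) * z * cnj w))\<^sup>2"
  have \<rho>: "\<rho> = d\<^sup>2 + (1 - d) * (cmod (z - w))\<^sup>2"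
    unfolding \<rho>_def poisson_denominator[OF assms(1,2)] by simp
  have d2: "d\<^sup>2 \<le> (cmod (z - w))\<^sup>2"
    using assms by (intro power_mono) auto
  have "(1 - d) * (cmod (z - w))\<^sup>2 \<le> 1 * (cmod (z - w))\<^sup>2"
    using assms by (intro mult_right_mono) auto
  with d2 have le: "\<rho> \<le> 2 * (cmod (z - w))\<^sup>2"
    unfolding \<rho> by simp
  have pos: "\<rho> > 0"
    unfolding \<rho> using assms by (intro add_pos_nonneg) auto
  have "1 / (cmod (z - w))\<^sup>2 \<le> 2 / \<rho>"
  proof -
    have "0 < (cmod (z - w))\<^sup>2" using le pos by linarith
    then show ?thesis using le pos by (simp add: divide_simps)
  qed
  also have "\<dots> \<le> 4 / d * (d / \<rho>)"
    using pos assms by (simp add: field_simps)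
  also have "\<dots> \<le> 4 / d * ((1 - (1 - d)\<^sup>2) / \<rho>)"
  proof -
    have "d * d \<le> d * 1" using assms by (intro mult_left_mono) auto
    then show ?thesis
      using pos assms by (intro mult_left_mono divide_right_mono) (auto simp: power2_eq_square algebra_simps)
  qed
  finally show ?thesis
    unfolding poisson_kernel_def \<rho>_def by simp
qed

section \<open>Power series and kernel formula of the Poisson extension\<close>

definition analytic_part :: "(complex \<Rightarrow> complex) \<Rightarrow> complex \<Rightarrow> complex"
  where "analytic_part f \<xi> = (\<Sum>m. circle_coeff f (int m) * \<xi> ^ m)"

text \<open>The constant mode is left to \<open>analytic_part\<close>, so that
  \<open>poisson_ext\<close> does not count it twice.\<close>

definition neg_coeff :: "(complex \<Rightarrow> complex) \<Rightarrow> nat \<Rightarrow> complex"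
  where "neg_coeff f m = (if m = 0 then 0 else circle_coeff f (- int m))"

definition antianalytic_part :: "(complex \<Rightarrow> complex) \<Rightarrow> complex \<Rightarrow> complex"
  where "antianalytic_part f \<xi> = (\<Sum>m. neg_coeff f m * \<xi> ^ m)"

text \<open>Splitting into a power series in z and one in \<open>cnj z\<close> separates the part
  that the first order operator annihilates from the part that it does not, and makes both
  differentiable term by term for s > 0.\<close>

definition poisson_ext :: "(complex \<Rightarrow> complex) \<Rightarrow> real \<Rightarrow> complex \<Rightarrow> complex"
  where "poisson_ext f s z = analytic_part f (of_real (exp (- s)) * z)
    + antianalytic_part f (of_real (exp (- s)) * cnj z)"

text \<open>Geometric series under the integral. One statement serves both power series: \<phi> is
  conjugation for the analytic part and the identity for the antianalytic part.\<close>

lemma cauchy_integral_sums: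
  assumes f: "integrable circle_measure f"
    and [measurable]: "\<phi> \<in> borel_measurable borel" and \<phi>: "AE w in circle_measure. cmod (\<phi> w) = 1"
    and \<xi>: "cmod \<xi> < 1"
  shows "(\<lambda>m. (\<integral>w. f w * \<phi> w ^ m \<partial>circle_measure) * \<xi> ^ m)
    sums (\<integral>w. f w / (1 - \<xi> * \<phi> w) \<partial>circle_measure)"
proof -
  have [measurable]: "f \<in> borel_measurable borel"
    using borel_measurable_integrable[OF f] by (simp cong: measurable_cong_sets)
  define F where "F m w = f w * \<phi> w ^ m * \<xi> ^ m" for m w
  have F_le: "AE w in circle_measure. cmod (F m w) = cmod (f w) * cmod \<xi> ^ m" for m
    using \<phi> by eventually_elim (simp add: F_def norm_mult norm_power)
  have i: "integrable circle_measure (\<lambda>w. f w * \<phi> w ^ m)" for m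
    using f by (rule Bochner_Integration.integrable_bound)
      (measurable, use \<phi> in eventually_elim, simp add: norm_mult norm_power)
  have int: "integrable circle_measure (F m)" for m
    unfolding F_def using i by (intro integrable_mult_left)
  have "(\<lambda>m. \<integral>w. F m w \<partial>circle_measure) sums (\<integral>w. (\<Sum>m. F m w) \<partial>circle_measure)"
  proof (rule sums_integral[OF int])
    have "AE w in circle_measure. \<forall>m. cmod (F m w) = cmod (f w) * cmod \<xi> ^ m"
      using F_le by (simp add: AE_all_countable)
    then show "AE w in circle_measure. summable (\<lambda>m. norm (F m w))"
      by eventually_elim (use \<xi> in \<open>simp add: summable_mult summable_geometric\<close>)
    have "(\<integral>w. norm (F m w) \<partial>circle_measure) = (\<integral>w. cmod (f w) \<partial>circle_measure) * cmod \<xi> ^ m" for m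
    proof -
      have "(\<integral>w. norm (F m w) \<partial>circle_measure) = (\<integral>w. cmod (f w) * cmod \<xi> ^ m \<partial>circle_measure)"
        by (rule integral_cong_AE) (use F_le in \<open>auto simp: F_def\<close>)
      then show ?thesis by simp
    qed
    then show "summable (\<lambda>m. \<integral>w. norm (F m w) \<partial>circle_measure)"
      using \<xi> by (simp add: summable_mult summable_geometric)
  qed
  also have "(\<integral>w. (\<Sum>m. F m w) \<partial>circle_measure) = (\<integral>w. f w / (1 - \<xi> * \<phi> w) \<partial>circle_measure)"
  proof (rule integral_cong_AE)
    show "AE w in circle_measure. (\<Sum>m. F m w) = f w / (1 - \<xi> * \<phi> w)"
      using \<phi>
    proof eventually_elim
      case (elim w)
      then have "cmod (\<xi> * \<phi> w) < 1"
        using \<xi> by (simp add: norm_mult)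
      then have "(\<lambda>m. f w * (\<xi> * \<phi> w) ^ m) sums (f w * (1 / (1 - \<xi> * \<phi> w)))"
        by (intro sums_mult geometric_sums)
      then show ?case
        by (simp add: F_def sums_iff power_mult_distrib mult_ac)
    qed
  qed (auto simp: F_def)
  also have "(\<lambda>m. \<integral>w. F m w \<partial>circle_measure) = (\<lambda>m. (\<integral>w. f w * \<phi> w ^ m \<partial>circle_measure) * \<xi> ^ m)"
    by (simp add: F_def)
  finally show ?thesis .
qed

lemma circle_coeff_nat:
  "circle_coeff f (int m) = (\<integral>z. f z * cnj z ^ m \<partial>circle_measure) / (2 * pi)"
  by (simp add: circle_coeff_def)

lemma circle_coeff_neg:
  assumes [measurable]: "f \<in> borel_measurable borel"
  shows "circle_coeff f (- int m) = (\<integral>z. f z * z ^ m \<partial>circle_measure) / (2 * pi)"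
proof -
  have "(\<integral>z. f z * cnj z powi (- int m) \<partial>circle_measure) = (\<integral>z. f z * z ^ m \<partial>circle_measure)"
  proof (rule integral_cong_AE)
    show "AE z in circle_measure. f z * cnj z powi (- int m) = f z * z ^ m"
      using AE_circle_norm
    proof eventually_elim
      case (elim z)
      then have "cnj z * z = 1"
        using complex_norm_square[of z] by (simp add: mult.commute)
      then have "inverse (cnj z) = z"
        by (rule inverse_unique)
      then show ?case by (simp add: power_int_minus power_inverse[symmetric])
    qed
  qed auto
  then show ?thesis by (simp add: circle_coeff_def)
qed

lemma AE_circle_cnj: "AE z in circle_measure. cmod (cnj z) = 1"
  using AE_circle_norm by simp

lemma analytic_part_sums:
  assumes f: "integrable circle_measure f" and \<xi>: "cmod \<xi> < 1"
  shows "(\<lambda>m. circle_coeff f (int m) * \<xi> ^ m)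
    sums ((\<integral>w. f w / (1 - \<xi> * cnj w) \<partial>circle_measure) / (2 * pi))"
  using sums_divide[OF cauchy_integral_sums[OF f _ AE_circle_cnj \<xi>], of "2 * pi"]
  by (simp add: circle_coeff_nat)

lemma antianalytic_part_sums:
  assumes f: "integrable circle_measure f" and \<xi>: "cmod \<xi> < 1"
  shows "(\<lambda>m. neg_coeff f m * \<xi> ^ m)
    sums ((\<integral>w. f w / (1 - \<xi> * w) \<partial>circle_measure) / (2 * pi) - (\<integral>w. f w \<partial>circle_measure) / (2 * pi))"
proof -
  have [measurable]: "f \<in> borel_measurable borel"
    using borel_measurable_integrable[OF f] by (simp cong: measurable_cong_sets)
  have "(\<lambda>m. circle_coeff f (- int m) * \<xi> ^ m)
      sums ((\<integral>w. f w / (1 - \<xi> * w) \<partial>circle_measure) / (2 * pi))"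
    using sums_divide[OF cauchy_integral_sums[OF f _ AE_circle_norm \<xi>], of "2 * pi"]
    by (simp add: circle_coeff_neg)
  moreover have "(\<lambda>m. if m = 0 then (\<integral>w. f w \<partial>circle_measure) / (2 * pi) else 0)
      sums (\<Sum>m\<in>{0::nat}. (\<integral>w. f w \<partial>circle_measure) / (2 * pi))"
    using sums_If_finite_set[of "{0::nat}" "\<lambda>_. (\<integral>w. f w \<partial>circle_measure) / (2 * pi)"] by simp
  ultimately have "(\<lambda>m. circle_coeff f (- int m) * \<xi> ^ m - (if m = 0 then (\<integral>w. f w \<partial>circle_measure) / (2 * pi) else 0))
      sums ((\<integral>w. f w / (1 - \<xi> * w) \<partial>circle_measure) / (2 * pi) - (\<integral>w. f w \<partial>circle_measure) / (2 * pi))"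
    by (intro sums_diff) auto
  also have "(\<lambda>m. circle_coeff f (- int m) * \<xi> ^ m - (if m = 0 then (\<integral>w. f w \<partial>circle_measure) / (2 * pi) else 0))
      = (\<lambda>m. neg_coeff f m * \<xi> ^ m)"
    by (auto simp: neg_coeff_def circle_coeff_def)
  finally show ?thesis .
qed

lemma integrable_mult_bounded:
  fixes f :: "complex \<Rightarrow> complex"
  assumes "integrable circle_measure f" "h \<in> borel_measurable borel"
    and "AE w in circle_measure. cmod (h w) \<le> B"
  shows "integrable circle_measure (\<lambda>w. f w * h w)"
proof (rule Bochner_Integration.integrable_bound)
  show "integrable circle_measure (\<lambda>w. B * cmod (f w))"
    using assms(1) by simp
  have [measurable]: "f \<in> borel_measurable borel" "h \<in> borel_measurable borel"
    using borel_measurable_integrable[OF assms(1)] assms(2) by (simp_all cong: measurable_cong_sets)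
  show "(\<lambda>w. f w * h w) \<in> borel_measurable circle_measure" by measurable
  show "AE w in circle_measure. norm (f w * h w) \<le> norm (B * cmod (f w))"
    using assms(3)
  proof eventually_elim
    case (elim w)
    then have "cmod (h w) * cmod (f w) \<le> \<bar>B\<bar> * cmod (f w)"
      by (intro mult_right_mono) auto
    then show ?case by (simp add: norm_mult abs_mult mult.commute)
  qed
qed

text \<open>With \<xi> = r z \<open>cnj w\<close>, the two Cauchy kernels combine as 1 / (1 - \<xi>)
  + 1 / (1 - \<open>cnj \<xi>\<close>) - 1 = (1 - |\<xi>|^2) / |1 - \<xi>|^2; the term -1 stems from
  the omitted constant mode in \<open>neg_coeff\<close>.\<close>

lemma poisson_ext_eq_integral:
  assumes f: "integrable circle_measure f" and z: "cmod z = 1" and s: "s > 0"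
  shows "poisson_ext f s z = (\<integral>w. f w * poisson_kernel (exp (- s)) z w \<partial>circle_measure) / (2 * pi)"
proof -
  have [measurable]: "f \<in> borel_measurable borel"
    using borel_measurable_integrable[OF f] by (simp cong: measurable_cong_sets)
  define r where "r = exp (- s)"
  have r: "0 < r" "r < 1" using s by (auto simp: r_def)
  have small: "cmod (complex_of_real r * z) < 1" "cmod (complex_of_real r * cnj z) < 1"
    using r z by (auto simp: norm_mult)
  have bound: "cmod (1 / (1 - \<xi>)) \<le> 1 / (1 - r)" if "cmod \<xi> = r" for \<xi>
  proof -
    have "1 - r \<le> cmod (1 - \<xi>)"
      using norm_triangle_ineq2[of 1 \<xi>] that by simp
    then show ?thesis
      using r by (simp add: norm_divide frac_le)
  qed
  have i1: "integrable circle_measure (\<lambda>w. f w * (1 / (1 - r * z * cnj w)))"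
    by (rule integrable_mult_bounded[OF f, where B = "1 / (1 - r)"], measurable)
       (use AE_circle_norm in eventually_elim, rule bound, use z r in \<open>simp add: norm_mult\<close>)
  have i2: "integrable circle_measure (\<lambda>w. f w * (1 / (1 - r * cnj z * w)))"
    by (rule integrable_mult_bounded[OF f, where B = "1 / (1 - r)"], measurable)
       (use AE_circle_norm in eventually_elim, rule bound, use z r in \<open>simp add: norm_mult\<close>)
  have "2 * pi * poisson_ext f s z
      = (\<integral>w. f w * (1 / (1 - r * z * cnj w)) \<partial>circle_measure)
        + ((\<integral>w. f w * (1 / (1 - r * cnj z * w)) \<partial>circle_measure) - (\<integral>w. f w \<partial>circle_measure))"
    unfolding poisson_ext_def r_def[symmetric] analytic_part_def antianalytic_part_def
      sums_unique[OF analytic_part_sums[OF f small(1)], symmetric]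
      sums_unique[OF antianalytic_part_sums[OF f small(2)], symmetric]
    by (simp add: field_simps)
  also have "\<dots> = (\<integral>w. f w * (1 / (1 - r * z * cnj w)) + (f w * (1 / (1 - r * cnj z * w)) - f w) \<partial>circle_measure)"
    using i1 i2 f by simp
  also have "\<dots> = (\<integral>w. f w * poisson_kernel r z w \<partial>circle_measure)"
  proof (rule integral_cong_AE)
    show "AE w in circle_measure. f w * (1 / (1 - r * z * cnj w)) + (f w * (1 / (1 - r * cnj z * w)) - f w)
        = f w * poisson_kernel r z w"
      using AE_circle_norm
    proof eventually_elim
      case (elim w)
      define \<xi> where "\<xi> = r * z * cnj w"
      have \<xi>: "cmod \<xi> = r" using elim z r by (simp add: \<xi>_def norm_mult)
      then have ne: "1 - \<xi> \<noteq> 0" "1 - cnj \<xi> \<noteq> 0"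
        using r by (metis eq_iff_diff_eq_0 norm_one less_irrefl, metis complex_mod_cnj eq_iff_diff_eq_0 norm_one less_irrefl)
      have "1 / (1 - \<xi>) + (1 / (1 - cnj \<xi>) - 1) = (1 - \<xi> * cnj \<xi>) / ((1 - \<xi>) * cnj (1 - \<xi>))"
        using ne by (simp add: field_simps)
      also have "\<dots> = of_real ((1 - r\<^sup>2) / (cmod (1 - \<xi>))\<^sup>2)"
        unfolding complex_norm_square[symmetric] \<xi> by simp
      finally have "1 / (1 - \<xi>) + (1 / (1 - cnj \<xi>) - 1) = of_real (poisson_kernel r z w)"
        by (simp add: poisson_kernel_def \<xi>_def)
      then have "f w * of_real (poisson_kernel r z w) = f w * (1 / (1 - \<xi>) + (1 / (1 - cnj \<xi>) - 1))"
        by simp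
      also have "cnj \<xi> = r * cnj z * w" by (simp add: \<xi>_def)
      finally show ?case
        by (simp add: \<xi>_def algebra_simps)
    qed
  qed measurable
  finally show ?thesis
    by (simp add: r_def field_simps)
qed

text \<open>The extension of the constant 1 is 1, since only its coefficient at 0 is nonzero; the
  kernel formula then yields the total mass.\<close>

lemma poisson_kernel_integral_complex:
  assumes "cmod z = 1" "0 < r" "r < 1"
  shows "(\<integral>w. complex_of_real (poisson_kernel r z w) \<partial>circle_measure) = 2 * pi"
proof -
  define s where "s = - ln r"
  have s: "s > 0" "exp (- s) = r" using assms by (auto simp: s_def)
  have c: "circle_coeff (\<lambda>z. 1) n = (if n = 0 then 1 else 0)" for n
    using fourier_to_L2[OF square_integrable_mode[of 1 0], of n] fourier_mode[of 1 0 n]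
    by (simp add: mode_def)
  have "poisson_ext (\<lambda>_. 1) s z = 1"
    unfolding poisson_ext_def analytic_part_def antianalytic_part_def
    by (simp add: c neg_coeff_def if_distrib[of "\<lambda>a. a * _"] cong: if_cong)
      (simp add: sums_unique[OF sums_single[of 0 "\<lambda>_. 1 :: complex"], symmetric])
  then show ?thesis
    using poisson_ext_eq_integral[of "\<lambda>_. 1" z s] assms s by simp
qed

lemma integrable_poisson_kernel:
  assumes "cmod z = 1" "0 < r" "r < 1"
  shows "integrable circle_measure (\<lambda>w. poisson_kernel r z w)"
proof (rule circle.integrable_const_bound[where B = "2 / (1 - r)"])
  show "AE w in circle_measure. norm (poisson_kernel r z w) \<le> 2 / (1 - r)"
    using AE_circle_norm
  proof eventually_elim
    case (elim w)
    then show ?case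
      using poisson_kernel_le_near[of z w r] poisson_kernel_nonneg[of r z w] assms by simp
  qed
qed measurable

lemma poisson_kernel_integral:
  assumes "cmod z = 1" "0 < r" "r < 1"
  shows "(\<integral>w. poisson_kernel r z w \<partial>circle_measure) = 2 * pi"
    and "(\<integral>w. poisson_kernel r w z \<partial>circle_measure) = 2 * pi"
proof -
  have "complex_of_real (\<integral>w. poisson_kernel r z w \<partial>circle_measure) = complex_of_real (2 * pi)"
    using poisson_kernel_integral_complex[OF assms] by simp
  then show "(\<integral>w. poisson_kernel r z w \<partial>circle_measure) = 2 * pi"
    unfolding of_real_eq_iff .
  then show "(\<integral>w. poisson_kernel r w z \<partial>circle_measure) = 2 * pi"
    by (simp add: poisson_kernel_commute)
qed

lemma nn_integral_poisson_kernel: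
  assumes "cmod z = 1" "0 < r" "r < 1"
  shows "(\<integral>\<^sup>+w. ennreal (poisson_kernel r w z) \<partial>circle_measure) = ennreal (2 * pi)"
  unfolding poisson_kernel_integral(2)[OF assms, symmetric] 
  using assms integrable_poisson_kernel[OF assms] 
  by (intro nn_integral_eq_integral) (auto simp: poisson_kernel_nonneg poisson_kernel_commute[of r _ z])

section \<open>Weighted square estimate for the Poisson extension\<close>

interpretation lborel_circle: pair_sigma_finite lborel circle_measure
  by standard

interpretation circle_lborel: pair_sigma_finite circle_measure lborel
  by standard

interpretation circle_circle: pair_sigma_finite circle_measure circle_measure
  by standard

lemma indicator_interval_eq: "indicator {a<..<b} s = (if a < s \<and> s < b then 1 else 0)"
  by (simp add: indicator_def)

lemma nn_integral_indicator_interval: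
  fixes a b :: real
  shows "(\<integral>\<^sup>+s. ennreal (indicator {a<..<b} s * c) \<partial>lborel) \<le> ennreal (max 0 (b - a)) * ennreal c"
proof -
  have "(\<integral>\<^sup>+s. ennreal (indicator {a<..<b} s * c) \<partial>lborel)
      = (\<integral>\<^sup>+s. ennreal c * indicator {a<..<b} s \<partial>lborel)"
    by (intro nn_integral_cong) (auto simp: indicator_def)
  also have "\<dots> = ennreal c * emeasure lborel {a<..<b}"
    by (subst nn_integral_cmult_indicator) auto
  also have "\<dots> \<le> ennreal (max 0 (b - a)) * ennreal c"
    by (cases "a \<le> b") (auto simp: mult.commute max_def)
  finally show ?thesis .
qed

text \<open>The region \<open>0 < s < Q z\<close> is cut at \<open>\<bar>z - w\<bar> = Q w\<close>: near \<open>w\<close> the weight is comparable to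
  \<open>1 / (Q w)\<^sup>2\<close> and the kernel has mass \<open>2 * pi\<close>, away from \<open>w\<close> the kernel is at most
  \<open>4 * s / \<bar>z - w\<bar>\<^sup>2\<close>, which is in turn dominated by the kernel of radius \<open>1 - Q w\<close>.\<close>

lemma poisson_kernel_weight_bound:
  fixes Q :: "complex \<Rightarrow> real"
  assumes [measurable]: "Q \<in> borel_measurable borel"
    and Q_le: "\<And>z. cmod z = 1 \<Longrightarrow> Q z \<le> 1 / 2"
    and Q_lip: "\<And>z w. \<bar>Q z - Q w\<bar> \<le> cmod (z - w) / 2"
    and w: "cmod w = 1" "Q w > 0"
  shows "(\<integral>\<^sup>+s. \<integral>\<^sup>+z. ennreal (indicator {0<..<Q z} s * (poisson_kernel (exp (- s)) z w / (Q z)\<^sup>2))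
    \<partial>circle_measure \<partial>lborel) \<le> ennreal (48 * pi / Q w)"
proof -
  define d where "d = Q w"
  have d: "0 < d" "d \<le> 1 / 2" using w Q_le[of w] by (auto simp: d_def)
  \<comment> \<open>Where |z - w| < d, the Lipschitz bound puts Q z between d / 2 and 2 d, whence
    the factor 4 / d^2 and the range of s in \<open>near\<close>. Elsewhere the kernel is at most 4
    Q z times 4 / d times the kernel of radius 1 - d; division by (Q z)^2 gives the factor in
    \<open>far\<close>. Both are nonnegative everywhere, so the sum dominates in either
    case.\<close>
  define near where "near s z = indicator {0<..<2 * d} s * (4 / d\<^sup>2 * poisson_kernel (exp (- s)) z w)" for s z
  define far where "far s z = indicator {0<..<Q z} s * (16 / (d * Q z) * poisson_kernel (1 - d) z w)" for s z
  have [measurable]: "case_prod near \<in> borel_measurable (lborel \<Otimes>\<^sub>M circle_measure)"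
    "case_prod far \<in> borel_measurable (lborel \<Otimes>\<^sub>M circle_measure)"
    unfolding near_def far_def indicator_interval_eq by measurable
  have near_nonneg: "0 \<le> near s z" for s z
    unfolding near_def by (auto simp: indicator_def intro!: mult_nonneg_nonneg divide_nonneg_nonneg poisson_kernel_nonneg)
  have far_nonneg: "0 \<le> far s z" for s z
    unfolding far_def using d
    by (auto simp: indicator_def intro!: mult_nonneg_nonneg divide_nonneg_nonneg poisson_kernel_nonneg)
  have le: "indicator {0<..<Q z} s * (poisson_kernel (exp (- s)) z w / (Q z)\<^sup>2) \<le> near s z + far s z"
    if z: "cmod z = 1" for s z
  proof (cases "0 < s \<and> s < Q z")
    case True
    have K: "0 \<le> poisson_kernel (exp (- s)) z w"
      using True by (intro poisson_kernel_nonneg) auto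
    show ?thesis
    proof (cases "cmod (z - w) < d")
      case near: True
      then have Qz: "d / 2 \<le> Q z" "Q z < 2 * d"
        using Q_lip[of z w] unfolding d_def by linarith+
      have "(d / 2)\<^sup>2 \<le> (Q z)\<^sup>2"
        using Qz d by (intro power_mono) auto
      then have "poisson_kernel (exp (- s)) z w / (Q z)\<^sup>2 \<le> poisson_kernel (exp (- s)) z w / (d / 2)\<^sup>2"
        using K d True by (intro divide_left_mono) auto
      then have "indicator {0<..<Q z} s * (poisson_kernel (exp (- s)) z w / (Q z)\<^sup>2) \<le> near s z"
        using True Qz by (simp add: near_def power_divide mult.commute)
      then show ?thesis using far_nonneg[of s z] by linarith
    next
      case False
      then have ne: "z \<noteq> w" using d by auto
      have "poisson_kernel (exp (- s)) z w \<le> 4 * s / (cmod (z - w))\<^sup>2"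
        using True Q_le[OF z] w ne by (intro poisson_kernel_le_far z) auto
      also have "\<dots> \<le> 4 * Q z * (1 / (cmod (z - w))\<^sup>2)"
        using True by (simp add: divide_right_mono)
      also have "\<dots> \<le> 4 * Q z * (4 / d * poisson_kernel (1 - d) z w)"
        using True d False by (intro mult_left_mono inverse_square_le_poisson_kernel z w) auto
      finally have "poisson_kernel (exp (- s)) z w / (Q z)\<^sup>2
          \<le> 4 * Q z * (4 / d * poisson_kernel (1 - d) z w) / (Q z)\<^sup>2"
        by (intro divide_right_mono) auto
      also have "\<dots> = 16 / (d * Q z) * poisson_kernel (1 - d) z w"
        using True by (simp add: power2_eq_square)
      finally have "indicator {0<..<Q z} s * (poisson_kernel (exp (- s)) z w / (Q z)\<^sup>2) \<le> far s z"
        using True by (simp add: far_def)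
      then show ?thesis using near_nonneg[of s z] by linarith
    qed
  next
    case False
    then show ?thesis using near_nonneg[of s z] far_nonneg[of s z] by (auto simp: indicator_def)
  qed
  have near_int: "(\<integral>\<^sup>+s. \<integral>\<^sup>+z. ennreal (near s z) \<partial>circle_measure \<partial>lborel) \<le> ennreal (16 * pi / d)"
  proof -
    have "(\<integral>\<^sup>+z. ennreal (near s z) \<partial>circle_measure) \<le> ennreal (indicator {0<..<2 * d} s * (8 * pi / d\<^sup>2))" for s
    proof (cases "0 < s \<and> s < 2 * d")
      case True
      have "(\<integral>\<^sup>+z. ennreal (near s z) \<partial>circle_measure)
          = (\<integral>\<^sup>+z. ennreal (4 / d\<^sup>2) * ennreal (poisson_kernel (exp (- s)) z w) \<partial>circle_measure)"
        using True d by (intro nn_integral_cong) (simp add: near_def ennreal_mult'[symmetric])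
      also have "\<dots> = ennreal (4 / d\<^sup>2) * ennreal (2 * pi)"
        using True w by (subst nn_integral_cmult) (auto simp: nn_integral_poisson_kernel)
      also have "\<dots> = ennreal (8 * pi / d\<^sup>2)"
        by (subst ennreal_mult'[symmetric]) auto
      finally show ?thesis using True by simp
    qed (auto simp: near_def)
    then have "(\<integral>\<^sup>+s. \<integral>\<^sup>+z. ennreal (near s z) \<partial>circle_measure \<partial>lborel)
        \<le> (\<integral>\<^sup>+s. ennreal (indicator {0<..<2 * d} s * (8 * pi / d\<^sup>2)) \<partial>lborel)"
      by (intro nn_integral_mono)
    also have "\<dots> \<le> ennreal (max 0 (2 * d - 0)) * ennreal (8 * pi / d\<^sup>2)"
      by (rule nn_integral_indicator_interval)
    also have "\<dots> = ennreal (16 * pi / d)"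
      using d by (subst ennreal_mult[symmetric]) (auto simp: power2_eq_square)
    finally show ?thesis .
  qed
  have far_int: "(\<integral>\<^sup>+s. \<integral>\<^sup>+z. ennreal (far s z) \<partial>circle_measure \<partial>lborel) \<le> ennreal (32 * pi / d)"
  proof -
    \<comment> \<open>Here s is integrated first: the length Q z of its range cancels the factor 1 /
      Q z, and a plain Poisson kernel is left for the integral over z.\<close>
    have "(\<integral>\<^sup>+s. ennreal (far s z) \<partial>lborel) \<le> ennreal (16 / d) * ennreal (poisson_kernel (1 - d) z w)" for z
    proof (cases "0 < Q z")
      case True
      have "(\<integral>\<^sup>+s. ennreal (far s z) \<partial>lborel)
          \<le> ennreal (max 0 (Q z - 0)) * ennreal (16 / (d * Q z) * poisson_kernel (1 - d) z w)"
        unfolding far_def by (rule nn_integral_indicator_interval)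
      also have "\<dots> = ennreal (Q z * (16 / (d * Q z) * poisson_kernel (1 - d) z w))"
        using True by (subst ennreal_mult'[symmetric]) auto
      also have "Q z * (16 / (d * Q z) * poisson_kernel (1 - d) z w) = 16 / d * poisson_kernel (1 - d) z w"
        using True d by simp
      finally show ?thesis
        using d by (subst ennreal_mult'[symmetric]) auto
    next
      case False
      then have "far s z = 0" for s by (auto simp: far_def indicator_def)
      then show ?thesis by simp
    qed
    then have "(\<integral>\<^sup>+z. \<integral>\<^sup>+s. ennreal (far s z) \<partial>lborel \<partial>circle_measure)
        \<le> (\<integral>\<^sup>+z. ennreal (16 / d) * ennreal (poisson_kernel (1 - d) z w) \<partial>circle_measure)"
      by (intro nn_integral_mono)
    also have "\<dots> = ennreal (16 / d) * ennreal (2 * pi)"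
      using d w by (subst nn_integral_cmult) (auto simp: nn_integral_poisson_kernel)
    also have "\<dots> = ennreal (32 * pi / d)"
      using d by (subst ennreal_mult[symmetric]) auto
    finally have "(\<integral>\<^sup>+z. \<integral>\<^sup>+s. ennreal (far s z) \<partial>lborel \<partial>circle_measure) \<le> ennreal (32 * pi / d)" .
    then show ?thesis
      by (subst lborel_circle.Fubini'[symmetric]) measurable
  qed
  have "(\<integral>\<^sup>+s. \<integral>\<^sup>+z. ennreal (indicator {0<..<Q z} s * (poisson_kernel (exp (- s)) z w / (Q z)\<^sup>2))
      \<partial>circle_measure \<partial>lborel)
      \<le> (\<integral>\<^sup>+s. \<integral>\<^sup>+z. ennreal (near s z) + ennreal (far s z) \<partial>circle_measure \<partial>lborel)"
  proof (rule nn_integral_mono, rule nn_integral_mono_AE)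
    fix s
    show "AE z in circle_measure. ennreal (indicator {0<..<Q z} s * (poisson_kernel (exp (- s)) z w / (Q z)\<^sup>2))
        \<le> ennreal (near s z) + ennreal (far s z)"
      using AE_circle_norm
    proof eventually_elim
      case (elim z)
      show ?case
        unfolding ennreal_plus[OF near_nonneg far_nonneg, symmetric]
        by (rule ennreal_leI, rule le, rule elim)
    qed
  qed
  also have "\<dots> = (\<integral>\<^sup>+s. \<integral>\<^sup>+z. ennreal (near s z) \<partial>circle_measure \<partial>lborel)
      + (\<integral>\<^sup>+s. \<integral>\<^sup>+z. ennreal (far s z) \<partial>circle_measure \<partial>lborel)"
    by (simp add: nn_integral_add)
  also have "\<dots> \<le> ennreal (16 * pi / d) + ennreal (32 * pi / d)"
    by (intro add_mono near_int far_int)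
  also have "\<dots> = ennreal (48 * pi / d)"
    using d by (subst ennreal_plus[symmetric]) (auto simp: field_simps)
  finally show ?thesis by (simp add: d_def)
qed

lemma square_integrable_imp_integrable:
  assumes "square_integrable f"
  shows "integrable circle_measure f"
proof (rule Bochner_Integration.integrable_bound)
  show "integrable circle_measure (\<lambda>z. 1 + (cmod (f z))\<^sup>2)"
    using assms by (simp add: square_integrable_def)
  have *: "a \<le> 1 + a\<^sup>2" for a :: real
    using zero_le_power2[of "a - 1/2"] by (simp add: power2_eq_square algebra_simps)
  then show "AE z in circle_measure. norm (f z) \<le> norm (1 + (cmod (f z))\<^sup>2)"
    by (auto simp: abs_of_nonneg)
qed (use assms in \<open>simp add: square_integrable_def\<close>)

text \<open>Jensen's inequality for the probability density K / (2 pi). It is obtained from the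
  nonnegativity of the variance, the integral of K |f - c|^2, where c is the mean of f, that is, the
  value of the extension.\<close>

lemma poisson_ext_square_le:
  assumes f: "square_integrable f" and z: "cmod z = 1" and s: "s > 0"
  shows "ennreal ((cmod (poisson_ext f s z))\<^sup>2)
    \<le> (\<integral>\<^sup>+w. ennreal (poisson_kernel (exp (- s)) z w) * ennreal ((cmod (f w))\<^sup>2 / (2 * pi)) \<partial>circle_measure)"
proof -
  define r where "r = exp (- s)"
  have r: "0 < r" "r < 1" using s by (auto simp: r_def)
  define K where "K w = poisson_kernel r z w" for w
  have K0: "0 \<le> K w" for w using r by (simp add: K_def poisson_kernel_nonneg)
  have KB: "AE w in circle_measure. cmod (complex_of_real (K w)) \<le> 2 / (1 - r)"
    using AE_circle_norm
  proof eventually_elim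
    case (elim w)
    then show ?case using poisson_kernel_le_near[OF z elim] r K0[of w] by (simp add: K_def)
  qed
  have [measurable]: "f \<in> borel_measurable borel" "K \<in> borel_measurable borel"
    using f unfolding K_def by (simp_all add: square_integrable_def cong: measurable_cong_sets)
  have fi: "integrable circle_measure f"
    using f by (rule square_integrable_imp_integrable)
  have i1: "integrable circle_measure (\<lambda>w. f w * complex_of_real (K w))"
    by (rule integrable_mult_bounded[OF fi _ KB]) measurable
  have i2: "integrable circle_measure (\<lambda>w. K w * (cmod (f w))\<^sup>2)"
  proof (rule Bochner_Integration.integrable_bound)
    show "integrable circle_measure (\<lambda>w. 2 / (1 - r) * (cmod (f w))\<^sup>2)"
      using f by (simp add: square_integrable_def)
    show "AE w in circle_measure. norm (K w * (cmod (f w))\<^sup>2) \<le> norm (2 / (1 - r) * (cmod (f w))\<^sup>2)"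
      using KB
    proof eventually_elim
      case (elim w)
      then have "K w * (cmod (f w))\<^sup>2 \<le> 2 / (1 - r) * (cmod (f w))\<^sup>2"
        using K0[of w] by (intro mult_right_mono) auto
      then show ?case using K0[of w] r by (simp add: abs_mult)
    qed
  qed measurable
  have i3: "integrable circle_measure K"
    unfolding K_def using integrable_poisson_kernel[OF z r] .
  define c where "c = poisson_ext f s z"
  have c: "(\<integral>w. f w * K w \<partial>circle_measure) = 2 * pi * c"
    unfolding c_def using poisson_ext_eq_integral[OF fi z s] by (simp add: K_def r_def)
  have "0 \<le> (\<integral>w. K w * (cmod (f w - c))\<^sup>2 \<partial>circle_measure)"
    using K0 by (intro integral_nonneg_AE) auto
  also have "\<dots> = (\<integral>w. K w * (cmod (f w))\<^sup>2 - 2 * Re (f w * K w * cnj c) + K w * (cmod c)\<^sup>2 \<partial>circle_measure)"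
  proof -
    have "(cmod (a - c))\<^sup>2 = (cmod a)\<^sup>2 - 2 * Re (a * cnj c) + (cmod c)\<^sup>2" for a
      unfolding cmod_power2 by (simp add: power2_eq_square algebra_simps)
    note expand = this
    show ?thesis
      unfolding expand by (intro Bochner_Integration.integral_cong refl) (simp add: algebra_simps)
  qed
  also have "\<dots> = (\<integral>w. K w * (cmod (f w))\<^sup>2 \<partial>circle_measure)
      - 2 * Re ((\<integral>w. f w * K w \<partial>circle_measure) * cnj c) + (\<integral>w. K w \<partial>circle_measure) * (cmod c)\<^sup>2"
  proof -
    define X where "X w = Re (f w * K w * cnj c)" for w
    have "integrable circle_measure (\<lambda>w. f w * K w * cnj c)"
      using i1 by (rule integrable_mult_left)
    note int = this
    have X: "integrable circle_measure X"
      "(\<integral>w. X w \<partial>circle_measure) = Re ((\<integral>w. f w * K w \<partial>circle_measure) * cnj c)"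
      unfolding X_def by (rule integrable_Re[OF int]) (simp only: integral_Re[OF int] integral_mult_left_zero)
    show ?thesis
      unfolding X_def[symmetric] X(2)[symmetric] using i2 i3 X(1) by simp
  qed
  also have "\<dots> = (\<integral>w. K w * (cmod (f w))\<^sup>2 \<partial>circle_measure) - 2 * pi * (cmod c)\<^sup>2"
    unfolding c using poisson_kernel_integral(1)[OF z r]
    by (simp add: K_def mult.assoc cmod_power2[of c] flip: power2_eq_square)
  finally have "(cmod c)\<^sup>2 \<le> (\<integral>w. K w * ((cmod (f w))\<^sup>2 / (2 * pi)) \<partial>circle_measure)"
    by (simp add: field_simps)
  then have "ennreal ((cmod c)\<^sup>2) \<le> ennreal (\<integral>w. K w * ((cmod (f w))\<^sup>2 / (2 * pi)) \<partial>circle_measure)"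
    by (rule ennreal_leI)
  also have "\<dots> = (\<integral>\<^sup>+w. ennreal (K w * ((cmod (f w))\<^sup>2 / (2 * pi))) \<partial>circle_measure)"
    using i2 K0 by (intro nn_integral_eq_integral[symmetric]) auto
  also have "\<dots> = (\<integral>\<^sup>+w. ennreal (K w) * ennreal ((cmod (f w))\<^sup>2 / (2 * pi)) \<partial>circle_measure)"
    using K0 by (intro nn_integral_cong ennreal_mult) auto
  finally show ?thesis by (simp add: c_def K_def r_def)
qed

text \<open>The Hardy type inequality: Jensen makes the left side linear in |f|^2, Tonelli moves the
  weight onto the kernel, and \<open>poisson_kernel_weight_bound\<close> evaluates it at each w. The
  constant is 48 pi divided by the 2 pi of Jensen's inequality; points with Q w \<le> 0 contribute
  nothing because f vanishes there.\<close>

lemma poisson_ext_weight_bound: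
  fixes Q :: "complex \<Rightarrow> real"
  assumes f: "square_integrable f" and Q [measurable]: "Q \<in> borel_measurable borel"
    and Q_le: "\<And>z. cmod z = 1 \<Longrightarrow> Q z \<le> 1 / 2"
    and Q_lip: "\<And>z w. \<bar>Q z - Q w\<bar> \<le> cmod (z - w) / 2"
    and f0: "AE w in circle_measure. Q w \<le> 0 \<longrightarrow> f w = 0"
  shows "(\<integral>\<^sup>+s. \<integral>\<^sup>+z. ennreal (indicator {0<..<Q z} s * ((cmod (poisson_ext f s z))\<^sup>2 / (Q z)\<^sup>2))
      \<partial>circle_measure \<partial>lborel)
    \<le> 24 * (\<integral>\<^sup>+w. ennreal ((cmod (f w))\<^sup>2 / Q w) \<partial>circle_measure)"
proof -
  have [measurable]: "f \<in> borel_measurable borel"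
    using f by (simp add: square_integrable_def cong: measurable_cong_sets)
  define k where "k s z w = ennreal (indicator {0<..<Q z} s * (poisson_kernel (exp (- s)) z w / (Q z)\<^sup>2))" for s z w
  define F where "F w = ennreal ((cmod (f w))\<^sup>2 / (2 * pi))" for w
  have [measurable]: "(\<lambda>(s, z, w). k s z w) \<in> borel_measurable (lborel \<Otimes>\<^sub>M circle_measure \<Otimes>\<^sub>M circle_measure)"
    unfolding k_def indicator_interval_eq by measurable
  have [measurable]: "F \<in> borel_measurable circle_measure"
    unfolding F_def by measurable
  have "(\<integral>\<^sup>+s. \<integral>\<^sup>+z. ennreal (indicator {0<..<Q z} s * ((cmod (poisson_ext f s z))\<^sup>2 / (Q z)\<^sup>2))
      \<partial>circle_measure \<partial>lborel) \<le> (\<integral>\<^sup>+s. \<integral>\<^sup>+z. \<integral>\<^sup>+w. k s z w * F w \<partial>circle_measure \<partial>circle_measure \<partial>lborel)"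
  proof (rule nn_integral_mono, rule nn_integral_mono_AE)
    fix s
    show "AE z in circle_measure. ennreal (indicator {0<..<Q z} s * ((cmod (poisson_ext f s z))\<^sup>2 / (Q z)\<^sup>2))
        \<le> (\<integral>\<^sup>+w. k s z w * F w \<partial>circle_measure)"
      using AE_circle_norm
    proof eventually_elim
      case (elim z)
      show ?case
      proof (cases "0 < s \<and> s < Q z")
        case True
        have "ennreal (indicator {0<..<Q z} s * ((cmod (poisson_ext f s z))\<^sup>2 / (Q z)\<^sup>2))
            = ennreal (1 / (Q z)\<^sup>2) * ennreal ((cmod (poisson_ext f s z))\<^sup>2)"
          using True by (simp add: ennreal_mult'[symmetric])
        also have "\<dots> \<le> ennreal (1 / (Q z)\<^sup>2)
            * (\<integral>\<^sup>+w. ennreal (poisson_kernel (exp (- s)) z w) * F w \<partial>circle_measure)"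
          unfolding F_def using True by (intro mult_left_mono poisson_ext_square_le f elim) auto
        also have "\<dots> = (\<integral>\<^sup>+w. ennreal (1 / (Q z)\<^sup>2)
            * (ennreal (poisson_kernel (exp (- s)) z w) * F w) \<partial>circle_measure)"
          by (rule nn_integral_cmult[symmetric]) measurable
        also have "\<dots> = (\<integral>\<^sup>+w. k s z w * F w \<partial>circle_measure)"
          using True by (intro nn_integral_cong)
            (simp add: k_def mult.assoc[symmetric] ennreal_mult'[symmetric])
        finally show ?thesis .
      qed auto
    qed
  qed
  also have "\<dots> = (\<integral>\<^sup>+s. \<integral>\<^sup>+w. \<integral>\<^sup>+z. k s z w * F w \<partial>circle_measure \<partial>circle_measure \<partial>lborel)"
    by (intro nn_integral_cong circle_circle.Fubini')
      (unfold k_def F_def indicator_interval_eq, measurable)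
  also have "\<dots> = (\<integral>\<^sup>+w. \<integral>\<^sup>+s. \<integral>\<^sup>+z. k s z w * F w \<partial>circle_measure \<partial>lborel \<partial>circle_measure)"
    by (rule circle_lborel.Fubini') (unfold k_def F_def indicator_interval_eq, measurable)
  also have "\<dots> = (\<integral>\<^sup>+w. (\<integral>\<^sup>+s. \<integral>\<^sup>+z. k s z w \<partial>circle_measure \<partial>lborel) * F w \<partial>circle_measure)"
  proof -
    have [measurable]: "(\<lambda>(s, z). k s z w) \<in> borel_measurable (lborel \<Otimes>\<^sub>M circle_measure)" for w
      unfolding k_def indicator_interval_eq by measurable
    show ?thesis by (simp add: nn_integral_multc)
  qed
  also have "\<dots> \<le> (\<integral>\<^sup>+w. 24 * ennreal ((cmod (f w))\<^sup>2 / Q w) \<partial>circle_measure)"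
  proof (rule nn_integral_mono_AE)
    show "AE w in circle_measure. (\<integral>\<^sup>+s. \<integral>\<^sup>+z. k s z w \<partial>circle_measure \<partial>lborel) * F w
        \<le> 24 * ennreal ((cmod (f w))\<^sup>2 / Q w)"
      using AE_circle_norm f0
    proof eventually_elim
      case (elim w)
      show ?case
      proof (cases "Q w > 0")
        case True
        have "(\<integral>\<^sup>+s. \<integral>\<^sup>+z. k s z w \<partial>circle_measure \<partial>lborel) * F w \<le> ennreal (48 * pi / Q w) * F w"
          unfolding k_def using elim True
          by (intro mult_right_mono poisson_kernel_weight_bound Q Q_le Q_lip) auto
        also have "\<dots> = ennreal (24 * ((cmod (f w))\<^sup>2 / Q w))"
          unfolding F_def using True by (subst ennreal_mult'[symmetric]) (auto simp: field_simps)
        also have "\<dots> = 24 * ennreal ((cmod (f w))\<^sup>2 / Q w)"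
          using True by (subst ennreal_mult) auto
        finally show ?thesis .
      next
        case False
        then show ?thesis using elim by (simp add: F_def)
      qed
    qed
  qed
  also have "\<dots> = 24 * (\<integral>\<^sup>+w. ennreal ((cmod (f w))\<^sup>2 / Q w) \<partial>circle_measure)"
    by (rule nn_integral_cmult) measurable
  finally show ?thesis .
qed

section \<open>Weak boundary values of the Poisson extension\<close>

text \<open>The averaged function depends on s as well, as the cutoff does, so the assumption is a
  joint limit as s \<rightarrow> 0 and z \<rightarrow> w. Near w the kernel has mass at most 2 pi,
  and at distance d or more it is at most 4 s / d^2.\<close>

lemma poisson_kernel_approximate_identity:
  fixes h :: "real \<Rightarrow> complex \<Rightarrow> complex"
    and l :: complex
  assumes w: "cmod w = 1" and [measurable]: "\<And>s. h s \<in> borel_measurable borel"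
    and bound: "\<And>s z. cmod z = 1 \<Longrightarrow> cmod (h s z) \<le> M"
    and near: "\<And>e. e > 0 \<Longrightarrow> \<exists>d>0. \<forall>s z. 0 < s \<longrightarrow> s < d \<longrightarrow> cmod z = 1 \<longrightarrow> cmod (z - w) < d
      \<longrightarrow> cmod (h s z - l) \<le> e"
  shows "((\<lambda>s. \<integral>z. poisson_kernel (exp (- s)) z w * h s z \<partial>circle_measure) \<longlongrightarrow> 2 * pi * l) (at_right 0)"
proof (rule tendstoI)
  fix e :: real assume e: "e > 0"
  \<comment> \<open>Against the mass 2 pi, the error e / (8 pi) costs e / 4. The far part costs C s,
    where the factor 2 pi in C is the mass of the circle, and is made smaller than e / 2.\<close>
  obtain d where d: "d > 0" and hd: "\<And>s z. \<lbrakk>0 < s; s < d; cmod z = 1; cmod (z - w) < d\<rbrakk>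
      \<Longrightarrow> cmod (h s z - l) \<le> e / (8 * pi)"
    using near[of "e / (8 * pi)"] e by auto
  define C where "C = (M + cmod l) * 4 / d\<^sup>2 * (2 * pi)"
  have "((\<lambda>s. C * s) \<longlongrightarrow> C * 0) (at_right 0)"
    by (intro tendsto_intros)
  then have "\<forall>\<^sub>F s in at_right 0. C * s < e / 2"
    using e by (intro order_tendstoD) auto
  moreover have "\<forall>\<^sub>F s in at_right (0::real). 0 < s \<and> s < min d (1 / 2)"
    using d eventually_at_right_real[of 0 "min d (1/2)"] by auto
  ultimately show "\<forall>\<^sub>F s in at_right 0.
      dist (\<integral>z. poisson_kernel (exp (- s)) z w * h s z \<partial>circle_measure) (2 * pi * l) < e"
  proof eventually_elim
    case (elim s)
    have s: "0 < s" "s < d" "s < 1 / 2" using elim by auto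
    define r where "r = exp (- s)"
    have r: "0 < r" "r < 1" using s by (auto simp: r_def)
    define K where "K z = poisson_kernel r z w" for z
    have K0: "0 \<le> K z" for z using r by (simp add: K_def poisson_kernel_nonneg)
    have [measurable]: "K \<in> borel_measurable borel" unfolding K_def by measurable
    have Ki: "integrable circle_measure K"
      unfolding K_def using integrable_poisson_kernel[OF w r] by (simp add: poisson_kernel_commute[of r _ w])
    have KI: "(\<integral>z. K z \<partial>circle_measure) = 2 * pi"
      unfolding K_def by (rule poisson_kernel_integral(2)[OF w r])
    have "integrable circle_measure (\<lambda>z. complex_of_real (K z))"
      using Ki by simp
    then have Khi: "integrable circle_measure (\<lambda>z. complex_of_real (K z) * h s z)"
      by (rule integrable_mult_bounded[where B = M])
         (measurable, use AE_circle_norm in eventually_elim, rule bound)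
    have eq: "(\<integral>z. K z * h s z \<partial>circle_measure) - 2 * pi * l = (\<integral>z. K z * (h s z - l) \<partial>circle_measure)"
      using Ki Khi by (simp add: right_diff_distrib KI)
    define B where "B = (M + cmod l) * (4 * s / d\<^sup>2)"
    have "cmod (\<integral>z. K z * (h s z - l) \<partial>circle_measure)
        \<le> (\<integral>z. cmod (K z * (h s z - l)) \<partial>circle_measure)"
      by (rule integral_norm_bound)
    also have "\<dots> \<le> (\<integral>z. K z * (e / (8 * pi)) + B \<partial>circle_measure)"
    proof (rule integral_mono_AE)
      show "integrable circle_measure (\<lambda>z. cmod (complex_of_real (K z) * (h s z - l)))"
        using Ki Khi by (intro integrable_norm) (simp add: right_diff_distrib)
      show "integrable circle_measure (\<lambda>z. K z * (e / (8 * pi)) + B)"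
        using Ki by simp
      show "AE z in circle_measure. cmod (K z * (h s z - l)) \<le> K z * (e / (8 * pi)) + B"
        using AE_circle_norm
      proof eventually_elim
        case (elim z)
        note z = elim
        have M: "0 \<le> M + cmod l" using bound[OF z, of s] norm_ge_zero[of "h s z"] norm_ge_zero[of l] by linarith
        have B: "0 \<le> B" unfolding B_def using M s by (intro mult_nonneg_nonneg) auto
        show ?case
        proof (cases "cmod (z - w) < d")
          case True
          then have "K z * cmod (h s z - l) \<le> K z * (e / (8 * pi))"
            using K0 s by (intro mult_left_mono hd z) auto
          then show ?thesis using B K0[of z] by (simp add: norm_mult)
        next
          case False
          then have zw: "d \<le> cmod (z - w)" "z \<noteq> w" using d by auto
          have "K z \<le> 4 * s / (cmod (z - w))\<^sup>2"
            unfolding K_def r_def using s zw by (intro poisson_kernel_le_far z w) auto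
          also have "\<dots> \<le> 4 * s / d\<^sup>2"
            using s zw d by (intro divide_left_mono power_mono mult_pos_pos) auto
          finally have "K z * cmod (h s z - l) \<le> 4 * s / d\<^sup>2 * (M + cmod l)"
            using K0 s bound[OF z, of s] norm_triangle_ineq4[of "h s z" l] M
            by (intro mult_mono) auto
          moreover have "0 \<le> K z * (e / (8 * pi))" using K0 e by simp
          ultimately show ?thesis using K0[of z] by (simp add: norm_mult B_def mult.commute)
        qed
      qed
    qed
    also have "\<dots> = e / 4 + C * s"
      using Ki by (simp add: KI C_def B_def measure_def emeasure_circle)
    also have "\<dots> < e" using elim e by simp
    finally show ?case
      using eq by (simp add: dist_norm K_def r_def)
  qed
qed

text \<open>Fubini moves the Poisson average from f, which is merely integrable, onto the bounded
  functions h. Their averages H converge almost everywhere by the preceding lemma and are at most 2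
  pi M, so M (2 pi) |f| is a majorant. Dominated convergence is for sequences, hence the sequence
  \<sigma>.\<close>

lemma poisson_ext_weak_limit:
  fixes h :: "real \<Rightarrow> complex \<Rightarrow> complex" and l :: "complex \<Rightarrow> complex"
  assumes f: "integrable circle_measure f"
    and [measurable]: "\<And>s. h s \<in> borel_measurable borel" "l \<in> borel_measurable borel"
    and bound: "\<And>s z. cmod z = 1 \<Longrightarrow> cmod (h s z) \<le> M"
    and near: "AE w in circle_measure. \<forall>e>0. \<exists>d>0. \<forall>s z. 0 < s \<longrightarrow> s < d \<longrightarrow> cmod z = 1
      \<longrightarrow> cmod (z - w) < d \<longrightarrow> cmod (h s z - l w) \<le> e"
    and \<sigma>: "\<And>k::nat. 0 < \<sigma> k" "\<sigma> \<longlonglongrightarrow> 0"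
  shows "(\<lambda>k. \<integral>z. h (\<sigma> k) z * poisson_ext f (\<sigma> k) z \<partial>circle_measure)
    \<longlonglongrightarrow> (\<integral>w. f w * l w \<partial>circle_measure)"
proof -
  have [measurable]: "f \<in> borel_measurable borel"
    using borel_measurable_integrable[OF f] by (simp cong: measurable_cong_sets)
  define H where "H s w = (\<integral>z. poisson_kernel (exp (- s)) z w * h s z \<partial>circle_measure)" for s w
  have [measurable]: "H s \<in> borel_measurable borel" for s
    unfolding H_def by measurable
  have M: "0 \<le> M" using order_trans[OF norm_ge_zero bound[of 1 0]] by simp
  have r: "0 < exp (- s)" "exp (- s) < 1" if "s > 0" for s :: real using that by auto
  have swap: "(\<integral>z. h s z * poisson_ext f s z \<partial>circle_measure) = (\<integral>w. f w * H s w \<partial>circle_measure) / (2 * pi)"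
    if s: "s > 0" for s
  proof -
    define \<Phi> where "\<Phi> z w = h s z * (f w * poisson_kernel (exp (- s)) z w)" for z w
    have [measurable]: "case_prod \<Phi> \<in> borel_measurable (circle_measure \<Otimes>\<^sub>M circle_measure)"
      unfolding \<Phi>_def by measurable
    define B where "B = 2 / (1 - exp (- s))"
    have \<Phi>_le: "cmod (\<Phi> z w) \<le> M * (cmod (f w) * B)" if "cmod z = 1" "cmod w = 1" for z w
      unfolding \<Phi>_def B_def norm_mult using that s M
      by (intro mult_mono bound mult_left_mono)
         (auto simp: poisson_kernel_le_near poisson_kernel_nonneg)
    have \<Phi>_int: "integrable circle_measure (\<Phi> z)" if z: "cmod z = 1" for z
    proof (rule Bochner_Integration.integrable_bound)
      show "integrable circle_measure (\<lambda>w. M * (cmod (f w) * B))"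
        using f by simp
      show "AE w in circle_measure. norm (\<Phi> z w) \<le> norm (M * (cmod (f w) * B))"
        using AE_circle_norm
      proof eventually_elim
        case (elim w)
        show ?case using \<Phi>_le[OF z elim] by simp
      qed
    qed measurable
    have "integrable (circle_measure \<Otimes>\<^sub>M circle_measure) (case_prod \<Phi>)"
    proof (rule circle_circle.Fubini_integrable)
      show "AE z in circle_measure. integrable circle_measure (\<lambda>w. case (z, w) of (z, w) \<Rightarrow> \<Phi> z w)"
        using AE_circle_norm by eventually_elim (simp add: \<Phi>_int)
      show "integrable circle_measure (\<lambda>z. \<integral>w. norm (case (z, w) of (z, w) \<Rightarrow> \<Phi> z w) \<partial>circle_measure)"
      proof (rule circle.integrable_const_bound[where B = "\<integral>w. M * (cmod (f w) * B) \<partial>circle_measure"])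
        show "AE z in circle_measure. norm (\<integral>w. norm (case (z, w) of (z, w) \<Rightarrow> \<Phi> z w) \<partial>circle_measure)
            \<le> (\<integral>w. M * (cmod (f w) * B) \<partial>circle_measure)"
          using AE_circle_norm
        proof eventually_elim
          case (elim z)
          have "(\<integral>w. norm (\<Phi> z w) \<partial>circle_measure) \<le> (\<integral>w. M * (cmod (f w) * B) \<partial>circle_measure)"
          proof (rule integral_mono_AE)
            show "AE w in circle_measure. norm (\<Phi> z w) \<le> M * (cmod (f w) * B)"
              using AE_circle_norm by eventually_elim (rule \<Phi>_le[OF elim])
          qed (use f \<Phi>_int[OF elim] in auto)
          then show ?case by simp
        qed
      qed measurable
    qed measurable
    then have "(\<integral>w. (\<integral>z. \<Phi> z w \<partial>circle_measure) \<partial>circle_measure)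
        = (\<integral>z. (\<integral>w. \<Phi> z w \<partial>circle_measure) \<partial>circle_measure)"
      by (rule circle_circle.Fubini_integral)
    also have "\<dots> = (\<integral>z. h s z * (2 * pi * poisson_ext f s z) \<partial>circle_measure)"
    proof (rule integral_cong_AE)
      show "AE z in circle_measure. (\<integral>w. \<Phi> z w \<partial>circle_measure) = h s z * (2 * pi * poisson_ext f s z)"
        using AE_circle_norm
        by eventually_elim (simp add: \<Phi>_def poisson_ext_eq_integral[OF f _ s])
      have "(\<lambda>z. poisson_ext f s z) \<in> borel_measurable borel"
        unfolding poisson_ext_def analytic_part_def antianalytic_part_def by measurable
      then show "(\<lambda>z. h s z * (2 * pi * poisson_ext f s z)) \<in> borel_measurable circle_measure"
        by measurable
    qed measurable
    also have "\<dots> = 2 * pi * (\<integral>z. h s z * poisson_ext f s z \<partial>circle_measure)"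
      by (simp add: mult.left_commute[of _ "2 * pi"] mult.assoc mult.left_commute[of "h _ _"])
    also have "(\<integral>w. (\<integral>z. \<Phi> z w \<partial>circle_measure) \<partial>circle_measure) = (\<integral>w. f w * H s w \<partial>circle_measure)"
      unfolding \<Phi>_def H_def
      by (intro Bochner_Integration.integral_cong refl)
         (simp add: mult_ac flip: integral_mult_right_zero)
    finally show ?thesis by simp
  qed
  have H_le: "cmod (H s w) \<le> M * (2 * pi)" if s: "s > 0" and w: "cmod w = 1" for s w
  proof -
    have Ki: "integrable circle_measure (\<lambda>z. poisson_kernel (exp (- s)) z w)"
      using integrable_poisson_kernel[OF w r[OF s]] by (simp add: poisson_kernel_commute[of _ _ w])
    have le: "AE z in circle_measure. norm (poisson_kernel (exp (- s)) z w * h s z)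
        \<le> M * poisson_kernel (exp (- s)) z w"
      using AE_circle_norm
    proof eventually_elim
      case (elim z)
      then show ?case
        using mult_right_mono[OF bound[OF elim, of s] poisson_kernel_nonneg[of "exp (- s)" z w]] s
          poisson_kernel_nonneg[of "exp (- s)" z w]
        by (simp add: norm_mult mult.commute)
    qed
    have "cmod (H s w) \<le> (\<integral>z. norm (poisson_kernel (exp (- s)) z w * h s z) \<partial>circle_measure)"
      unfolding H_def by (rule integral_norm_bound)
    also have "\<dots> \<le> (\<integral>z. M * poisson_kernel (exp (- s)) z w \<partial>circle_measure)"
    proof (rule integral_mono_AE[OF _ _ le])
      have "integrable circle_measure (\<lambda>z. poisson_kernel (exp (- s)) z w * h s z)"
        by (rule Bochner_Integration.integrable_bound[of _ "\<lambda>z. M * poisson_kernel (exp (- s)) z w"])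
           (use Ki in simp, measurable, use le in eventually_elim, simp)
      then show "integrable circle_measure (\<lambda>z. norm (poisson_kernel (exp (- s)) z w * h s z))"
        by (rule integrable_norm)
    qed (use Ki in simp)
    also have "\<dots> = M * (2 * pi)"
      using poisson_kernel_integral(2)[OF w r[OF s]] by simp
    finally show ?thesis .
  qed
  have "(\<lambda>k. \<integral>w. f w * H (\<sigma> k) w \<partial>circle_measure) \<longlonglongrightarrow> (\<integral>w. f w * (2 * pi * l w) \<partial>circle_measure)"
  proof (rule integral_dominated_convergence[where w = "\<lambda>w. cmod (f w) * (M * (2 * pi))"])
    show "integrable circle_measure (\<lambda>w. cmod (f w) * (M * (2 * pi)))"
      using f by simp
    show "AE w in circle_measure. (\<lambda>k. f w * H (\<sigma> k) w) \<longlonglongrightarrow> f w * (2 * pi * l w)"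
      using AE_circle_norm near
    proof eventually_elim
      case (elim w)
      have "((\<lambda>s. H s w) \<longlongrightarrow> 2 * pi * l w) (at_right 0)"
        unfolding H_def using elim bound by (intro poisson_kernel_approximate_identity) auto
      moreover have "filterlim \<sigma> (at_right 0) sequentially"
        using \<sigma> by (intro tendsto_imp_filterlim_at_right) auto
      ultimately show ?case
        by (intro tendsto_mult_left) (rule filterlim_compose)
    qed
    show "AE w in circle_measure. norm (f w * H (\<sigma> k) w) \<le> cmod (f w) * (M * (2 * pi))" for k
      using AE_circle_norm
    proof eventually_elim
      case (elim w)
      show ?case unfolding norm_mult by (intro mult_left_mono H_le \<sigma> elim) auto
    qed
  qed measurable
  then have "(\<lambda>k. (\<integral>w. f w * H (\<sigma> k) w \<partial>circle_measure) / (2 * pi))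
      \<longlonglongrightarrow> (\<integral>w. f w * (2 * pi * l w) \<partial>circle_measure) / (2 * pi)"
    by (intro tendsto_divide tendsto_const) auto
  moreover have "(\<integral>w. f w * (2 * pi * l w) \<partial>circle_measure) = 2 * pi * (\<integral>w. f w * l w \<partial>circle_measure)"
    by (simp add: mult.left_commute[of "f _"] mult.assoc)
  ultimately show ?thesis
    using \<sigma>(1) by (simp add: swap)
qed

text \<open>Integration by parts on the cylinder [\<epsilon>, T] times the circle: the x-derivative
  integrates to 0 by periodicity, and after swapping the integrals the s-derivative leaves only the
  boundary term at \<epsilon>. Regularity is asked for s > 0 only, as the cutoff is singular at s =
  0.\<close>

lemma double_integral_FTC:
  fixes \<Phi> \<Phi>s \<Phi>x :: "real \<Rightarrow> real \<Rightarrow> complex"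
  assumes \<epsilon>: "0 < \<epsilon>" "\<epsilon> \<le> T"
    and ds: "\<And>s x. s > 0 \<Longrightarrow> ((\<lambda>s. \<Phi> s x) has_vector_derivative \<Phi>s s x) (at s)"
    and dx: "\<And>s x. s > 0 \<Longrightarrow> ((\<lambda>x. \<Phi> s x) has_vector_derivative \<Phi>x s x) (at x)"
    and cs: "continuous_on ({0<..} \<times> UNIV) (\<lambda>(s, x). \<Phi>s s x)"
    and cx: "continuous_on ({0<..} \<times> UNIV) (\<lambda>(s, x). \<Phi>x s x)"
    and periodic: "\<And>s. s > 0 \<Longrightarrow> \<Phi> s (2 * pi) = \<Phi> s 0" and final: "\<And>x. \<Phi> T x = 0"
  shows "integral {\<epsilon>..T} (\<lambda>s. integral {0..2*pi} (\<lambda>x. \<Phi>s s x - \<i> * \<Phi>x s x))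
    = - integral {0..2*pi} (\<Phi> \<epsilon>)"
proof -
  have inner: "integral {0..2*pi} (\<lambda>x. \<Phi>s s x - \<i> * \<Phi>x s x) = integral {0..2*pi} (\<Phi>s s)" if s: "s > 0" for s
  proof -
    have "continuous_on {0..2*pi} (\<lambda>x. (\<lambda>(s, x). \<Phi>s s x) (s, x))"
      by (rule continuous_on_compose2[OF cs]) (use s in \<open>auto intro!: continuous_intros\<close>)
    then have i1: "\<Phi>s s integrable_on {0..2*pi}"
      by (intro integrable_continuous_real) simp
    have "(\<Phi>x s has_integral (\<Phi> s (2 * pi) - \<Phi> s 0)) {0..2*pi}"
      by (rule fundamental_theorem_of_calculus) (use dx[OF s] in \<open>auto intro: has_vector_derivative_at_within\<close>)
    then have "(\<Phi>x s has_integral 0) {0..2*pi}"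
      using periodic[OF s] by simp
    from has_integral_mult_right[OF this, of \<i>]
    have "((\<lambda>x. \<Phi>s s x - \<i> * \<Phi>x s x) has_integral (integral {0..2*pi} (\<Phi>s s) - \<i> * 0)) {0..2*pi}"
      by (intro has_integral_diff integrable_integral i1)
    then show ?thesis by (simp add: integral_unique)
  qed
  have "integral {\<epsilon>..T} (\<lambda>s. integral {0..2*pi} (\<lambda>x. \<Phi>s s x - \<i> * \<Phi>x s x))
      = integral (cbox \<epsilon> T) (\<lambda>s. integral (cbox 0 (2*pi)) (\<Phi>s s))"
    unfolding cbox_interval using \<epsilon> by (intro integral_cong inner) auto
  also have "\<dots> = integral (cbox 0 (2*pi)) (\<lambda>x. integral (cbox \<epsilon> T) (\<lambda>s. \<Phi>s s x))"
    by (rule integral_swap_continuous, rule continuous_on_subset[OF cs])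
       (use \<epsilon> in \<open>auto simp: cbox_Pair_eq\<close>)
  also have "\<dots> = integral {0..2*pi} (\<lambda>x. - \<Phi> \<epsilon> x)"
    unfolding cbox_interval
  proof (rule integral_cong)
    fix x
    have "((\<lambda>s. \<Phi>s s x) has_integral (\<Phi> T x - \<Phi> \<epsilon> x)) {\<epsilon>..T}"
      by (rule fundamental_theorem_of_calculus)
         (use \<epsilon> ds in \<open>auto intro: has_vector_derivative_at_within\<close>)
    then show "integral {\<epsilon>..T} (\<lambda>s. \<Phi>s s x) = - \<Phi> \<epsilon> x"
      by (simp add: final integral_unique)
  qed
  finally show ?thesis by simp
qed

section \<open>The cutoff\<close>

text \<open>Squaring the positive part makes the cutoff continuously differentiable across the line
  y = s.\<close>

lemma max_square_derivative: "((\<lambda>y. (max 0 y)\<^sup>2) has_real_derivative 2 * max 0 y) (at y)"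
proof -
  consider "y > 0" | "y < 0" | "y = 0" by linarith
  then show ?thesis
  proof cases
    case 1
    have "((\<lambda>y. y\<^sup>2) has_real_derivative 2 * y) (at y)"
      by (auto intro!: derivative_eq_intros)
    then have "((\<lambda>y. (max 0 y)\<^sup>2) has_real_derivative 2 * y) (at y)"
      by (rule DERIV_cong_ev[THEN iffD1, rotated 3, OF _])
         (use 1 in \<open>auto intro!: eventually_mono[OF eventually_nhds_in_open[of "{0<..}" y]] simp: max_def\<close>)
    then show ?thesis using 1 by simp
  next
    case 2
    have "((\<lambda>y. 0) has_real_derivative 0) (at y)"
      by simp
    then have "((\<lambda>y. (max 0 y)\<^sup>2) has_real_derivative 0) (at y)"
      by (rule DERIV_cong_ev[THEN iffD1, rotated 3, OF _])
         (use 2 in \<open>auto intro!: eventually_mono[OF eventually_nhds_in_open[of "{..<0}" y]] simp: max_def\<close>)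
    then show ?thesis using 2 by simp
  next
    case 3
    have "((\<lambda>h. ((max 0 (0 + h))\<^sup>2 - (max 0 0)\<^sup>2) / h) \<longlongrightarrow> 0) (at (0::real))"
    proof (rule Lim_null_comparison)
      show "\<forall>\<^sub>F h in at (0::real). norm (((max 0 (0 + h))\<^sup>2 - (max 0 0)\<^sup>2) / h) \<le> \<bar>h\<bar>"
        by (rule always_eventually) (auto simp: max_def power2_eq_square)
      show "((\<lambda>h. \<bar>h\<bar>) \<longlongrightarrow> 0) (at (0::real))"
        by (rule tendsto_rabs_zero) (rule tendsto_ident_at)
    qed
    then show ?thesis using 3 by (simp add: DERIV_def)
  qed
qed

text \<open>At \<open>s = 0\<close> this is the indicator of \<open>y > 0\<close>, because \<open>0 / 0 = 0\<close>.\<close>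

definition cutoff :: "real \<Rightarrow> real \<Rightarrow> real"
  where "cutoff y s = (max 0 (y - s))\<^sup>2 / (y\<^sup>2 + s\<^sup>2)"

definition cutoff_dy :: "real \<Rightarrow> real \<Rightarrow> real"
  where "cutoff_dy y s = 2 * max 0 (y - s) / (y\<^sup>2 + s\<^sup>2) - (max 0 (y - s))\<^sup>2 * (2 * y) / (y\<^sup>2 + s\<^sup>2)\<^sup>2"

definition cutoff_ds :: "real \<Rightarrow> real \<Rightarrow> real"
  where "cutoff_ds y s = - (2 * max 0 (y - s) / (y\<^sup>2 + s\<^sup>2)) - (max 0 (y - s))\<^sup>2 * (2 * s) / (y\<^sup>2 + s\<^sup>2)\<^sup>2"

lemma cutoff_measurable [measurable]:
  assumes [measurable]: "f \<in> borel_measurable M" "g \<in> borel_measurable M"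
  shows "(\<lambda>x. cutoff (f x) (g x)) \<in> borel_measurable M"
    and "(\<lambda>x. cutoff_dy (f x) (g x)) \<in> borel_measurable M"
    and "(\<lambda>x. cutoff_ds (f x) (g x)) \<in> borel_measurable M"
  unfolding cutoff_def cutoff_dy_def cutoff_ds_def by measurable

lemma cutoff_has_derivative_y:
  assumes "s > 0"
  shows "((\<lambda>y. cutoff y s) has_real_derivative cutoff_dy y s) (at y)"
proof -
  have d: "y\<^sup>2 + s\<^sup>2 > 0" using assms by (intro add_nonneg_pos) auto
  have "((\<lambda>y. (max 0 (y - s))\<^sup>2) has_real_derivative 2 * max 0 (y - s) * (1 - 0)) (at y)"
    by (rule DERIV_chain2[OF max_square_derivative]) (auto intro!: derivative_eq_intros)
  moreover have "((\<lambda>y. y\<^sup>2 + s\<^sup>2) has_real_derivative 2 * y) (at y)"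
    by (auto intro!: derivative_eq_intros)
  ultimately have "((\<lambda>y. (max 0 (y - s))\<^sup>2 / (y\<^sup>2 + s\<^sup>2)) has_real_derivative
      (2 * max 0 (y - s) * (1 - 0) * (y\<^sup>2 + s\<^sup>2) - (max 0 (y - s))\<^sup>2 * (2 * y))
        / ((y\<^sup>2 + s\<^sup>2) * (y\<^sup>2 + s\<^sup>2))) (at y)"
    using d by (intro DERIV_divide) auto
  then show ?thesis
    unfolding cutoff_def cutoff_dy_def using d assms by (simp add: diff_divide_distrib power2_eq_square)
qed

lemma cutoff_has_derivative_s:
  assumes "s > 0"
  shows "((\<lambda>s. cutoff y s) has_real_derivative cutoff_ds y s) (at s)"
proof -
  have d: "y\<^sup>2 + s\<^sup>2 > 0" using assms by (intro add_nonneg_pos) auto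
  have "((\<lambda>s. (max 0 (y - s))\<^sup>2) has_real_derivative 2 * max 0 (y - s) * (0 - 1)) (at s)"
    by (rule DERIV_chain2[OF max_square_derivative]) (auto intro!: derivative_eq_intros)
  moreover have "((\<lambda>s. y\<^sup>2 + s\<^sup>2) has_real_derivative 2 * s) (at s)"
    by (auto intro!: derivative_eq_intros)
  ultimately have "((\<lambda>s. (max 0 (y - s))\<^sup>2 / (y\<^sup>2 + s\<^sup>2)) has_real_derivative
      (2 * max 0 (y - s) * (0 - 1) * (y\<^sup>2 + s\<^sup>2) - (max 0 (y - s))\<^sup>2 * (2 * s))
        / ((y\<^sup>2 + s\<^sup>2) * (y\<^sup>2 + s\<^sup>2))) (at s)"
    using d by (intro DERIV_divide) auto
  then show ?thesis
    unfolding cutoff_def cutoff_ds_def using d assms by (simp add: diff_divide_distrib power2_eq_square)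
qed

lemma cutoff_eq_0: "y \<le> s \<Longrightarrow> cutoff y s = 0" "y \<le> s \<Longrightarrow> cutoff_dy y s = 0" "y \<le> s \<Longrightarrow> cutoff_ds y s = 0"
  by (simp_all add: cutoff_def cutoff_dy_def cutoff_ds_def)

text \<open>The bound 2, unlike 1, also holds for negative s; \<open>poisson_ext_weak_limit\<close>
  asks for a bound uniform in all real s.\<close>

lemma cutoff_bounds: "0 \<le> cutoff y s" "cutoff y s \<le> 2"
proof -
  show "0 \<le> cutoff y s" by (simp add: cutoff_def)
  have "(max 0 (y - s))\<^sup>2 \<le> (y - s)\<^sup>2"
    by (auto simp: max_def)
  also have "(y - s)\<^sup>2 \<le> 2 * (y\<^sup>2 + s\<^sup>2)"
    using zero_le_power2[of "y + s"] by (simp add: power2_eq_square algebra_simps)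
  finally show "cutoff y s \<le> 2"
    unfolding cutoff_def by (cases "y\<^sup>2 + s\<^sup>2 = 0") (auto simp: divide_simps add_nonneg_pos sum_power2_gt_zero_iff)
qed

text \<open>The cutoff is homogeneous of degree 0 in (y, s), so its derivatives have degree -1 and
  are O(1 / y) in the cone 0 < s < y. Each of the two terms of a derivative is at most 2 / y in
  absolute value.\<close>

lemma cutoff_derivative_bounds:
  assumes "0 < s" "s < y"
  shows "cutoff y s \<le> 1" "\<bar>cutoff_dy y s\<bar> \<le> 4 / y" "\<bar>cutoff_ds y s\<bar> \<le> 4 / y"
proof -
  define q where "q = y\<^sup>2 + s\<^sup>2"
  define m where "m = max 0 (y - s)"
  have m: "0 \<le> m" "m \<le> y" using assms by (auto simp: m_def)
  have q: "y\<^sup>2 \<le> q" "0 < q" using assms by (auto simp: q_def add_pos_nonneg)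
  have m2: "m\<^sup>2 \<le> q" using power_mono[OF m(2) m(1), of 2] q by simp
  show "cutoff y s \<le> 1"
    unfolding cutoff_def m_def[symmetric] q_def[symmetric] using m2 q by simp
  have 1: "2 * m / q \<le> 2 / y"
  proof -
    have "2 * m / q \<le> 2 * y / y\<^sup>2"
      using m q assms by (intro frac_le) auto
    then show ?thesis using assms by (simp add: power2_eq_square)
  qed
  have 2: "m\<^sup>2 * (2 * t) / q\<^sup>2 \<le> 2 / y" "0 \<le> m\<^sup>2 * (2 * t) / q\<^sup>2" if "0 \<le> t" "t \<le> y" for t
  proof -
    have "m\<^sup>2 * (2 * t) / q\<^sup>2 = (m\<^sup>2 / q) * (2 * t / q)"
      by (simp add: power2_eq_square)
    also have "\<dots> \<le> 1 * (2 * y / y\<^sup>2)"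
      using m2 q that assms by (intro mult_mono frac_le) auto
    finally show "m\<^sup>2 * (2 * t) / q\<^sup>2 \<le> 2 / y" using assms by (simp add: power2_eq_square)
  qed (use that in simp)
  have 0: "0 \<le> 2 * m / q" using m q by simp
  have 4: "4 / y = 2 / y + 2 / y" by simp
  show "\<bar>cutoff_dy y s\<bar> \<le> 4 / y"
    unfolding cutoff_dy_def m_def[symmetric] q_def[symmetric]
    using 0 1 2[of y] assms unfolding abs_le_iff 4 by linarith
  show "\<bar>cutoff_ds y s\<bar> \<le> 4 / y"
    unfolding cutoff_ds_def m_def[symmetric] q_def[symmetric]
    using 0 1 2[of s] assms unfolding abs_le_iff 4 by linarith
qed

section \<open>The control\<close>

lemma cis_has_vector_derivative: "(cis has_vector_derivative \<i> * cis x) (at x)"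
  unfolding has_vector_derivative_def
  by (rule derivative_eq_intros has_derivative_cis refl | simp)+

text \<open>In the application c is the midpoint and h half the opening of the arc, and \<kappa>
  scales the weight Q. The bound \<kappa> \<le> 1 / 4 makes Q at most 1 / 2 with Lipschitz constant
  at most 1 / 2, as the weighted estimate demands; 2 \<kappa> \<le> T makes Q at most T, so that the
  cutoff has vanished at time T.\<close>

locale arc_control =
  fixes f :: "complex \<Rightarrow> complex" and c :: complex and \<kappa> h T :: real
  assumes square_integrable: "square_integrable f"
    and c: "cmod c = 1" and \<kappa>: "0 < \<kappa>" "\<kappa> \<le> 1 / 4" "2 * \<kappa> \<le> T"
begin

text \<open>A smooth substitute for the distance to the end points: on the circle |Q z| is \<kappa>
  / 2 times the product of the distances to both of them, and Q is positive exactly on the arc.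
  \<open>Q'\<close> is its derivative in the angle.\<close>

definition Q :: "complex \<Rightarrow> real"
  where "Q z = \<kappa> * (Re (z * cnj c) - cos h)"

definition Q' :: "complex \<Rightarrow> real"
  where "Q' z = - \<kappa> * Im (z * cnj c)"

lemma f_measurable [measurable]: "f \<in> borel_measurable borel"
  using square_integrable by (simp add: square_integrable_def cong: measurable_cong_sets)

lemma f_integrable: "integrable circle_measure f"
  using square_integrable by (rule square_integrable_imp_integrable)

lemma Q_measurable [measurable]: "Q \<in> borel_measurable borel" "Q' \<in> borel_measurable borel"
  unfolding Q_def Q'_def by measurable

lemma Re_mult_cnj_le:
  assumes "cmod z = 1" shows "\<bar>Re (z * cnj c)\<bar> \<le> 1" "\<bar>Im (z * cnj c)\<bar> \<le> 1"
  using abs_Re_le_cmod[of "z * cnj c"] abs_Im_le_cmod[of "z * cnj c"] assms c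
  by (auto simp del: times_complex.simps simp: norm_mult)

lemma Q_le:
  assumes "cmod z = 1"
  shows "Q z \<le> 2 * \<kappa>" "Q z \<le> 1 / 2" "Q z \<le> T" "\<bar>Q' z\<bar> \<le> 1"
proof -
  have "Re (z * cnj c) - cos h \<le> 2"
    using Re_mult_cnj_le(1)[OF assms] cos_ge_minus_one[of h] by linarith
  then show "Q z \<le> 2 * \<kappa>"
    unfolding Q_def using \<kappa> mult_left_mono[of "Re (z * cnj c) - cos h" 2 \<kappa>] by simp
  then show "Q z \<le> 1 / 2" "Q z \<le> T" using \<kappa> by auto
  have "\<bar>Q' z\<bar> = \<kappa> * \<bar>Im (z * cnj c)\<bar>"
    unfolding Q'_def using \<kappa> by (simp add: abs_mult)
  also have "\<dots> \<le> 1 * 1"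
    using \<kappa> Re_mult_cnj_le(2)[OF assms] by (intro mult_mono) auto
  finally show "\<bar>Q' z\<bar> \<le> 1" by simp
qed

lemma Q_lipschitz: "\<bar>Q z - Q w\<bar> \<le> cmod (z - w) / 2"
proof -
  have "\<bar>Q z - Q w\<bar> = \<kappa> * \<bar>Re ((z - w) * cnj c)\<bar>"
  proof -
    have "Q z - Q w = \<kappa> * Re ((z - w) * cnj c)"
      by (simp add: Q_def algebra_simps)
    then show ?thesis using \<kappa> by (simp add: abs_mult)
  qed
  also have "\<dots> \<le> \<kappa> * cmod (z - w)"
    using \<kappa> abs_Re_le_cmod[of "(z - w) * cnj c"] c
    by (intro mult_left_mono) (auto simp del: times_complex.simps simp: norm_mult)
  also have "\<dots> \<le> 1 / 2 * cmod (z - w)"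
    using \<kappa> by (intro mult_right_mono) auto
  finally show ?thesis by simp
qed

lemma Q_cis_derivative: "((\<lambda>x. Q (cis x)) has_real_derivative Q' (cis x)) (at x)"
  unfolding Q_def Q'_def by (auto intro!: derivative_eq_intros simp: algebra_simps)

definition antianalytic_deriv :: "complex \<Rightarrow> complex"
  where "antianalytic_deriv \<xi> = (\<Sum>m. diffs (neg_coeff f) m * \<xi> ^ m)"

definition analytic_deriv :: "complex \<Rightarrow> complex"
  where "analytic_deriv \<xi> = (\<Sum>m. diffs (\<lambda>m. circle_coeff f (int m)) m * \<xi> ^ m)"

lemma summable_parts:
  assumes "cmod \<xi> < 1"
  shows "summable (\<lambda>m. neg_coeff f m * \<xi> ^ m)" "summable (\<lambda>m. circle_coeff f (int m) * \<xi> ^ m)"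
  using antianalytic_part_sums[OF f_integrable assms] analytic_part_sums[OF f_integrable assms]
  by (auto simp: sums_iff)

lemma parts_derivative:
  assumes "cmod \<xi> < 1"
  shows "(antianalytic_part f has_field_derivative antianalytic_deriv \<xi>) (at \<xi>)"
    and "(analytic_part f has_field_derivative analytic_deriv \<xi>) (at \<xi>)"
  unfolding antianalytic_part_def[abs_def] antianalytic_deriv_def
    analytic_part_def[abs_def] analytic_deriv_def
  by (rule termdiffs_strong'[where K = 1]; use summable_parts assms in blast)+

lemma parts_continuous:
  "continuous_on (ball 0 1) (antianalytic_part f)" "continuous_on (ball 0 1) (analytic_part f)"
  "continuous_on (ball 0 1) antianalytic_deriv" "continuous_on (ball 0 1) analytic_deriv"
proof -
  show "continuous_on (ball 0 1) (antianalytic_part f)" "continuous_on (ball 0 1) (analytic_part f)"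
    using parts_derivative by (auto intro!: continuous_at_imp_continuous_on DERIV_isCont)
  have cont: "continuous_on (ball 0 1) (\<lambda>\<xi>. \<Sum>m. diffs a m * \<xi> ^ m)"
    if a: "\<And>\<xi>. cmod \<xi> < 1 \<Longrightarrow> summable (\<lambda>m. a m * \<xi> ^ m)" for a :: "nat \<Rightarrow> complex"
  proof (intro continuous_at_imp_continuous_on ballI)
    fix \<xi> :: complex assume \<xi>: "\<xi> \<in> ball 0 1"
    have "((\<lambda>\<xi>. \<Sum>m. diffs a m * \<xi> ^ m) has_field_derivative (\<Sum>m. diffs (diffs a) m * \<xi> ^ m)) (at \<xi>)"
    proof (rule termdiffs_strong'[where K = 1])
      show "summable (\<lambda>m. diffs a m * z ^ m)" if "cmod z < 1" for z
        using that a by (rule termdiff_converges)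
    qed (use \<xi> in simp)
    then show "isCont (\<lambda>\<xi>. \<Sum>m. diffs a m * \<xi> ^ m) \<xi>" by (rule DERIV_isCont)
  qed
  show "continuous_on (ball 0 1) antianalytic_deriv" "continuous_on (ball 0 1) analytic_deriv"
    unfolding antianalytic_deriv_def[abs_def] analytic_deriv_def[abs_def]
    by (rule cont, erule summable_parts)+
qed

text \<open>With \<open>z = cis x\<close>, this is \<open>\<partial>\<^sub>s - \<i> \<partial>\<^sub>x\<close> applied to the product of the cutoff and the Poisson
  extension: the operator annihilates the analytic part.\<close>

definition control :: "real \<Rightarrow> complex \<Rightarrow> complex"
  where "control s z = - 2 * cutoff (Q z) s * (of_real (exp (- s)) * cnj z * antianalytic_deriv (of_real (exp (- s)) * cnj z))
    + poisson_ext f s z * (cutoff_ds (Q z) s - \<i> * Q' z * cutoff_dy (Q z) s)"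

lemma poisson_ext_measurable [measurable]:
  assumes [measurable]: "u \<in> borel_measurable M" "v \<in> borel_measurable M"
  shows "(\<lambda>x. poisson_ext f (u x) (v x)) \<in> borel_measurable M"
  unfolding poisson_ext_def analytic_part_def antianalytic_part_def by measurable

lemma control_measurable [measurable]:
  assumes [measurable]: "u \<in> borel_measurable M" "v \<in> borel_measurable M"
  shows "(\<lambda>x. control (u x) (v x)) \<in> borel_measurable M"
  unfolding control_def antianalytic_deriv_def by measurable

lemma control_eq_0: "Q z \<le> s \<Longrightarrow> control s z = 0"
  by (simp add: control_def cutoff_eq_0)

text \<open>The test function for the n-th moment. It solves
  \<open>(\<partial>\<^sub>s - \<i> \<partial>\<^sub>x) wave = 0\<close>, so multiplying by it
  commutes with the operator.\<close>

definition wave :: "int \<Rightarrow> real \<Rightarrow> real \<Rightarrow> complex"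
  where "wave n s x = of_real (exp (n * s)) * cis (- (n * x))"

lemma cmod_radial: "s > 0 \<Longrightarrow> cmod (of_real (exp (- s)) * cis x) < 1"
  by (simp add: norm_mult)

lemma poisson_ext_cis:
  "poisson_ext f s (cis x) = analytic_part f (of_real (exp (- s)) * cis x)
    + antianalytic_part f (of_real (exp (- s)) * cis (- x))"
  by (simp add: poisson_ext_def cis_cnj)

lemma poisson_ext_derivative_s:
  assumes "s > 0"
  shows "((\<lambda>s. poisson_ext f s (cis x)) has_vector_derivative
    - (of_real (exp (- s)) * cis x * analytic_deriv (of_real (exp (- s)) * cis x))
    - of_real (exp (- s)) * cis (- x) * antianalytic_deriv (of_real (exp (- s)) * cis (- x))) (at s)"
proof -
  have d: "((\<lambda>s. of_real (exp (- s)) * cis y) has_vector_derivative - (of_real (exp (- s)) * cis y)) (at s)" for y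
  proof -
    have "((\<lambda>s. exp (- s)) has_real_derivative - exp (- s)) (at s)"
      by (auto intro!: derivative_eq_intros)
    from has_vector_derivative_mult_left[OF has_vector_derivative_of_real[OF this], of "cis y"]
    show ?thesis by simp
  qed
  from has_vector_derivative_add[OF
      field_vector_diff_chain_at[OF d parts_derivative(2)[OF cmod_radial[OF assms, of x]]]
      field_vector_diff_chain_at[OF d parts_derivative(1)[OF cmod_radial[OF assms, of "- x"]]]]
  show ?thesis
    unfolding poisson_ext_cis by (simp add: o_def)
qed

lemma poisson_ext_derivative_x:
  assumes "s > 0"
  shows "((\<lambda>x. poisson_ext f s (cis x)) has_vector_derivative
    \<i> * (of_real (exp (- s)) * cis x * analytic_deriv (of_real (exp (- s)) * cis x))
    - \<i> * (of_real (exp (- s)) * cis (- x) * antianalytic_deriv (of_real (exp (- s)) * cis (- x)))) (at x)"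
proof -
  have d1: "((\<lambda>x. of_real (exp (- s)) * cis x) has_vector_derivative of_real (exp (- s)) * (\<i> * cis x)) (at x)"
    by (rule has_vector_derivative_mult_right[OF cis_has_vector_derivative])
  have "((cis \<circ> uminus) has_vector_derivative (-1) *\<^sub>R (\<i> * cis (- x))) (at x)"
    by (rule vector_diff_chain_at[OF _ cis_has_vector_derivative]) (auto intro!: derivative_eq_intros)
  then have "((\<lambda>x. cis (- x)) has_vector_derivative - (\<i> * cis (- x))) (at x)"
    by (simp add: o_def)
  then have d2: "((\<lambda>x. of_real (exp (- s)) * cis (- x)) has_vector_derivative of_real (exp (- s)) * (- (\<i> * cis (- x)))) (at x)"
    by (rule has_vector_derivative_mult_right)
  from has_vector_derivative_add[OF
      field_vector_diff_chain_at[OF d1 parts_derivative(2)[OF cmod_radial[OF assms, of x]]]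
      field_vector_diff_chain_at[OF d2 parts_derivative(1)[OF cmod_radial[OF assms, of "- x"]]]]
  show ?thesis
    unfolding poisson_ext_cis by (simp add: o_def mult_ac)
qed

lemma wave_derivatives:
  "((\<lambda>s. wave n s x) has_vector_derivative n * wave n s x) (at s)"
  "((\<lambda>x. wave n s x) has_vector_derivative - (\<i> * n * wave n s x)) (at x)"
proof -
  have "((\<lambda>s. exp (n * s)) has_real_derivative n * exp (n * s)) (at s)"
    by (auto intro!: derivative_eq_intros)
  from has_vector_derivative_mult_left[OF has_vector_derivative_of_real[OF this], of "cis (- (n * x))"]
  show "((\<lambda>s. wave n s x) has_vector_derivative n * wave n s x) (at s)"
    by (simp add: wave_def[abs_def] mult.assoc)
  have "((cis \<circ> (\<lambda>x. - (n * x))) has_vector_derivative (- n) *\<^sub>R (\<i> * cis (- (n * x)))) (at x)"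
    by (rule vector_diff_chain_at[OF _ cis_has_vector_derivative]) (auto intro!: derivative_eq_intros)
  from has_vector_derivative_mult_right[OF this, of "of_real (exp (n * s))"]
  show "((\<lambda>x. wave n s x) has_vector_derivative - (\<i> * n * wave n s x)) (at x)"
    by (simp add: wave_def[abs_def] o_def scaleR_conv_of_real mult_ac)
qed

lemma continuous_Q_cis: "continuous_on S (\<lambda>p. Q (cis (snd p)))" "continuous_on S (\<lambda>p. Q' (cis (snd p)))"
  unfolding Q_def Q'_def by (intro continuous_intros)+

lemma continuous_cutoff:
  fixes g :: "'a::topological_space \<Rightarrow> real"
  assumes "continuous_on S g" "continuous_on S t" "\<And>p. p \<in> S \<Longrightarrow> t p > 0"
  shows "continuous_on S (\<lambda>p. cutoff (g p) (t p))" "continuous_on S (\<lambda>p. cutoff_dy (g p) (t p))"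
    "continuous_on S (\<lambda>p. cutoff_ds (g p) (t p))"
proof -
  have "(g p)\<^sup>2 + (t p)\<^sup>2 \<noteq> 0" if "p \<in> S" for p
    using assms(3)[OF that] by (simp add: sum_power2_eq_zero_iff)
  then show "continuous_on S (\<lambda>p. cutoff (g p) (t p))" "continuous_on S (\<lambda>p. cutoff_dy (g p) (t p))"
    "continuous_on S (\<lambda>p. cutoff_ds (g p) (t p))"
    unfolding cutoff_def cutoff_dy_def cutoff_ds_def
    by (auto intro!: continuous_intros assms)
qed

lemma continuous_radial:
  assumes "continuous_on (ball 0 1) g" "continuous_on S y" "S \<subseteq> {0<..} \<times> UNIV"
  shows "continuous_on S (\<lambda>p. g (of_real (exp (- fst p)) * cis (y p)))"
proof (rule continuous_on_compose2[OF assms(1)])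
  show "continuous_on S (\<lambda>p. of_real (exp (- fst p)) * cis (y p) :: complex)"
    by (intro continuous_intros assms)
  show "(\<lambda>p. of_real (exp (- fst p)) * cis (y p)) ` S \<subseteq> ball 0 1"
    using assms(3) cmod_radial by auto
qed

lemma continuous_poisson_ext_cis:
  assumes "S \<subseteq> {0<..} \<times> UNIV"
  shows "continuous_on S (\<lambda>p. poisson_ext f (fst p) (cis (snd p)))"
  unfolding poisson_ext_cis
  by (intro continuous_intros continuous_radial parts_continuous assms)

lemma continuous_wave: "continuous_on S (\<lambda>p. wave n (fst p) (snd p))"
  unfolding wave_def by (intro continuous_intros)

lemma continuous_control_cis:
  assumes "S \<subseteq> {0<..} \<times> UNIV"
  shows "continuous_on S (\<lambda>p. control (fst p) (cis (snd p)))"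
  unfolding control_def cis_cnj using assms
  by (auto intro!: continuous_intros continuous_radial[OF _ _ assms] parts_continuous continuous_cutoff
      continuous_Q_cis continuous_poisson_ext_cis assms)

text \<open>The operator is a derivation that annihilates \<open>wave\<close>, hence
  \<open>control\<close> times \<open>wave\<close> is the operator applied to cutoff times extension
  times wave, to which \<open>double_integral_FTC\<close> applies.\<close>

lemma integral_control_wave:
  assumes \<epsilon>: "0 < \<epsilon>" "\<epsilon> \<le> T"
  shows "integral {\<epsilon>..T} (\<lambda>s. integral {0..2*pi} (\<lambda>x. control s (cis x) * wave n s x))
    = - integral {0..2*pi} (\<lambda>x. cutoff (Q (cis x)) \<epsilon> * poisson_ext f \<epsilon> (cis x) * wave n \<epsilon> x)"
proof -
  define G where "G s x = poisson_ext f s (cis x)" for s x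
  \<comment> \<open>The analytic part has s-derivative -a and x-derivative \<i> a, which the
    operator combines to -a + a = 0. For the antianalytic part they are -b and -\<i> b, which give
    -2 b: the factor -2 in \<open>control\<close>.\<close>
  define a where "a s x = of_real (exp (- s)) * cis x * analytic_deriv (of_real (exp (- s)) * cis x)" for s x
  define b where "b s x = of_real (exp (- s)) * cis (- x) * antianalytic_deriv (of_real (exp (- s)) * cis (- x))" for s x
  define cut where "cut s x = complex_of_real (cutoff (Q (cis x)) s)" for s x
  define cuts where "cuts s x = complex_of_real (cutoff_ds (Q (cis x)) s)" for s x
  define cutx where "cutx s x = complex_of_real (cutoff_dy (Q (cis x)) s * Q' (cis x))" for s x
  define \<Phi> where "\<Phi> s x = cut s x * G s x * wave n s x" for s x
  define \<Phi>s where "\<Phi>s s x = cut s x * G s x * (n * wave n s x) + (cut s x * (- a s x - b s x) + cuts s x * G s x) * wave n s x" for s x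
  define \<Phi>x where "\<Phi>x s x = cut s x * G s x * (- (\<i> * n * wave n s x))
    + (cut s x * (\<i> * a s x - \<i> * b s x) + cutx s x * G s x) * wave n s x" for s x
  have "integral {\<epsilon>..T} (\<lambda>s. integral {0..2*pi} (\<lambda>x. \<Phi>s s x - \<i> * \<Phi>x s x)) = - integral {0..2*pi} (\<Phi> \<epsilon>)"
  proof (rule double_integral_FTC[OF \<epsilon>])
    fix s x :: real assume s: "s > 0"
    show "((\<lambda>s. \<Phi> s x) has_vector_derivative \<Phi>s s x) (at s)"
      unfolding \<Phi>_def \<Phi>s_def cut_def cuts_def G_def a_def b_def
      by (intro has_vector_derivative_mult wave_derivatives poisson_ext_derivative_s[OF s]
          has_vector_derivative_of_real cutoff_has_derivative_s[OF s])
    show "((\<lambda>x. \<Phi> s x) has_vector_derivative \<Phi>x s x) (at x)"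
      unfolding \<Phi>_def \<Phi>x_def cut_def cutx_def G_def a_def b_def
      by (intro has_vector_derivative_mult wave_derivatives poisson_ext_derivative_x[OF s]
          has_vector_derivative_of_real DERIV_chain2[OF cutoff_has_derivative_y[OF s]] Q_cis_derivative)
  next
    show "continuous_on ({0<..} \<times> UNIV) (\<lambda>(s, x). \<Phi>s s x)" "continuous_on ({0<..} \<times> UNIV) (\<lambda>(s, x). \<Phi>x s x)"
      unfolding \<Phi>s_def \<Phi>x_def cut_def cuts_def cutx_def G_def a_def b_def split_beta
      by (auto intro!: continuous_intros continuous_radial parts_continuous continuous_cutoff
          continuous_Q_cis continuous_poisson_ext_cis continuous_wave)
  next
    show "\<Phi> s (2 * pi) = \<Phi> s 0" for s
    proof -
      have "cis (2 * pi) = 1" "cis (- (n * (2 * pi))) = 1"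
        using cis_multiple_2pi[of 1] cis_multiple_2pi[of "- of_int n"] by (auto simp: mult.commute)
      then show ?thesis by (simp add: \<Phi>_def cut_def G_def wave_def)
    qed
    show "\<Phi> T x = 0" for x
      using Q_le(3)[of "cis x"] by (simp add: \<Phi>_def cut_def cutoff_eq_0)
  qed
  also have "(\<lambda>s x. \<Phi>s s x - \<i> * \<Phi>x s x) = (\<lambda>s x. control s (cis x) * wave n s x)"
  proof (intro ext)
    fix s x
    have "control s (cis x) = - 2 * cut s x * b s x + G s x * (cuts s x - \<i> * cutx s x)"
      by (simp add: control_def cut_def b_def G_def cuts_def cutx_def cis_cnj mult_ac)
    note eq = this
    show "\<Phi>s s x - \<i> * \<Phi>x s x = control s (cis x) * wave n s x"
      unfolding \<Phi>s_def \<Phi>x_def eq by (simp add: algebra_simps)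
  qed
  finally show ?thesis
    unfolding \<Phi>_def cut_def G_def by (simp add: mult.assoc)
qed

lemma wave_eq: "wave n s x = of_real (exp (n * s)) * cnj (cis x) powi n"
  by (simp add: wave_def cis_cnj cis_power_int)

lemma integral_continuous_circle:
  fixes g :: "complex \<Rightarrow> complex"
  assumes [measurable]: "g \<in> borel_measurable borel" and "continuous_on {0..2*pi} (\<lambda>x. g (cis x))"
  shows "(\<integral>z. g z \<partial>circle_measure) = integral {0..2*pi} (\<lambda>x. g (cis x))"
    and "integrable circle_measure g"
proof -
  have "set_integrable lborel {0..2*pi} (\<lambda>x. g (cis x))"
    using assms(2) by (rule borel_integrable_atLeastAtMost')
  then show "(\<integral>z. g z \<partial>circle_measure) = integral {0..2*pi} (\<lambda>x. g (cis x))" "integrable circle_measure g"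
    by (simp_all add: integral_circle integrable_circle_iff set_borel_integral_eq_integral)
qed

lemma continuous_slice:
  fixes F :: "real \<times> real \<Rightarrow> complex"
  assumes "\<And>S. S \<subseteq> {0<..} \<times> UNIV \<Longrightarrow> continuous_on S F" "s > 0"
  shows "continuous_on A (\<lambda>x. F (s, x))"
  by (rule continuous_on_compose2[OF assms(1)[of "{s} \<times> UNIV"]])
     (use assms(2) in \<open>auto intro!: continuous_intros\<close>)

lemma control_moment_eq:
  assumes \<epsilon>: "0 < \<epsilon>" "\<epsilon> \<le> T"
    and int: "set_integrable lborel {\<epsilon>..T} (\<lambda>s. of_real (exp (n * s)) * (\<integral>z. control s z * cnj z powi n \<partial>circle_measure))"
  shows "(LBINT s:{\<epsilon>..T}. of_real (exp (n * s)) * (\<integral>z. control s z * cnj z powi n \<partial>circle_measure))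
    = - of_real (exp (n * \<epsilon>)) * (\<integral>z. cutoff (Q z) \<epsilon> * cnj z powi n * poisson_ext f \<epsilon> z \<partial>circle_measure)"
proof -
  have 1: "of_real (exp (n * s)) * (\<integral>z. control s z * cnj z powi n \<partial>circle_measure)
      = integral {0..2*pi} (\<lambda>x. control s (cis x) * wave n s x)" if s: "s > 0" for s :: real
  proof -
    have "of_real (exp (n * s)) * (\<integral>z. control s z * cnj z powi n \<partial>circle_measure)
        = (\<integral>z. control s z * (of_real (exp (n * s)) * cnj z powi n) \<partial>circle_measure)"
      by (simp add: mult.left_commute[of "control _ _"])
    also have "\<dots> = integral {0..2*pi} (\<lambda>x. control s (cis x) * (of_real (exp (n * s)) * cnj (cis x) powi n))"
    proof (rule integral_continuous_circle)
      show "continuous_on {0..2*pi} (\<lambda>x. control s (cis x) * (of_real (exp (n * s)) * cnj (cis x) powi n))"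
        unfolding wave_eq[symmetric]
        by (rule continuous_slice[OF _ s, where F = "\<lambda>p. control (fst p) (cis (snd p)) * wave n (fst p) (snd p)",
              unfolded fst_conv snd_conv])
           (intro continuous_on_mult continuous_control_cis continuous_wave)
    qed measurable
    finally show ?thesis by (simp add: wave_eq)
  qed
  have 2: "of_real (exp (n * \<epsilon>)) * (\<integral>z. cutoff (Q z) \<epsilon> * cnj z powi n * poisson_ext f \<epsilon> z \<partial>circle_measure)
      = integral {0..2*pi} (\<lambda>x. cutoff (Q (cis x)) \<epsilon> * poisson_ext f \<epsilon> (cis x) * wave n \<epsilon> x)"
  proof -
    have "of_real (exp (n * \<epsilon>)) * (\<integral>z. cutoff (Q z) \<epsilon> * cnj z powi n * poisson_ext f \<epsilon> z \<partial>circle_measure)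
        = (\<integral>z. cutoff (Q z) \<epsilon> * poisson_ext f \<epsilon> z * (of_real (exp (n * \<epsilon>)) * cnj z powi n) \<partial>circle_measure)"
      unfolding integral_mult_right_zero[symmetric] by (simp add: mult_ac)
    also have "\<dots> = integral {0..2*pi} (\<lambda>x. cutoff (Q (cis x)) \<epsilon> * poisson_ext f \<epsilon> (cis x)
        * (of_real (exp (n * \<epsilon>)) * cnj (cis x) powi n))"
    proof (rule integral_continuous_circle)
      show "continuous_on {0..2*pi} (\<lambda>x. cutoff (Q (cis x)) \<epsilon> * poisson_ext f \<epsilon> (cis x)
          * (of_real (exp (n * \<epsilon>)) * cnj (cis x) powi n))"
        unfolding wave_eq[symmetric]
        by (rule continuous_slice[OF _ \<epsilon>(1), where F = "\<lambda>p. cutoff (Q (cis (snd p))) (fst p)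
              * poisson_ext f (fst p) (cis (snd p)) * wave n (fst p) (snd p)", unfolded fst_conv snd_conv])
           (auto intro!: continuous_intros continuous_cutoff continuous_Q_cis continuous_poisson_ext_cis continuous_wave)
    qed measurable
    finally show ?thesis by (simp add: wave_eq)
  qed
  have "(LBINT s:{\<epsilon>..T}. of_real (exp (n * s)) * (\<integral>z. control s z * cnj z powi n \<partial>circle_measure))
      = integral {\<epsilon>..T} (\<lambda>s. of_real (exp (n * s)) * (\<integral>z. control s z * cnj z powi n \<partial>circle_measure))"
    using int by (rule set_borel_integral_eq_integral)
  also have "\<dots> = integral {\<epsilon>..T} (\<lambda>s. integral {0..2*pi} (\<lambda>x. control s (cis x) * wave n s x))"
    using \<epsilon> by (intro integral_cong 1) auto
  finally show ?thesis
    using integral_control_wave[OF \<epsilon>, of n] 2 by simp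
qed

end

section \<open>Square integrability of the control\<close>

text \<open>Parseval's identity for polynomials in \<open>cnj z\<close>, which on the circle are
  combinations of the orthogonal modes of index - m. Fatou's lemma later passes to the full
  series.\<close>

lemma nn_integral_trigonometric_polynomial:
  "(\<integral>\<^sup>+z. ennreal ((cmod (\<Sum>m<N. a m * cnj z ^ m))\<^sup>2) \<partial>circle_measure)
    = ennreal (2 * pi * (\<Sum>m<N. (cmod (a m))\<^sup>2))"
proof -
  define p where "p n z = (\<Sum>m<n. a m * z powi (- int m))" for n and z :: complex
  have p: "square_integrable (p n) \<and> to_L2 (p n) = (\<Sum>m<n. mode (a m) (- int m))" for n
  proof (induction n)
    case 0
    then show ?case
      by (simp add: p_def[abs_def] square_integrable_zero to_L2_def zero_L2_circle.abs_eq)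
  next
    case (Suc n)
    have "p (Suc n) = (\<lambda>z. p n z + a n * z powi (- int n))"
      by (auto simp: p_def)
    then show ?case
      using Suc square_integrable_add[OF conjunct1[OF Suc] square_integrable_mode]
        to_L2_add[OF conjunct1[OF Suc] square_integrable_mode]
      by (simp add: mode_def)
  qed
  have "(\<integral>\<^sup>+z. ennreal ((cmod (\<Sum>m<N. a m * cnj z ^ m))\<^sup>2) \<partial>circle_measure)
      = (\<integral>\<^sup>+z. ennreal ((cmod (p N z))\<^sup>2) \<partial>circle_measure)"
  proof (rule nn_integral_cong_AE)
    show "AE z in circle_measure. ennreal ((cmod (\<Sum>m<N. a m * cnj z ^ m))\<^sup>2) = ennreal ((cmod (p N z))\<^sup>2)"
      using AE_circle_norm
    proof eventually_elim
      case (elim z)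
      then have "z * cnj z = 1"
        using complex_norm_square[of z] by simp
      then have "cnj z = inverse z"
        by (metis inverse_unique)
      then show ?case by (simp add: p_def power_int_minus power_inverse)
    qed
  qed
  also have "\<dots> = ennreal ((norm (\<Sum>m<N. mode (a m) (- int m)))\<^sup>2)"
    using norm_to_L2[of "p N"] p[of N] by simp
  also have "(norm (\<Sum>m<N. mode (a m) (- int m)))\<^sup>2 = 2 * pi * (\<Sum>m<N. (cmod (a m))\<^sup>2)"
    by (subst norm_sum_orthogonal) (auto simp: mode_orthogonal norm_mode sum_distrib_left)
  finally show ?thesis .
qed

lemma nn_integral_exp_decay:
  assumes "a > 0"
  shows "(\<integral>\<^sup>+s. ennreal (exp (- (a * s))) * indicator {0..} s \<partial>lborel) = ennreal (1 / a)"
proof -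
  have "(\<integral>\<^sup>+s. ennreal (exp (- (a * s))) * indicator {0..} s \<partial>lborel) = ennreal (0 - (- exp (- (a * 0)) / a))"
  proof (rule nn_integral_FTC_atLeast)
    show "((\<lambda>s. - exp (- (a * s)) / a) has_real_derivative exp (- (a * s))) (at s)" for s
      using assms by (auto intro!: derivative_eq_intros)
    have "filterlim (\<lambda>s. a * s) at_top at_top"
      using assms by (intro filterlim_tendsto_pos_mult_at_top[OF tendsto_const] filterlim_ident)
    then have "filterlim (\<lambda>s. - (a * s)) at_bot at_top"
      by (simp add: filterlim_uminus_at_bot)
    then have "((\<lambda>s. exp (- (a * s))) \<longlongrightarrow> 0) at_top"
      by (rule filterlim_compose[OF exp_at_bot])
    then have "((\<lambda>s. - exp (- (a * s)) / a) \<longlongrightarrow> - 0 / a) at_top"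
      by (intro tendsto_divide tendsto_minus tendsto_const) (use assms in auto)
    then show "((\<lambda>s. - exp (- (a * s)) / a) \<longlongrightarrow> 0) at_top" by simp
  qed auto
  then show ?thesis by simp
qed

context arc_control
begin

lemma antianalytic_deriv_sums:
  assumes "cmod \<xi> < 1"
  shows "(\<lambda>m. of_nat m * neg_coeff f m * \<xi> ^ m) sums (\<xi> * antianalytic_deriv \<xi>)"
proof -
  have "summable (\<lambda>m. diffs (neg_coeff f) m * \<xi> ^ m)"
    by (rule termdiff_converges[OF assms]) (rule summable_parts)
  then have "(\<lambda>m. \<xi> * (diffs (neg_coeff f) m * \<xi> ^ m)) sums (\<xi> * antianalytic_deriv \<xi>)"
    unfolding antianalytic_deriv_def by (intro sums_mult summable_sums)
  then have "(\<lambda>m. of_nat (Suc m) * neg_coeff f (Suc m) * \<xi> ^ Suc m) sums (\<xi> * antianalytic_deriv \<xi>)"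
    by (simp add: diffs_def mult_ac)
  then show ?thesis
    by (subst (asm) sums_Suc_iff) simp
qed

text \<open>By Parseval the energy at time s is 2 pi times the sum of m^2 |c_m|^2 exp (- 2 m s),
  with c_m the coefficient \<open>neg_coeff f m\<close>. Integrating in s divides by 2 m and leaves
  the weight m of condition (2). Truncated series are estimated, and Fatou is applied once in z and
  once in s.\<close>

lemma antianalytic_energy:
  assumes neg: "summable (\<lambda>m. real m * (cmod (neg_coeff f m))\<^sup>2)"
  shows "(\<integral>\<^sup>+s. \<integral>\<^sup>+z. ennreal (indicator {0<..} s
      * (cmod (of_real (exp (- s)) * cnj z * antianalytic_deriv (of_real (exp (- s)) * cnj z)))\<^sup>2)
      \<partial>circle_measure \<partial>lborel)
    \<le> ennreal (pi * (\<Sum>m. real m * (cmod (neg_coeff f m))\<^sup>2))"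
proof -
  define S where "S N s z = (\<Sum>m<N. (of_nat m * neg_coeff f m * of_real (exp (- s)) ^ m) * cnj z ^ m)" for N s z
  define g where "g N s z = ennreal (indicator {0<..} s * (cmod (S N s z))\<^sup>2)" for N s z
  have [measurable]: "case_prod (g N) \<in> borel_measurable (lborel \<Otimes>\<^sub>M circle_measure)" for N
    unfolding g_def S_def indicator_def greaterThan_iff by measurable
  have le: "(\<integral>\<^sup>+s. \<integral>\<^sup>+z. g N s z \<partial>circle_measure \<partial>lborel)
      \<le> ennreal (pi * (\<Sum>m. real m * (cmod (neg_coeff f m))\<^sup>2))" for N
  proof -
    have "(\<integral>\<^sup>+s. \<integral>\<^sup>+z. g N s z \<partial>circle_measure \<partial>lborel)
        \<le> (\<integral>\<^sup>+s. (\<Sum>m<N. ennreal (2 * pi * ((real m)\<^sup>2 * (cmod (neg_coeff f m))\<^sup>2))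
            * (ennreal (exp (- (2 * real m * s))) * indicator {0..} s)) \<partial>lborel)"
    proof (rule nn_integral_mono)
      fix s :: real
      show "(\<integral>\<^sup>+z. g N s z \<partial>circle_measure)
          \<le> (\<Sum>m<N. ennreal (2 * pi * ((real m)\<^sup>2 * (cmod (neg_coeff f m))\<^sup>2))
            * (ennreal (exp (- (2 * real m * s))) * indicator {0..} s))"
      proof (cases "s > 0")
        case True
        have "(\<integral>\<^sup>+z. g N s z \<partial>circle_measure)
            = ennreal (2 * pi * (\<Sum>m<N. (cmod (of_nat m * neg_coeff f m * of_real (exp (- s)) ^ m))\<^sup>2))"
          unfolding g_def S_def using True
          by (simp add: nn_integral_trigonometric_polynomial)
        also have "\<dots> = ennreal (\<Sum>m<N. 2 * pi * ((real m)\<^sup>2 * (cmod (neg_coeff f m))\<^sup>2) * exp (- (2 * real m * s)))"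
        proof (intro arg_cong[where f = ennreal], subst sum_distrib_left, intro sum.cong refl)
          fix m
          have "(exp (- s) ^ m)\<^sup>2 = exp (- (2 * real m * s))"
            by (simp add: power_mult[symmetric] exp_of_nat_mult[symmetric] mult_ac)
          then show "2 * pi * (cmod (of_nat m * neg_coeff f m * of_real (exp (- s)) ^ m))\<^sup>2
              = 2 * pi * ((real m)\<^sup>2 * (cmod (neg_coeff f m))\<^sup>2) * exp (- (2 * real m * s))"
            by (simp add: norm_mult norm_power power_mult_distrib)
        qed
        also have "\<dots> = (\<Sum>m<N. ennreal (2 * pi * ((real m)\<^sup>2 * (cmod (neg_coeff f m))\<^sup>2))
            * (ennreal (exp (- (2 * real m * s))) * indicator {0..} s))"
          using True by (subst sum_ennreal[symmetric]) (auto simp: ennreal_mult)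
        finally show ?thesis by simp
      qed (simp add: g_def)
    qed
    also have "\<dots> = (\<Sum>m<N. ennreal (2 * pi * ((real m)\<^sup>2 * (cmod (neg_coeff f m))\<^sup>2))
        * (\<integral>\<^sup>+s. ennreal (exp (- (2 * real m * s))) * indicator {0..} s \<partial>lborel))"
      by (subst nn_integral_sum) (auto simp: nn_integral_cmult)
    also have "\<dots> = (\<Sum>m<N. ennreal (pi * (real m * (cmod (neg_coeff f m))\<^sup>2)))"
    proof (intro sum.cong refl)
      fix m
      show "ennreal (2 * pi * ((real m)\<^sup>2 * (cmod (neg_coeff f m))\<^sup>2))
          * (\<integral>\<^sup>+s. ennreal (exp (- (2 * real m * s))) * indicator {0..} s \<partial>lborel)
          = ennreal (pi * (real m * (cmod (neg_coeff f m))\<^sup>2))"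
      \<comment> \<open>For m = 0 the integral over s is infinite, but its factor is 0 and the
        product is 0 in \<open>ennreal\<close>.\<close>
      proof (cases "m = 0")
        case False
        then show ?thesis
          by (subst nn_integral_exp_decay) (auto simp: ennreal_mult[symmetric] power2_eq_square)
      qed simp
    qed
    also have "\<dots> = ennreal (pi * (\<Sum>m<N. real m * (cmod (neg_coeff f m))\<^sup>2))"
      by (subst sum_ennreal) (auto simp: sum_distrib_left)
    also have "\<dots> \<le> ennreal (pi * (\<Sum>m. real m * (cmod (neg_coeff f m))\<^sup>2))"
      by (intro ennreal_leI mult_left_mono sum_le_suminf neg) auto
    finally show ?thesis .
  qed
  have "(\<integral>\<^sup>+s. \<integral>\<^sup>+z. ennreal (indicator {0<..} s
      * (cmod (of_real (exp (- s)) * cnj z * antianalytic_deriv (of_real (exp (- s)) * cnj z)))\<^sup>2)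
      \<partial>circle_measure \<partial>lborel) \<le> (\<integral>\<^sup>+s. \<integral>\<^sup>+z. liminf (\<lambda>N. g N s z) \<partial>circle_measure \<partial>lborel)"
  proof (rule nn_integral_mono, rule nn_integral_mono_AE)
    fix s :: real
    show "AE z in circle_measure. ennreal (indicator {0<..} s
        * (cmod (of_real (exp (- s)) * cnj z * antianalytic_deriv (of_real (exp (- s)) * cnj z)))\<^sup>2)
        \<le> liminf (\<lambda>N. g N s z)"
      using AE_circle_norm
    proof eventually_elim
      case (elim z)
      show ?case
      proof (cases "s > 0")
        case True
        define \<xi> where "\<xi> = of_real (exp (- s)) * cnj z"
        have "cmod \<xi> < 1" using True elim by (simp add: \<xi>_def norm_mult)
        from antianalytic_deriv_sums[OF this]
        have "(\<lambda>N. S N s z) \<longlonglongrightarrow> \<xi> * antianalytic_deriv \<xi>"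
          by (simp add: sums_def S_def \<xi>_def power_mult_distrib mult.assoc)
        then have "(\<lambda>N. g N s z) \<longlonglongrightarrow> ennreal (indicator {0<..} s * (cmod (\<xi> * antianalytic_deriv \<xi>))\<^sup>2)"
          unfolding g_def by (intro tendsto_intros)
        then show ?thesis
          unfolding \<xi>_def by (simp add: lim_imp_Liminf)
      qed simp
    qed
  qed
  also have "\<dots> \<le> (\<integral>\<^sup>+s. liminf (\<lambda>N. \<integral>\<^sup>+z. g N s z \<partial>circle_measure) \<partial>lborel)"
    by (intro nn_integral_mono nn_integral_liminf) measurable
  also have "\<dots> \<le> liminf (\<lambda>N. \<integral>\<^sup>+s. \<integral>\<^sup>+z. g N s z \<partial>circle_measure \<partial>lborel)"
    by (intro nn_integral_liminf) measurable
  also have "\<dots> \<le> ennreal (pi * (\<Sum>m. real m * (cmod (neg_coeff f m))\<^sup>2))"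
    by (rule Liminf_le) (auto intro: always_eventually le)
  finally show ?thesis .
qed

text \<open>Both constants carry the 2 of \<open>sum_power2_le\<close>: 8 = 2 * 2^2 from the factor
  -2 in \<open>control\<close>, and 128 = 2 * 8^2 because each of the two cutoff derivatives
  contributes at most 4 / Q z.\<close>

lemma control_square_le:
  assumes z: "cmod z = 1" and s: "s > 0"
  shows "(cmod (control s z))\<^sup>2
    \<le> 8 * (cmod (of_real (exp (- s)) * cnj z * antianalytic_deriv (of_real (exp (- s)) * cnj z)))\<^sup>2
      + 128 * (indicator {0<..<Q z} s * ((cmod (poisson_ext f s z))\<^sup>2 / (Q z)\<^sup>2))"
proof (cases "s < Q z")
  case True
  define b where "b = of_real (exp (- s)) * cnj z * antianalytic_deriv (of_real (exp (- s)) * cnj z)"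
  define e where "e = cutoff_ds (Q z) s - \<i> * Q' z * cutoff_dy (Q z) s"
  note bounds = cutoff_derivative_bounds[OF s True]
  have e: "cmod e \<le> 8 / Q z"
  proof -
    have "cmod e \<le> cmod (complex_of_real (cutoff_ds (Q z) s)) + cmod (\<i> * Q' z * cutoff_dy (Q z) s)"
      unfolding e_def by (rule norm_triangle_ineq4)
    also have "\<dots> = \<bar>cutoff_ds (Q z) s\<bar> + \<bar>Q' z\<bar> * \<bar>cutoff_dy (Q z) s\<bar>"
      by (simp add: norm_mult)
    also have "\<dots> \<le> 4 / Q z + 1 * (4 / Q z)"
      using bounds Q_le(4)[OF z] by (intro add_mono mult_mono) auto
    finally show ?thesis by simp
  qed
  have "(cmod (control s z))\<^sup>2 \<le> 2 * (cmod (- 2 * cutoff (Q z) s * b))\<^sup>2 + 2 * (cmod (poisson_ext f s z * e))\<^sup>2"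
    unfolding control_def b_def[symmetric] e_def[symmetric] by (rule sum_power2_le)
  also have "(cmod (- 2 * cutoff (Q z) s * b))\<^sup>2 \<le> (2 * cmod b)\<^sup>2"
    using bounds(1) cutoff_bounds(1)[of "Q z" s]
    by (intro power_mono) (auto simp: norm_mult intro: mult_left_le_one_le)
  also have "(cmod (poisson_ext f s z * e))\<^sup>2 \<le> (cmod (poisson_ext f s z) * (8 / Q z))\<^sup>2"
    unfolding norm_mult using e by (intro power_mono mult_left_mono) auto
  finally show ?thesis
    using True s by (simp add: b_def power_mult_distrib power_divide)
next
  case False
  then show ?thesis by (simp add: control_eq_0)
qed

lemma control_energy_finite:
  assumes neg: "summable (\<lambda>m. real m * (cmod (neg_coeff f m))\<^sup>2)"
    and f0: "AE w in circle_measure. Q w \<le> 0 \<longrightarrow> f w = 0"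
    and weight: "(\<integral>\<^sup>+w. ennreal ((cmod (f w))\<^sup>2 / Q w) \<partial>circle_measure) < \<infinity>"
  shows "(\<integral>\<^sup>+s. \<integral>\<^sup>+z. ennreal (indicator {0<..} s * (cmod (control s z))\<^sup>2) \<partial>circle_measure \<partial>lborel) < \<infinity>"
proof -
  define a where "a s z = ennreal (indicator {0<..} s
      * (cmod (of_real (exp (- s)) * cnj z * antianalytic_deriv (of_real (exp (- s)) * cnj z)))\<^sup>2)" for s z
  define b where "b s z = ennreal (indicator {0<..<Q z} s * ((cmod (poisson_ext f s z))\<^sup>2 / (Q z)\<^sup>2))" for s z
  have [measurable]: "case_prod a \<in> borel_measurable (lborel \<Otimes>\<^sub>M circle_measure)"
    "case_prod b \<in> borel_measurable (lborel \<Otimes>\<^sub>M circle_measure)"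
    unfolding a_def b_def antianalytic_deriv_def indicator_interval_eq indicator_def[of "{0<..}"] greaterThan_iff
    by measurable
  have "(\<integral>\<^sup>+s. \<integral>\<^sup>+z. ennreal (indicator {0<..} s * (cmod (control s z))\<^sup>2) \<partial>circle_measure \<partial>lborel)
      \<le> (\<integral>\<^sup>+s. \<integral>\<^sup>+z. 8 * a s z + 128 * b s z \<partial>circle_measure \<partial>lborel)"
  proof (rule nn_integral_mono, rule nn_integral_mono_AE)
    fix s :: real
    show "AE z in circle_measure. ennreal (indicator {0<..} s * (cmod (control s z))\<^sup>2) \<le> 8 * a s z + 128 * b s z"
      using AE_circle_norm
    proof eventually_elim
      case (elim z)
      show ?case
      proof (cases "s > 0")
        case True
        have "ennreal ((cmod (control s z))\<^sup>2) \<le> ennreal (8 * (cmod (of_real (exp (- s)) * cnj z * antianalytic_deriv (of_real (exp (- s)) * cnj z)))\<^sup>2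
            + 128 * (indicator {0<..<Q z} s * ((cmod (poisson_ext f s z))\<^sup>2 / (Q z)\<^sup>2)))"
          by (intro ennreal_leI control_square_le elim True)
        also have "\<dots> = 8 * a s z + 128 * b s z"
        proof -
          have "ennreal (8 * x + 128 * y) = 8 * ennreal x + 128 * ennreal y" if "0 \<le> x" "0 \<le> y" for x y
            using that by (simp add: ennreal_mult)
          note eq = this
          show ?thesis
            unfolding a_def b_def using True by (subst eq) auto
        qed
        finally show ?thesis using True by simp
      qed simp
    qed
  qed
  also have "\<dots> = 8 * (\<integral>\<^sup>+s. \<integral>\<^sup>+z. a s z \<partial>circle_measure \<partial>lborel) + 128 * (\<integral>\<^sup>+s. \<integral>\<^sup>+z. b s z \<partial>circle_measure \<partial>lborel)"
    by (simp add: nn_integral_add nn_integral_cmult)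
  also have "\<dots> \<le> 8 * ennreal (pi * (\<Sum>m. real m * (cmod (neg_coeff f m))\<^sup>2))
      + 128 * (24 * (\<integral>\<^sup>+w. ennreal ((cmod (f w))\<^sup>2 / Q w) \<partial>circle_measure))"
    unfolding a_def b_def
    by (intro add_mono mult_left_mono antianalytic_energy neg
        poisson_ext_weight_bound square_integrable Q_le Q_lipschitz f0) auto
  also have "\<dots> < \<infinity>"
    using weight by (auto simp: ennreal_mult_less_top)
  finally show ?thesis .
qed

section \<open>Exponential moments of the control\<close>

text \<open>On the circle Q vanishes only at the points of angle h and - h from c. Discarding them
  removes the points where the cutoff is discontinuous at s = 0, and the gap between the open arc
  and its closure.\<close>

lemma AE_Q_nonzero: "AE w in circle_measure. Q w \<noteq> 0"
proof -
  have "AE w in circle_measure. w \<noteq> c * cis h" "AE w in circle_measure. w \<noteq> c * cis (- h)"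
    by (rule AE_circle_singleton)+
  with AE_circle_norm show ?thesis
  proof eventually_elim
    case (elim w)
    have cc: "c * cnj c = 1" using c complex_norm_square[of c] by simp
    define v where "v = w * cnj c"
    have v: "(Re v)\<^sup>2 + (Im v)\<^sup>2 = 1"
      using elim(1) c unfolding cmod_power2[symmetric] v_def by (simp add: norm_mult)
    have w: "w = c * v" using cc by (simp add: v_def mult.left_commute)
    show ?case
    proof
      assume "Q w = 0"
      then have Re: "Re v = cos h" using \<kappa> unfolding Q_def v_def by simp
      have "(Im v)\<^sup>2 = (sin h)\<^sup>2"
        using v sin_cos_squared_add[of h] unfolding Re by linarith
      then have "Im v = sin h \<or> Im v = - sin h" by (simp add: power2_eq_iff)
      then have "v = cis h \<or> v = cis (- h)" using Re by (auto simp: complex_eq_iff)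
      then show False using elim w by auto
    qed
  qed
qed

text \<open>The identity on [\<epsilon>, T] is passed to \<epsilon> \<rightarrow> 0. The left side
  converges by dominated convergence; on the right, the cutoff tends to the indicator of Q > 0,
  which f absorbs since it vanishes elsewhere.\<close>

lemma control_moment:
  assumes f0: "AE w in circle_measure. Q w \<le> 0 \<longrightarrow> f w = 0"
    and int: "set_integrable lborel {0..T} (\<lambda>s. of_real (exp (n * s)) * (\<integral>z. control s z * cnj z powi n \<partial>circle_measure))"
  shows "(LBINT s:{0..T}. of_real (exp (n * s)) * (\<integral>z. control s z * cnj z powi n \<partial>circle_measure))
    = - (2 * pi * circle_coeff f n)"
proof -
  have T: "T > 0" using \<kappa> by linarith
  define N where "N s = of_real (exp (n * s)) * (\<integral>z. control s z * cnj z powi n \<partial>circle_measure)" for s :: real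
  define \<sigma> where "\<sigma> k = T / real (k + 2)" for k
  have \<sigma>: "0 < \<sigma> k" "\<sigma> k \<le> T" for k
    using T by (auto simp: \<sigma>_def field_simps)
  have \<sigma>0: "\<sigma> \<longlonglongrightarrow> 0"
    unfolding \<sigma>_def by (rule tendsto_divide_0[OF tendsto_const])
      (intro filterlim_at_top_imp_at_infinity filterlim_compose[OF filterlim_real_sequentially] filterlim_add_const_nat_at_top)
  define l where "l w = (if Q w > 0 then 1 else 0) * cnj w powi n" for w
  have [measurable]: "l \<in> borel_measurable borel" unfolding l_def by measurable
  have lim1: "(\<lambda>k. LBINT s:{\<sigma> k..T}. N s) \<longlonglongrightarrow> (LBINT s:{0..T}. N s)"
    unfolding set_lebesgue_integral_def
  proof (rule integral_dominated_convergence[where w = "\<lambda>s. norm (indicator {0..T} s *\<^sub>R N s)"])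
    have int': "integrable lborel (\<lambda>s. indicator {0..T} s *\<^sub>R N s)"
      using int by (simp add: set_integrable_def N_def)
    then show "integrable lborel (\<lambda>s. norm (indicator {0..T} s *\<^sub>R N s))"
      by (rule integrable_norm)
    show "(\<lambda>s. indicator {0..T} s *\<^sub>R N s) \<in> borel_measurable lborel"
      using int' by (rule borel_measurable_integrable)
    show "(\<lambda>s. indicator {\<sigma> k..T} s *\<^sub>R N s) \<in> borel_measurable lborel" for k
    proof -
      have "(\<lambda>s. indicator {\<sigma> k..T} s *\<^sub>R (indicator {0..T} s *\<^sub>R N s)) \<in> borel_measurable lborel"
        by (rule borel_measurable_scaleR[OF borel_measurable_indicator borel_measurable_integrable[OF int']]) simp
      also have "(\<lambda>s. indicator {\<sigma> k..T} s *\<^sub>R (indicator {0..T} s *\<^sub>R N s)) = (\<lambda>s. indicator {\<sigma> k..T} s *\<^sub>R N s)"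
        using \<sigma>(1)[of k] by (auto simp: indicator_def)
      finally show ?thesis .
    qed
    show "AE s in lborel. norm (indicator {\<sigma> k..T} s *\<^sub>R N s) \<le> norm (indicator {0..T} s *\<^sub>R N s)" for k
      using \<sigma>(1)[of k] by (intro AE_I2) (auto simp: indicator_def)
    show "AE s in lborel. (\<lambda>k. indicator {\<sigma> k..T} s *\<^sub>R N s) \<longlonglongrightarrow> indicator {0..T} s *\<^sub>R N s"
      using AE_lborel_singleton[of 0]
    proof eventually_elim
      case (elim s)
      have "\<forall>\<^sub>F k in sequentially. indicator {\<sigma> k..T} s *\<^sub>R N s = indicator {0..T} s *\<^sub>R N s"
      proof (cases "s > 0")
        case True
        have "\<forall>\<^sub>F k in sequentially. \<sigma> k < s"
          by (rule order_tendstoD(2)[OF \<sigma>0 True])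
        then show ?thesis by eventually_elim (use True in \<open>auto simp: indicator_def\<close>)
      next
        case False
        then have "\<not> \<sigma> k \<le> s" for k using \<sigma>(1)[of k] by linarith
        then show ?thesis using False elim by (auto simp: indicator_def)
      qed
      then show ?case by (rule tendsto_eventually)
    qed
  qed
  have "(\<lambda>k. \<integral>z. cutoff (Q z) (\<sigma> k) * cnj z powi n * poisson_ext f (\<sigma> k) z \<partial>circle_measure)
      \<longlonglongrightarrow> (\<integral>w. f w * l w \<partial>circle_measure)"
  proof (rule poisson_ext_weak_limit[OF f_integrable, where M = 2])
    show "cmod (cutoff (Q z) s * cnj z powi n) \<le> 2" if "cmod z = 1" for s z
      using cutoff_bounds[of "Q z" s] that by (simp add: norm_mult norm_power_int)
    show "AE w in circle_measure. \<forall>e>0. \<exists>d>0. \<forall>s z. 0 < s \<longrightarrow> s < d \<longrightarrow> cmod z = 1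
      \<longrightarrow> cmod (z - w) < d \<longrightarrow> cmod (cutoff (Q z) s * cnj z powi n - l w) \<le> e"
      using AE_circle_norm AE_Q_nonzero
    proof eventually_elim
      case (elim w)
      show ?case
      proof (intro allI impI)
        fix e :: real assume e: "e > 0"
        \<comment> \<open>At s = 0 the denominator of the cutoff is (Q w)^2, nonzero by the choice
          of w, so joint continuity at (0, w) holds and yields the neighbourhood required by the
          weak limit.\<close>
        have "isCont (\<lambda>p. cutoff (Q (snd p)) (fst p) * cnj (snd p) powi n) (0, w)"
          unfolding cutoff_def Q_def using elim
          by (intro continuous_intros) (auto simp: Q_def sum_power2_eq_zero_iff)
        then obtain d where d: "d > 0" and "\<And>p. dist p (0, w) < d \<Longrightarrow>
            dist (cutoff (Q (snd p)) (fst p) * cnj (snd p) powi n) (cutoff (Q w) 0 * cnj w powi n) < e"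
          unfolding continuous_at_eps_delta using e by (metis fst_conv snd_conv)
        then have d': "\<And>s z. dist (s, z) (0, w) < d \<Longrightarrow>
            dist (cutoff (Q z) s * cnj z powi n) (cutoff (Q w) 0 * cnj w powi n) < e"
          by fastforce
        have l: "cutoff (Q w) 0 * cnj w powi n = l w"
          using elim by (simp add: l_def cutoff_def max_def)
        have "cmod (cutoff (Q z) s * cnj z powi n - l w) \<le> e"
          if "0 < s" "s < d / 2" "cmod (z - w) < d / 2" for s z
        proof -
          have "dist (s, z) (0, w) \<le> \<bar>s\<bar> + cmod (z - w)"
            unfolding dist_Pair_Pair using sqrt_sum_squares_le_sum_abs[of "dist s 0" "dist z w"]
            by (simp add: dist_norm)
          also have "\<dots> < d" using that by simp
          finally show ?thesis
            using d'[of s z] unfolding l by (simp add: dist_norm)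
        qed
        then show "\<exists>d>0. \<forall>s z. 0 < s \<longrightarrow> s < d \<longrightarrow> cmod z = 1 \<longrightarrow> cmod (z - w) < d
            \<longrightarrow> cmod (cutoff (Q z) s * cnj z powi n - l w) \<le> e"
          using d by (intro exI[of _ "d / 2"]) auto
      qed
    qed
  qed (use \<sigma> \<sigma>0 in measurable)
  moreover have "(\<integral>w. f w * l w \<partial>circle_measure) = (\<integral>w. f w * cnj w powi n \<partial>circle_measure)"
  proof (rule integral_cong_AE)
    show "AE w in circle_measure. f w * l w = f w * cnj w powi n"
      using f0 by eventually_elim (auto simp: l_def)
  qed measurable
  moreover have "(\<lambda>k. complex_of_real (exp (n * \<sigma> k))) \<longlonglongrightarrow> complex_of_real (exp (real_of_int n * 0))"
    by (intro tendsto_intros \<sigma>0)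
  ultimately have "(\<lambda>k. - of_real (exp (n * \<sigma> k)) * (\<integral>z. cutoff (Q z) (\<sigma> k) * cnj z powi n * poisson_ext f (\<sigma> k) z \<partial>circle_measure))
      \<longlonglongrightarrow> - of_real (exp (real_of_int n * 0)) * (\<integral>w. f w * cnj w powi n \<partial>circle_measure)"
    by (intro tendsto_mult tendsto_minus) simp_all
  also have "(\<lambda>k. - of_real (exp (n * \<sigma> k)) * (\<integral>z. cutoff (Q z) (\<sigma> k) * cnj z powi n * poisson_ext f (\<sigma> k) z \<partial>circle_measure))
      = (\<lambda>k. LBINT s:{\<sigma> k..T}. N s)"
  proof
    fix k
    have "set_integrable lborel {\<sigma> k..T} N"
      unfolding N_def by (rule set_integrable_subset[OF int]) (use \<sigma>(1)[of k] in auto)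
    then show "- of_real (exp (n * \<sigma> k)) * (\<integral>z. cutoff (Q z) (\<sigma> k) * cnj z powi n * poisson_ext f (\<sigma> k) z \<partial>circle_measure)
        = (LBINT s:{\<sigma> k..T}. N s)"
      unfolding N_def by (rule control_moment_eq[OF \<sigma>, symmetric])
  qed
  finally have "(\<lambda>k. LBINT s:{\<sigma> k..T}. N s) \<longlonglongrightarrow> - (\<integral>w. f w * cnj w powi n \<partial>circle_measure)"
    by simp
  from LIMSEQ_unique[OF lim1 this] show ?thesis
    by (simp add: N_def circle_coeff_def)
qed

end

section \<open>From moments of a control to null controllability\<close>

lemma norm_fourier_le: "cmod (fourier f n) \<le> norm f"
proof (rule power2_le_imp_le)
  have "1 * (cmod (fourier f n))\<^sup>2 \<le> 2 * pi * (cmod (fourier f n))\<^sup>2"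
    using pi_gt3 by (intro mult_right_mono) auto
  also have "\<dots> \<le> (norm f)\<^sup>2"
    using bessel_inequality[of "{n}" f] by simp
  finally show "(cmod (fourier f n))\<^sup>2 \<le> (norm f)\<^sup>2"
    by (simp only: mult_1)
qed simp

text \<open>\<open>to_L2\<close> jumps to 0 at times whose section is not square integrable. These
  times are detected by a measurable function of s, the integral of the square, so the case
  distinction preserves measurability.\<close>

lemma to_L2_measurable_fourier:
  fixes v :: "real \<Rightarrow> complex \<Rightarrow> complex"
  assumes [measurable]: "case_prod v \<in> borel_measurable (lborel \<Otimes>\<^sub>M circle_measure)"
  shows "(\<lambda>s. fourier (to_L2 (v s)) n) \<in> borel_measurable borel"
proof -
  have z: "fourier 0 n = 0"
    by (rule linear_0[OF bounded_linear.linear[OF bounded_linear_fourier]])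
  have "fourier (to_L2 (v s)) n = (if (\<integral>\<^sup>+z. ennreal ((cmod (v s z))\<^sup>2) \<partial>circle_measure) < \<infinity>
      then circle_coeff (v s) n else 0)" for s
  proof -
    have [measurable]: "v s \<in> borel_measurable circle_measure"
      using measurable_Pair2[OF assms, of s] by simp
    have "square_integrable (v s) \<longleftrightarrow> (\<integral>\<^sup>+z. ennreal ((cmod (v s z))\<^sup>2) \<partial>circle_measure) < \<infinity>"
      by (simp add: square_integrable_def integrable_iff_bounded)
    then show ?thesis
      by (auto simp: fourier_to_L2) (simp add: to_L2_def z)
  qed
  moreover have "(\<lambda>s. circle_coeff (v s) n) \<in> borel_measurable lborel"
    unfolding circle_coeff_def by measurable
  ultimately show ?thesis by simp
qed

text \<open>From here on the construction of the control is irrelevant: U stands for any control of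
  finite energy that lives on \<omega> at positive times. What it steers is decided by its
  exponential moments alone.\<close>

locale moment_control =
  fixes \<omega> :: "complex set" and U :: "real \<Rightarrow> complex \<Rightarrow> complex" and T :: real
  assumes T: "T > 0" and \<omega> [measurable]: "\<omega> \<in> sets borel"
    and U [measurable]: "case_prod U \<in> borel_measurable (lborel \<Otimes>\<^sub>M circle_measure)"
    and outside: "\<And>s z. 0 < s \<Longrightarrow> cmod z = 1 \<Longrightarrow> z \<notin> \<omega> \<Longrightarrow> U s z = 0"
    and energy: "(\<integral>\<^sup>+s. \<integral>\<^sup>+z. ennreal (indicator {0<..} s * (cmod (U s z))\<^sup>2) \<partial>circle_measure \<partial>lborel) < \<infinity>"
begin

definition E :: "real \<Rightarrow> ennreal"
  where "E s = (\<integral>\<^sup>+z. ennreal (indicator {0<..} s * (cmod (U s z))\<^sup>2) \<partial>circle_measure)"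

lemma E_measurable [measurable]: "E \<in> borel_measurable borel"
proof -
  have "E \<in> borel_measurable lborel"
    unfolding E_def indicator_def greaterThan_iff by measurable
  then show ?thesis by simp
qed

lemma U_section_measurable [measurable]: "U s \<in> borel_measurable borel"
  using measurable_Pair2[OF U, of s] by (simp cong: measurable_cong_sets)

definition V :: "real \<Rightarrow> L2_circle"
  where "V s = extend0 \<omega> (\<lambda>z. U s z)"

text \<open>An integrable majorant of the norm of V: E is almost everywhere the squared norm and
  measurable by Tonelli, and x \<le> 1 + x^2 passes from the squared norm to the norm on the bounded
  interval.\<close>

definition bound :: "real \<Rightarrow> real"
  where "bound s = indicator {0..T} s * (1 + enn2real (E s))"

lemma integrable_bound: "integrable lborel bound"
proof -
  have "integrable lborel (\<lambda>s. enn2real (E s))"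
  proof (rule integrableI_bounded)
    have "(\<integral>\<^sup>+s. ennreal (norm (enn2real (E s))) \<partial>lborel) \<le> (\<integral>\<^sup>+s. E s \<partial>lborel)"
      by (intro nn_integral_mono) (simp add: ennreal_enn2real_if)
    also have "\<dots> < \<infinity>"
      using energy by (simp add: E_def)
    finally show "(\<integral>\<^sup>+s. ennreal (norm (enn2real (E s))) \<partial>lborel) < \<infinity>" .
  qed measurable
  then have "integrable lborel (\<lambda>s. indicator {0..T} s + indicator {0..T} s *\<^sub>R enn2real (E s))"
    by (intro Bochner_Integration.integrable_add integrable_mult_indicator integrable_real_indicator)
       (auto simp: less_imp_le[OF T])
  then show ?thesis
    by (simp add: bound_def[abs_def] algebra_simps)
qed

lemma AE_E_finite: "AE s in lborel. E s < \<infinity>"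
proof -
  have "integral\<^sup>N lborel E < \<infinity>"
    using energy by (simp only: E_def[abs_def])
  then have "AE s in lborel. E s \<noteq> \<infinity>"
    by (intro nn_integral_PInf_AE) auto
  then show ?thesis by (simp add: less_top)
qed

lemma AE_restricted_section:
  assumes "s > 0"
  shows "AE z in circle_measure. (if z \<in> \<omega> then U s z else 0) = U s z"
  using AE_circle_norm by eventually_elim (use assms outside in auto)

text \<open>At almost every time the energy is finite, so V avoids the junk value of
  \<open>to_L2\<close>; extending by 0 outside \<omega> changes U s only on a null set.\<close>

lemma AE_section: "AE s in lborel. s > 0 \<longrightarrow> square_integrable (U s)
    \<and> norm (V s) \<le> 1 + enn2real (E s)
    \<and> fourier (V s) n = (\<integral>z. U s z * cnj z powi n \<partial>circle_measure) / (2 * pi)"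
  using AE_E_finite
proof eventually_elim
  case (elim s)
  show ?case
  proof
    assume s: "s > 0"
    have Es: "E s = (\<integral>\<^sup>+z. ennreal ((cmod (U s z))\<^sup>2) \<partial>circle_measure)"
      using s by (simp add: E_def)
    have sq: "square_integrable (U s)"
      using elim unfolding square_integrable_def integrable_iff_bounded Es by simp
    define v where "v z = (if z \<in> \<omega> then U s z else 0)" for z
    have [measurable]: "v \<in> borel_measurable borel" unfolding v_def by measurable
    have AE: "AE z in circle_measure. v z = U s z"
      unfolding v_def by (rule AE_restricted_section[OF s])
    have sqv: "square_integrable v"
      by (rule square_integrableI_bound[where h = "\<lambda>z. (cmod (U s z))\<^sup>2"])
         (use sq in \<open>auto simp: v_def square_integrable_def cong: measurable_cong_sets\<close>)
    have V: "V s = to_L2 v"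
      unfolding V_def extend0_def v_def ..
    have "ennreal ((norm (V s))\<^sup>2) = (\<integral>\<^sup>+z. ennreal ((cmod (v z))\<^sup>2) \<partial>circle_measure)"
      unfolding V by (rule norm_to_L2[OF sqv])
    also have "\<dots> = E s"
      unfolding Es by (rule nn_integral_cong_AE) (use AE in eventually_elim, simp)
    finally have E_eq: "E s = ennreal ((norm (V s))\<^sup>2)" ..
    have "norm (V s) \<le> 1 + (norm (V s))\<^sup>2"
      using zero_le_power2[of "norm (V s) - 1/2"] by (simp add: power2_eq_square algebra_simps)
    then have "norm (V s) \<le> 1 + enn2real (E s)"
      unfolding E_eq by simp
    moreover have "fourier (V s) n = circle_coeff (U s) n"
      unfolding V fourier_to_L2[OF sqv] by (rule circle_coeff_cong_AE[OF AE]) measurable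
    ultimately show "square_integrable (U s) \<and> norm (V s) \<le> 1 + enn2real (E s)
        \<and> fourier (V s) n = (\<integral>z. U s z * cnj z powi n \<partial>circle_measure) / (2 * pi)"
      using sq by (simp add: circle_coeff_def)
  qed
qed

lemma AE_norm_V_le: "AE s in lborel. s \<in> {0..T} \<longrightarrow> norm (V s) \<le> bound s"
  using AE_section[of 0] AE_lborel_singleton[of 0]
  by eventually_elim (auto simp: bound_def)

lemma fourier_V_measurable [measurable]: "(\<lambda>s. fourier (V s) n) \<in> borel_measurable borel"
  unfolding V_def extend0_def
  by (rule to_L2_measurable_fourier) measurable

lemma L2_control: "L2_control \<omega> T (\<lambda>p. U (fst p) (snd p))"
proof -
  define M1 where "M1 = restrict_space lborel {0..T}"
  define M2 where "M2 = restrict_space circle_measure \<omega>"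
  interpret M2: finite_measure M2
    unfolding M2_def by (rule finite_measure_restrict_space) (simp_all add: circle.finite_measure_axioms)
  have id1: "(\<lambda>s. s) \<in> measurable M1 lborel" and id2: "(\<lambda>z. z) \<in> measurable M2 circle_measure"
    unfolding M1_def M2_def by (rule measurable_restrict_space1, simp)+
  have "(\<lambda>p. (fst p, snd p)) \<in> measurable (M1 \<Otimes>\<^sub>M M2) (lborel \<Otimes>\<^sub>M circle_measure)"
    by (intro measurable_Pair measurable_compose[OF measurable_fst id1] measurable_compose[OF measurable_snd id2])
  from measurable_compose[OF this U]
  have meas [measurable]: "(\<lambda>p. U (fst p) (snd p)) \<in> borel_measurable (M1 \<Otimes>\<^sub>M M2)"
    by simp
  have "integrable (M1 \<Otimes>\<^sub>M M2) (\<lambda>p. (cmod (U (fst p) (snd p)))\<^sup>2)"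
  proof (rule integrableI_bounded)
    have "(\<integral>\<^sup>+p. ennreal (norm ((cmod (U (fst p) (snd p)))\<^sup>2)) \<partial>(M1 \<Otimes>\<^sub>M M2))
        = (\<integral>\<^sup>+s. \<integral>\<^sup>+z. ennreal ((cmod (U s z))\<^sup>2) \<partial>M2 \<partial>M1)"
      by (subst M2.nn_integral_fst[symmetric]) auto
    also have "\<dots> = (\<integral>\<^sup>+s. (\<integral>\<^sup>+z. ennreal ((cmod (U s z))\<^sup>2) * indicator \<omega> z \<partial>circle_measure) * indicator {0..T} s \<partial>lborel)"
      unfolding M1_def M2_def by (simp add: nn_integral_restrict_space)
    also have "\<dots> \<le> (\<integral>\<^sup>+s. \<integral>\<^sup>+z. ennreal (indicator {0<..} s * (cmod (U s z))\<^sup>2) \<partial>circle_measure \<partial>lborel)"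
    proof (rule nn_integral_mono_AE)
      show "AE s in lborel. (\<integral>\<^sup>+z. ennreal ((cmod (U s z))\<^sup>2) * indicator \<omega> z \<partial>circle_measure) * indicator {0..T} s
          \<le> (\<integral>\<^sup>+z. ennreal (indicator {0<..} s * (cmod (U s z))\<^sup>2) \<partial>circle_measure)"
        using AE_lborel_singleton[of 0]
      proof eventually_elim
        case (elim s)
        show ?case
        proof (cases "0 < s \<and> s \<le> T")
          case True
          then show ?thesis
            by (auto intro!: nn_integral_mono simp: indicator_def)
        qed (use elim in \<open>auto simp: indicator_def\<close>)
      qed
    qed
    also have "\<dots> < \<infinity>" by (rule energy)
    finally show "(\<integral>\<^sup>+p. ennreal (norm ((cmod (U (fst p) (snd p)))\<^sup>2)) \<partial>(M1 \<Otimes>\<^sub>M M2)) < \<infinity>" .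
  qed measurable
  with meas show ?thesis
    unfolding L2_control_def M1_def M2_def Let_def by simp
qed

lemma integrable_bounded_coeff:
  assumes [measurable]: "k \<in> borel_measurable borel" and k: "\<And>s. s \<in> {0..T} \<Longrightarrow> cmod (k s) \<le> B"
  shows "integrable lborel (\<lambda>s. indicator {0..T} s *\<^sub>R (fourier (V s) n * k s))"
proof (rule Bochner_Integration.integrable_bound)
  show "integrable lborel (\<lambda>s. B * bound s)"
    using integrable_bound by simp
  show "AE s in lborel. norm (indicator {0..T} s *\<^sub>R (fourier (V s) n * k s)) \<le> norm (B * bound s)"
    using AE_norm_V_le
  proof eventually_elim
    case (elim s)
    show ?case
    proof (cases "s \<in> {0..T}")
      case True
      have "cmod (k s) * cmod (fourier (V s) n) \<le> B * bound s"
        using True elim k[OF True] norm_fourier_le[of "V s" n] order_trans[OF norm_ge_zero k[OF True]]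
        by (intro mult_mono) (auto intro: order_trans simp: bound_def)
      then show ?thesis using True by (simp add: norm_mult mult.commute)
    qed simp
  qed
qed measurable

lemma integrable_moment:
  "set_integrable lborel {0..T} (\<lambda>s. of_real (exp (real_of_int n * s)) * (\<integral>z. U s z * cnj z powi n \<partial>circle_measure))"
  and moment_eq: "(LBINT s:{0..T}. of_real (exp (real_of_int n * s)) * (\<integral>z. U s z * cnj z powi n \<partial>circle_measure))
    = 2 * pi * (LBINT s:{0..T}. fourier (V s) n * of_real (exp (real_of_int n * s)))"
proof -
  have [measurable]: "(\<lambda>s. \<integral>z. U s z * cnj z powi n \<partial>circle_measure) \<in> borel_measurable lborel"
    by measurable
  have AE: "AE s in lborel. indicator {0..T} s *\<^sub>R (of_real (exp (real_of_int n * s)) * (\<integral>z. U s z * cnj z powi n \<partial>circle_measure))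
      = 2 * pi * (indicator {0..T} s *\<^sub>R (fourier (V s) n * of_real (exp (real_of_int n * s))))"
    using AE_section[of n] AE_lborel_singleton[of 0]
    by eventually_elim (auto simp: indicator_def)
  have int: "integrable lborel (\<lambda>s. indicator {0..T} s *\<^sub>R (fourier (V s) n * of_real (exp (real_of_int n * s))))"
  proof (rule integrable_bounded_coeff)
    show "cmod (of_real (exp (real_of_int n * s))) \<le> exp (\<bar>real_of_int n\<bar> * T)" if "s \<in> {0..T}" for s
    proof -
      have "real_of_int n * s \<le> \<bar>real_of_int n\<bar> * T"
        using that by (intro mult_mono) auto
      then show ?thesis by simp
    qed
  qed measurable
  show "set_integrable lborel {0..T} (\<lambda>s. of_real (exp (real_of_int n * s)) * (\<integral>z. U s z * cnj z powi n \<partial>circle_measure))"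
    unfolding set_integrable_def
    by (subst integrable_cong_AE[OF _ _ AE]) (measurable, rule integrable_mult_right[OF int])
  show "(LBINT s:{0..T}. of_real (exp (real_of_int n * s)) * (\<integral>z. U s z * cnj z powi n \<partial>circle_measure))
    = 2 * pi * (LBINT s:{0..T}. fourier (V s) n * of_real (exp (real_of_int n * s)))"
    unfolding set_lebesgue_integral_def
    by (subst integral_cong_AE[OF _ _ AE]) (measurable, simp only: integral_mult_right_zero)
qed

text \<open>The Bochner integral is computed mode by mode. The truncations P N converge pointwise to
  the integrand and satisfy norm (P N s) \<le> norm (V s), so they are dominated by
  \<open>bound\<close>. By the moment hypothesis their integrals are minus the partial sums of
  \<open>semigroup_D T (riesz g)\<close>.\<close>

lemma H2_solution_eq_0:
  assumes moment: "\<And>n. (LBINT s:{0..T}. of_real (exp (real_of_int n * s)) * (\<integral>z. U s z * cnj z powi n \<partial>circle_measure))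
    = - (2 * pi * fourier g n)"
  shows "H2_solution \<omega> (\<lambda>p. U (fst p) (snd p)) (riesz g) T = 0"
proof -
  define F where "F s = semigroup_D (T - s) (riesz (V s))" for s
  define k where "k n s = complex_of_real (exp (- (real n * (T - s))))" for n s
  define P where "P N s = (\<Sum>n<N. mode (fourier (V s) (int n) * k n s) (int n))" for N s
  have [measurable]: "k n \<in> borel_measurable borel" for n
    unfolding k_def by measurable
  have mode_meas: "(\<lambda>x. mode x n) \<in> borel_measurable borel" for n
    by (intro borel_measurable_continuous_onI linear_continuous_on bounded_linear_mode)
  have [measurable]: "P N \<in> borel_measurable borel" for N
    unfolding P_def by (intro borel_measurable_sum measurable_compose[OF _ mode_meas]) measurable
  have lim: "(\<lambda>N. P N s) \<longlonglongrightarrow> F s" if "s \<in> {0..T}" for s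
    unfolding P_def F_def k_def using that by (intro semigroup_D_riesz_LIMSEQ) auto
  have P_le: "norm (P N s) \<le> norm (V s)" if s: "s \<in> {0..T}" for N s
  proof -
    define a where "a m = (if m \<ge> 0 then complex_of_real (exp (- (real_of_int m * (T - s)))) else 0)" for m :: int
    have "P N s = (\<Sum>m\<in>int ` {..<N}. mode (fourier (V s) m * a m) m)"
      unfolding P_def k_def by (subst sum.reindex) (auto simp: a_def)
    also have "norm \<dots> \<le> norm (V s)"
      by (rule norm_sum_multiplier_le) (use s in \<open>auto simp: a_def\<close>)
    finally show ?thesis .
  qed
  have coeff: "(\<integral>s. indicator {0..T} s *\<^sub>R (fourier (V s) (int n) * k n s) \<partial>lborel)
      = - (fourier g (int n) * of_real (exp (- (real n * T))))" for n
  proof -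
    have "(\<integral>s. indicator {0..T} s *\<^sub>R (fourier (V s) (int n) * k n s) \<partial>lborel)
        = (\<integral>s. of_real (exp (- (real n * T))) * (indicator {0..T} s *\<^sub>R (fourier (V s) (int n) * of_real (exp (real n * s)))) \<partial>lborel)"
    proof (intro Bochner_Integration.integral_cong refl)
      fix s
      have "exp (- (real n * (T - s))) = exp (- (real n * T)) * exp (real n * s)"
        by (simp add: exp_add[symmetric] algebra_simps)
      then show "indicator {0..T} s *\<^sub>R (fourier (V s) (int n) * k n s)
          = of_real (exp (- (real n * T))) * (indicator {0..T} s *\<^sub>R (fourier (V s) (int n) * of_real (exp (real n * s))))"
        by (simp add: k_def mult_ac)
    qed
    also have "\<dots> = of_real (exp (- (real n * T))) * (LBINT s:{0..T}. fourier (V s) (int n) * of_real (exp (real n * s)))"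
      unfolding set_lebesgue_integral_def by (rule integral_mult_right_zero)
    also have "(LBINT s:{0..T}. fourier (V s) (int n) * of_real (exp (real n * s))) = - fourier g (int n)"
    proof -
      define X where "X = (LBINT s:{0..T}. fourier (V s) (int n) * of_real (exp (real n * s)))"
      have "complex_of_real (2 * pi) * X = complex_of_real (2 * pi) * (- fourier g (int n))"
        unfolding X_def using trans[OF moment_eq[of "int n", symmetric] moment[of "int n"]] by simp
      then show ?thesis unfolding X_def[symmetric] by (subst (asm) mult_left_cancel) auto
    qed
    finally show ?thesis by simp
  qed
  have int: "integrable lborel (\<lambda>s. indicator {0..T} s *\<^sub>R (fourier (V s) (int n) * k n s))" for n
    by (rule integrable_bounded_coeff[where B = 1]) (auto simp: k_def)
  have P_int: "(\<integral>s. indicator {0..T} s *\<^sub>R P N s \<partial>lborel)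
      = - (\<Sum>n<N. mode (fourier g (int n) * of_real (exp (- (real n * T)))) (int n))" for N
  proof -
    have "(\<integral>s. indicator {0..T} s *\<^sub>R P N s \<partial>lborel)
        = (\<integral>s. (\<Sum>n<N. mode (indicator {0..T} s *\<^sub>R (fourier (V s) (int n) * k n s)) (int n)) \<partial>lborel)"
      unfolding P_def by (simp add: scaleR_sum_right linear_cmul[OF bounded_linear.linear[OF bounded_linear_mode]])
    also have "\<dots> = (\<Sum>n<N. mode (\<integral>s. indicator {0..T} s *\<^sub>R (fourier (V s) (int n) * k n s) \<partial>lborel) (int n))"
      by (subst Bochner_Integration.integral_sum)
         (auto intro!: integrable_bounded_linear[OF bounded_linear_mode] int sum.cong
            integral_bounded_linear[OF bounded_linear_mode])
    also have "\<dots> = (\<Sum>n<N. - mode (fourier g (int n) * of_real (exp (- (real n * T)))) (int n))"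
      unfolding coeff by (simp add: linear_neg[OF bounded_linear.linear[OF bounded_linear_mode]])
    finally show ?thesis by (simp add: sum_negf)
  qed
  have "(\<lambda>N. \<integral>s. indicator {0..T} s *\<^sub>R P N s \<partial>lborel) \<longlonglongrightarrow> (\<integral>s. indicator {0..T} s *\<^sub>R F s \<partial>lborel)"
  proof (rule integral_dominated_convergence[OF _ _ integrable_bound])
    have lim': "(\<lambda>N. indicator {0..T} s *\<^sub>R P N s) \<longlonglongrightarrow> indicator {0..T} s *\<^sub>R F s" for s
      using lim[of s] by (cases "s \<in> {0..T}") auto
    then show "AE s in lborel. (\<lambda>N. indicator {0..T} s *\<^sub>R P N s) \<longlonglongrightarrow> indicator {0..T} s *\<^sub>R F s"
      by simp
    \<comment> \<open>Measurability of the vector valued integrand is inherited from the finite sums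
      P N, each built from scalar coefficients.\<close>
    show "(\<lambda>s. indicator {0..T} s *\<^sub>R F s) \<in> borel_measurable lborel"
      by (rule borel_measurable_LIMSEQ_metric[OF _ lim']) measurable
    show "AE s in lborel. norm (indicator {0..T} s *\<^sub>R P N s) \<le> bound s" for N
      using AE_norm_V_le
    proof eventually_elim
      case (elim s)
      then show ?case
        using P_le[of s N] by (cases "s \<in> {0..T}") (auto simp: bound_def)
    qed
  qed measurable
  then have "(\<lambda>N. - (\<Sum>n<N. mode (fourier g (int n) * of_real (exp (- (real n * T)))) (int n)))
      \<longlonglongrightarrow> (LBINT s:{0..T}. F s)"
    unfolding P_int set_lebesgue_integral_def .
  moreover have "(\<lambda>N. - (\<Sum>n<N. mode (fourier g (int n) * of_real (exp (- (real n * T)))) (int n)))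
      \<longlonglongrightarrow> - semigroup_D T (riesz g)"
    using T by (intro tendsto_minus semigroup_D_riesz_LIMSEQ) auto
  ultimately have "(LBINT s:{0..T}. F s) = - semigroup_D T (riesz g)"
    by (rule LIMSEQ_unique)
  then show ?thesis
    unfolding H2_solution_def F_def V_def fst_conv snd_conv by simp
qed

end

section \<open>Arcs\<close>

text \<open>The support is defined through all open sets on which g vanishes almost everywhere;
  Lindelof's theorem reduces them to countably many, whose exceptional null sets can be
  united.\<close>

lemma AE_0_outside_L2_support:
  "AE z in circle_measure. z \<notin> L2_support g \<longrightarrow> rep_L2_circle g z = 0"
proof -
  define \<F> where "\<F> = {W. open W \<and> (AE w in circle_measure. w \<in> W \<longrightarrow> rep_L2_circle g w = 0)}"
  obtain \<F>' where \<F>': "\<F>' \<subseteq> \<F>" "countable \<F>'" "\<Union>\<F>' = \<Union>\<F>"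
    using Lindelof[of \<F>] unfolding \<F>_def by blast
  have "AE w in circle_measure. \<forall>W\<in>\<F>'. w \<in> W \<longrightarrow> rep_L2_circle g w = 0"
    using \<F>' by (subst AE_ball_countable) (auto simp: \<F>_def)
  with AE_circle_norm show ?thesis
  proof eventually_elim
    case (elim z)
    show ?case
    proof
      assume "z \<notin> L2_support g"
      then obtain W where "open W" "z \<in> W" "AE w in circle_measure. w \<in> W \<longrightarrow> rep_L2_circle g w = 0"
        using elim unfolding L2_support_def by auto
      then have "z \<in> \<Union>\<F>'" unfolding \<F>' by (auto simp: \<F>_def)
      then show "rep_L2_circle g z = 0" using elim by blast
    qed
  qed
qed

context
  fixes a b :: real and c :: complex and h :: real
  assumes ab: "0 < b - a" "b - a < 2 * pi"
  defines "c \<equiv> cis ((a + b) / 2)" and "h \<equiv> (b - a) / 2"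
begin

text \<open>Multiplication by \<open>cnj c\<close> rotates the midpoint of the arc to 1. Membership
  then means |angle| < h, and the cosine decreases on [0, pi]; h < pi because the interval is
  strict.\<close>

lemma mem_arc_iff:
  assumes z: "cmod z = 1"
  shows "z \<in> cis ` {a<..<b} \<longleftrightarrow> cos h < Re (z * cnj c)"
proof
  have h: "0 < h" "h < pi" using ab by (auto simp: h_def)
  assume "z \<in> cis ` {a<..<b}"
  then obtain x where x: "a < x" "x < b" "z = cis x" by auto
  define t where "t = x - (a + b) / 2"
  have t: "\<bar>t\<bar> < h" using x unfolding t_def h_def by (auto simp: abs_if field_simps)
  have "Re (z * cnj c) = cos \<bar>t\<bar>"
    by (simp add: x c_def cis_cnj cis_mult t_def)
  also have "\<dots> > cos h"
    using t h by (intro cos_monotone_0_pi) auto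
  finally show "cos h < Re (z * cnj c)" .
next
  have h: "0 < h" "h < pi" using ab by (auto simp: h_def)
  assume less: "cos h < Re (z * cnj c)"
  have n: "cmod (z * cnj c) = 1" using z by (simp add: c_def norm_mult)
  define t where "t = Arg (z * cnj c)"
  have t: "cis t = z * cnj c"
  proof -
    have "z * cnj c \<noteq> 0" using n by (metis norm_zero zero_neq_one)
    from cis_Arg[OF this] show ?thesis using n by (simp add: t_def sgn_div_norm)
  qed
  have tpi: "\<bar>t\<bar> \<le> pi"
    using Arg_bounded[of "z * cnj c"] by (auto simp: t_def)
  have "\<bar>t\<bar> < h"
  proof (rule ccontr)
    assume "\<not> \<bar>t\<bar> < h"
    then have "cos \<bar>t\<bar> \<le> cos h"
      using h tpi by (intro cos_monotone_0_pi_le) auto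
    moreover have "cos t = Re (z * cnj c)" using t by (metis cis.simps(1))
    ultimately show False using less by simp
  qed
  moreover have "z = cis ((a + b) / 2 + t)"
  proof -
    have "cis ((a + b) / 2 + t) = c * (z * cnj c)"
      by (simp add: cis_mult[symmetric] c_def t)
    also have "\<dots> = z * (c * cnj c)" by simp
    also have "c * cnj c = 1" by (simp add: c_def cis_cnj cis_mult)
    finally show ?thesis by simp
  qed
  ultimately show "z \<in> cis ` {a<..<b}"
    by (auto simp: h_def abs_less_iff field_simps intro!: image_eqI)
qed

lemma closure_arc_subset: "closure (cis ` {a<..<b}) \<subseteq> {z. cos h \<le> Re (z * cnj c)}"
proof (rule closure_minimal)
  show "cis ` {a<..<b} \<subseteq> {z. cos h \<le> Re (z * cnj c)}"
  proof
    fix z assume z: "z \<in> cis ` {a<..<b}"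
    then have "cmod z = 1" by auto
    from mem_arc_iff[OF this] z show "z \<in> {z. cos h \<le> Re (z * cnj c)}"
      by (simp del: times_complex.simps)
  qed
  show "closed {z. cos h \<le> Re (z * cnj c)}"
    by (intro closed_Collect_le continuous_intros)
qed

lemma arc_borel: "cis ` {a<..<b} \<in> sets borel"
proof -
  have "cis ` {a<..<b} = {z. cmod z = 1 \<and> cos h < Re (z * cnj c)}"
  proof (rule set_eqI)
    fix z
    show "z \<in> cis ` {a<..<b} \<longleftrightarrow> z \<in> {z. cmod z = 1 \<and> cos h < Re (z * cnj c)}"
      using mem_arc_iff[of z] by (cases "cmod z = 1") (auto simp del: times_complex.simps)
  qed
  also have "\<dots> \<in> sets borel" by measurable
  finally show ?thesis .
qed

text \<open>Both points lie in the closure of the arc but not in the arc. Inclusion and distinctness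
  suffice: the frontier is given as a set {\<zeta>_1, \<zeta>_2}, which two distinct points
  exhaust.\<close>

lemma endpoints_frontier:
  "{cis a, cis b} \<subseteq> top_of_set (sphere 0 1) frontier_of (cis ` {a<..<b})" "cis a \<noteq> cis b"
proof -
  have h: "0 < h" "h < pi" using ab by (auto simp: h_def)
  have sub: "cis ` {a<..<b} \<subseteq> sphere 0 1" by auto
  have ends: "cis a = c * cis (- h)" "cis b = c * cis h"
    by (simp_all add: c_def h_def cis_mult add_divide_distrib diff_divide_distrib)
  have cc: "c * cnj c = 1" by (simp add: c_def cis_cnj cis_mult)
  show "cis a \<noteq> cis b"
  proof
    assume "cis a = cis b"
    then have "cis (- h) = cis h" unfolding ends by (auto simp: c_def)
    then have "sin h = 0" by (simp add: complex_eq_iff)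
    then show False using sin_gt_zero[of h] h by simp
  qed
  have "cis a \<notin> cis ` {a<..<b}" "cis b \<notin> cis ` {a<..<b}"
  proof -
    have "Re (cis a * cnj c) = cos h" "Re (cis b * cnj c) = cos h"
    proof -
      have "c * v * cnj c = v" for v
        using cc by (simp add: mult.commute[of c] mult.assoc)
      note rotate = this
      show "Re (cis a * cnj c) = cos h" "Re (cis b * cnj c) = cos h"
        unfolding ends rotate by simp_all
    qed
    then show "cis a \<notin> cis ` {a<..<b}" "cis b \<notin> cis ` {a<..<b}"
      using mem_arc_iff[of "cis a"] mem_arc_iff[of "cis b"] by auto
  qed
  moreover have "top_of_set (sphere 0 1) interior_of (cis ` {a<..<b}) \<subseteq> cis ` {a<..<b}"
    by (rule interior_of_subset)
  moreover have "cis x \<in> top_of_set (sphere 0 1) closure_of (cis ` {a<..<b})" if "x \<in> {a..b}" for x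
  proof -
    have "cis ` closure {a<..<b} \<subseteq> closure (cis ` {a<..<b})"
      by (rule image_closure_subset) (auto intro!: continuous_intros closure_subset[THEN subsetD])
    then have "cis x \<in> closure (cis ` {a<..<b})"
      using that ab by auto
    then show ?thesis
      using sub by (simp add: closure_of_subtopology inf_absorb2)
  qed
  ultimately show "{cis a, cis b} \<subseteq> top_of_set (sphere 0 1) frontier_of (cis ` {a<..<b})"
    using ab unfolding frontier_of_def by auto
qed

text \<open>For v = z \<open>cnj c\<close> the product becomes v^2 - 2 v cos h + 1, and writing 1 as
  v \<open>cnj v\<close> turns it into v times the real number 2 (Re v - cos h). This ties the
  weight of condition (3) to Q.\<close>

lemma endpoint_distance_product:
  assumes z: "cmod z = 1"
  shows "cmod ((z - cis a) * (z - cis b)) = 2 * \<bar>Re (z * cnj c) - cos h\<bar>"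
proof -
  define v where "v = z * cnj c"
  have ends: "cis a = c * cis (- h)" "cis b = c * cis h"
    by (simp_all add: c_def h_def cis_mult add_divide_distrib diff_divide_distrib)
  have zv: "z = c * v"
    by (simp add: v_def c_def cis_cnj cis_mult mult.left_commute[of _ z])
  have vv: "v * cnj v = 1"
    using z complex_norm_square[of z] by (simp add: v_def c_def norm_mult cis_cnj cis_mult mult_ac)
  have hh: "cis (- h) * cis h = 1" "cis (- h) + cis h = 2 * of_real (cos h)"
    by (simp_all add: cis_mult complex_eq_iff)
  have "(v - cis (- h)) * (v - cis h) = v * v - v * (cis (- h) + cis h) + cis (- h) * cis h"
    by (simp add: algebra_simps)
  also have "\<dots> = v * (v + cnj v - 2 * of_real (cos h))"
    unfolding hh vv[symmetric] by (simp add: algebra_simps)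
  also have "\<dots> = v * of_real (2 * (Re v - cos h))"
    by (simp add: complex_add_cnj)
  finally have *: "(v - cis (- h)) * (v - cis h) = v * of_real (2 * (Re v - cos h))" .
  have "cmod v = 1" using z by (simp add: v_def c_def norm_mult)
  have "(z - cis a) * (z - cis b) = c * c * ((v - cis (- h)) * (v - cis h))"
    unfolding zv ends by (simp add: algebra_simps)
  then have "cmod ((z - cis a) * (z - cis b)) = cmod v * \<bar>2 * (Re v - cos h)\<bar>"
    unfolding * by (simp only: norm_mult norm_of_real) (simp add: c_def)
  then show ?thesis
    unfolding v_def[symmetric] \<open>cmod v = 1\<close> abs_mult by simp
qed

end

section \<open>Null controllability of the projection\<close>

lemma summable_neg_coeff:
  assumes "(\<lambda>n. \<bar>real_of_int n\<bar> * (cmod (fourier g n))\<^sup>2) summable_on {..<0}"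
  shows "summable (\<lambda>m. real m * (cmod (neg_coeff (rep_L2_circle g) m))\<^sup>2)"
proof (rule summable_on_imp_summable)
  have "bij_betw (\<lambda>m. - int m) {0<..} {..<0}"
    by (rule bij_betw_byWitness[where f' = "\<lambda>n. nat (- n)"]) auto
  then have "(\<lambda>m. \<bar>real_of_int (- int m)\<bar> * (cmod (fourier g (- int m)))\<^sup>2) summable_on {0<..}"
    using assms by (subst summable_on_reindex_bij_betw)
  then show "(\<lambda>m. real m * (cmod (neg_coeff (rep_L2_circle g) m))\<^sup>2) summable_on UNIV"
    by (rule summable_on_cong_neutral[THEN iffD1, rotated 3])
       (auto simp: neg_coeff_def fourier_eq_circle_coeff)
qed

theorem theorem1p7:
  fixes \<omega> :: "complex set" and \<zeta>\<^sub>1 \<zeta>\<^sub>2 :: complex and T :: real and g :: L2_circle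
  assumes "open_strict_interval \<omega>"
    and "top_of_set (sphere 0 1) frontier_of \<omega> = {\<zeta>\<^sub>1, \<zeta>\<^sub>2}"
    and "T > 0"
    and "L2_support g \<subseteq> closure \<omega>"
    and "(\<lambda>n. \<bar>real_of_int n\<bar> * (cmod (fourier g n))\<^sup>2) summable_on {..<0}"
    and "set_integrable lborel {0..2*pi}
           (\<lambda>t. (cmod (rep_L2_circle g (cis t)))\<^sup>2 / cmod ((cis t - \<zeta>\<^sub>1) * (cis t - \<zeta>\<^sub>2)))"
  shows "riesz g \<in> null_controllable_H2 \<omega> T"
proof -
  obtain a b where ab: "0 < b - a" "b - a < 2 * pi" and \<omega>: "\<omega> = cis ` {a<..<b}"
    using assms(1) unfolding open_strict_interval_def by blast
  define c where "c = cis ((a + b) / 2)"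
  define h where "h = (b - a) / 2"
  \<comment> \<open>The largest scale that \<open>arc_control\<close> admits.\<close>
  define \<kappa> where "\<kappa> = min (1 / 4) (T / 2)"
  define f where "f = rep_L2_circle g"
  have \<kappa>: "0 < \<kappa>" using assms(3) by (simp add: \<kappa>_def)
  interpret arc: arc_control f c \<kappa> h T
    by unfold_locales (use assms(3) square_integrable_rep in \<open>auto simp: \<kappa>_def c_def f_def\<close>)
  \<comment> \<open>The support hypothesis makes f vanish off the closed arc, hence where Q < 0; the
    remaining set Q = 0 is null.\<close>
  have f0: "AE z in circle_measure. arc.Q z \<le> 0 \<longrightarrow> f z = 0"
    using AE_0_outside_L2_support[of g] arc.AE_Q_nonzero
  proof eventually_elim
    case (elim z)
    show ?case
    proof
      assume "arc.Q z \<le> 0"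
      with elim have "arc.Q z < 0" by simp
      then have "\<not> cos h \<le> Re (z * cnj c)"
        using \<kappa> unfolding arc.Q_def by (simp add: mult_less_0_iff)
      then have "z \<notin> closure \<omega>"
        using closure_arc_subset[OF ab] unfolding \<omega> c_def h_def by blast
      then show "f z = 0" using elim assms(4) unfolding f_def by blast
    qed
  qed
  \<comment> \<open>The hypothesis does not say which \<zeta> is which end point, but the product is
    symmetric.\<close>
  have \<zeta>: "cmod ((z - \<zeta>\<^sub>1) * (z - \<zeta>\<^sub>2)) = cmod ((z - cis a) * (z - cis b))" for z
  proof -
    have "{cis a, cis b} \<subseteq> {\<zeta>\<^sub>1, \<zeta>\<^sub>2}" "cis a \<noteq> cis b"
      using endpoints_frontier[OF ab] assms(2) unfolding \<omega> by auto
    then show ?thesis by (auto simp: mult.commute)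
  qed
  have weight: "(\<integral>\<^sup>+w. ennreal ((cmod (f w))\<^sup>2 / arc.Q w) \<partial>circle_measure) < \<infinity>"
  proof -
    define F where "F z = (cmod (f z))\<^sup>2 / cmod ((z - \<zeta>\<^sub>1) * (z - \<zeta>\<^sub>2))" for z
    have [measurable]: "F \<in> borel_measurable borel" unfolding F_def by measurable
    have F: "integrable circle_measure F"
      using assms(6) by (subst integrable_circle_iff) (auto simp: F_def f_def)
    \<comment> \<open>The factor 2 / \<kappa> is the ratio between the product of distances and Q on
      the arc; where Q \<le> 0 the left integrand is 0 because f is.\<close>
    have "(\<integral>\<^sup>+w. ennreal ((cmod (f w))\<^sup>2 / arc.Q w) \<partial>circle_measure)
        \<le> (\<integral>\<^sup>+w. ennreal (norm (2 / \<kappa> * F w)) \<partial>circle_measure)"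
    proof (rule nn_integral_mono_AE)
      show "AE w in circle_measure. ennreal ((cmod (f w))\<^sup>2 / arc.Q w) \<le> ennreal (norm (2 / \<kappa> * F w))"
        using AE_circle_norm f0
      proof eventually_elim
        case (elim w)
        show ?case
        proof (cases "arc.Q w > 0")
          case True
          have "cmod ((w - \<zeta>\<^sub>1) * (w - \<zeta>\<^sub>2)) = 2 * \<bar>arc.Q w / \<kappa>\<bar>"
          proof -
            have "arc.Q w / \<kappa> = Re (w * cnj c) - cos h"
              using \<kappa> by (simp add: arc.Q_def)
            then show ?thesis
              using endpoint_distance_product[OF ab elim(1)] unfolding \<zeta> c_def[symmetric] h_def[symmetric]
              by (simp only:)
          qed
          also have "\<dots> = 2 / \<kappa> * arc.Q w" using True \<kappa> by simp
          finally have "F w = (cmod (f w))\<^sup>2 / (2 / \<kappa> * arc.Q w)"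
            unfolding F_def by simp
          then have "(cmod (f w))\<^sup>2 / arc.Q w = 2 / \<kappa> * F w"
            using \<kappa> by simp
          then show ?thesis
            by (simp only:) (rule ennreal_leI, simp only: real_norm_def abs_ge_self)
        qed (use elim in simp)
      qed
    qed
    also have "\<dots> < \<infinity>"
      using integrable_mult_right[OF F, of "2 / \<kappa>"] unfolding integrable_iff_bounded by blast
    finally show ?thesis .
  qed
  interpret moment_control \<omega> arc.control T
  proof
    show "\<omega> \<in> sets borel" unfolding \<omega> by (rule arc_borel[OF ab])
    show "case_prod arc.control \<in> borel_measurable (lborel \<Otimes>\<^sub>M circle_measure)"
      unfolding split_beta by measurable
    show "arc.control s z = 0" if "0 < s" "cmod z = 1" "z \<notin> \<omega>" for s z
    proof -
      have "Re (z * cnj c) - cos h \<le> 0"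
        using mem_arc_iff[OF ab that(2)] that(3) unfolding \<omega> c_def h_def by linarith
      then have "arc.Q z \<le> 0"
        unfolding arc.Q_def using \<kappa> by (simp add: mult_nonneg_nonpos)
      then show ?thesis using that by (intro arc.control_eq_0) auto
    qed
    show "(\<integral>\<^sup>+s. \<integral>\<^sup>+z. ennreal (indicator {0<..} s * (cmod (arc.control s z))\<^sup>2) \<partial>circle_measure \<partial>lborel) < \<infinity>"
      by (rule arc.control_energy_finite[OF _ f0 weight])
         (unfold f_def, rule summable_neg_coeff, rule assms)
  qed (rule assms)
  have "H2_solution \<omega> (\<lambda>p. arc.control (fst p) (snd p)) (riesz g) T = 0"
  proof (rule H2_solution_eq_0)
    show "(LBINT s:{0..T}. of_real (exp (real_of_int n * s)) * (\<integral>z. arc.control s z * cnj z powi n \<partial>circle_measure))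
      = - (2 * pi * fourier g n)" for n
      unfolding fourier_eq_circle_coeff f_def[symmetric]
      by (rule arc.control_moment[OF f0 integrable_moment])
  qed
  with L2_control show ?thesis
    unfolding null_controllable_H2_def H2_def by blast
qed

end
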